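(* Let $S_2\subset\mathbb{P}^3$ be the cubic surface $$S_2=\{[x_1,x_2,x_3,x_4]\in\mathbb{P}^3:\ x_1x_2(x_1+x_2)+x_4(x_1+x_2+x_3)^2=0\},$$ and let $U_2\subset S_2$ be the Zariski open subset obtained by deleting from $S_2$ the six lines $$x_i=x_4=0,\qquad x_1+x_2=x_j=0,\qquad x_i=x_1+x_2+x_3=0,\qquad (i\in\{1,2\},\ j\in\{3,4\}).$$ For $B\geq 1$ let $N_{U_2}(B)=\#\{x\in U_2(\mathbb{Q}): H(x)\leq B\}$. Then for all $B\geq 2$, $$N_{U_2}(B)\ll B(\log B)^6 .$$
   Context: For a point $x\in\mathbb{P}^{n-1}(\mathbb{Q})$ written as $x=[\mathbf{x}]$ with $\mathbf{x}=(x_1,\dots,x_n)\in\mathbb{Z}^n$ and $\gcd(x_1,\dots,x_n)=1$, the height is $H(x)=\max_i|x_i|$. The notation $A\ll B$ means $|A|\leq cB$ for an absolute constant $c>0$. *)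

theory Defs
  imports Complex_Main
begin

type_synonym vec4 = "int \<times> int \<times> int \<times> int"

definition primitive4 :: "vec4 \<Rightarrow> bool" where
  "primitive4 v = (case v of (a,b,c,d) \<Rightarrow> gcd (gcd a b) (gcd c d) = 1)"

definition height4 :: "vec4 \<Rightarrow> int" where
  "height4 v = (case v of (a,b,c,d) \<Rightarrow> max (max \<bar>a\<bar> \<bar>b\<bar>) (max \<bar>c\<bar> \<bar>d\<bar>))"

definition neg4 :: "vec4 \<Rightarrow> vec4" where
  "neg4 v = (case v of (a,b,c,d) \<Rightarrow> (-a,-b,-c,-d))"

definition on_S2 :: "vec4 \<Rightarrow> bool" where
  "on_S2 v = (case v of (a,b,c,d) \<Rightarrow> a*b*(a+b) + d*(a+b+c)^2 = 0)"

definition on_six_lines :: "vec4 \<Rightarrow> bool" where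
  "on_six_lines v = (case v of (a,b,c,d) \<Rightarrow>
      (a = 0 \<and> d = 0) \<or> (b = 0 \<and> d = 0) \<or>
      (a + b = 0 \<and> c = 0) \<or> (a + b = 0 \<and> d = 0) \<or>
      (a = 0 \<and> a + b + c = 0) \<or> (b = 0 \<and> a + b + c = 0))"

text \<open>Rational points of P^3 are identified with the classes {v, -v} of primitive
  integer vectors v.\<close>
definition U2_points :: "real \<Rightarrow> vec4 set set" where
  "U2_points B = {{v, neg4 v} | v. primitive4 v \<and> on_S2 v \<and> \<not> on_six_lines v
                                  \<and> real_of_int (height4 v) \<le> B}"

definition N_U2 :: "real \<Rightarrow> nat" where
  "N_U2 B = card (U2_points B)"

end

(* With x1 = a, x2 = b, x3 = -(a + b) and y = a + b + c the surface becomes x1 + x2 + x3 = 0,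
   x1 x2 x3 = d y^2, and outside the six lines all of x1, x2, x3, d, y are nonzero. A prime dividing all
   x_i divides exactly one of y and d, since the point is primitive. This leads to
   coordinates on the universal torsor: with W = w1 w2 w3 and c_i = w_i u_i^2,
     x_i = h w0^2 W c_i a_i,   |y| = w0^3 W^2 u1 u2 u3,   d = h^3 a1 a2 a3,
   where c1 a1 + c2 a2 + c3 a3 = 0 with pairwise coprime terms; one may order the |x_i|.

   Two counts of the solutions compete, both in dyadic boxes and both based on the fact that primitive
   pairs lying in one lattice of determinant m have slopes that are well spaced.
   (1) Fix h, w, u. Then a = (a1, a2, a3) lies on a plane, which gives O(1 + A1 A2 / c3) solutions.
       The terms A1 A2 / c3 add up to B (log B)^6.
   (2) Fix h, w, two of the a_i and the u_k for which w_k U_k^3 is smallest. The other two u's satisfy a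
       binary quadratic congruence modulo w_k u_k^2, so they lie in O(tau(w_k u_k^2)) lattices.
   With P of the size of the largest c_i |a_i|, and V of the size of u1 u2 u3, the term 1 in (1)
   contributes about B V / (w0^2 W P), and (2) gives about B P / (w0^2 W^(5/3) V) up to divisor
   functions. Switching from (2) to (1) where P = V W^(1/3) makes both sums over w0, w1, w2, w3 converge,
   so that the divisor functions cost no more than the available powers of log B. *)
theory Submission
  imports Defs "HOL-Analysis.Analysis" "HOL-Library.Discrete_Functions" "HOL-Computational_Algebra.Squarefree"
begin

section \<open>Points with spaced slopes\<close>

text \<open>Both counts reach the exponent 6, for different reasons. In count (2), tau(w u^2) <=
  tau(w) tau(u)^2. The factor tau(w) is harmless because the sums over w converge, but the sum of
  tau(u)^2 / u has size (log B)^4. This is affordable because a single u_k acts as modulus: each of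
  the other two u's costs one logarithm, the number of its dyadic ranges. In count (1), the sum over
  h converges, the sums over the sizes of a1 and a2 are geometric, and the sum over u3 restores the
  full power of B. Six harmonic sums remain, over w0, w1, w2, w3, u1 and u2. The smallest w_k U_k^3
  is chosen because it is at most the geometric mean of the three. The modulus w_k U_k^2 is then at
  most W^(1/3) times the product of the other two U's, so the summand 1 in the count of pairs costs
  at most W^(1/3). Hence W^(5/3), where density alone would give W^2.\<close>

lemma card_separated_le:
  fixes S :: "real set"
  assumes sub: "S \<subseteq> {lo..lo + len}" and d: "\<delta> > 0" and len: "len \<ge> 0"
    and sep: "\<And>s t. s \<in> S \<Longrightarrow> t \<in> S \<Longrightarrow> s \<noteq> t \<Longrightarrow> \<bar>s - t\<bar> \<ge> \<delta>"
  shows "finite S \<and> real (card S) \<le> 1 + len / \<delta>"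
proof -
  define f where "f = (\<lambda>s. \<lfloor>(s - lo) / \<delta>\<rfloor>)"
  have inj: "inj_on f S"
  proof (rule inj_onI, rule ccontr)
    fix s t assume st: "s \<in> S" "t \<in> S" "f s = f t" "s \<noteq> t"
    have "\<bar>(s - lo) / \<delta> - (t - lo) / \<delta>\<bar> < 1"
      using st(3) unfolding f_def by linarith
    moreover have "(s - lo) / \<delta> - (t - lo) / \<delta> = (s - t) / \<delta>"
      using d by (simp add: field_simps)
    ultimately have "\<bar>s - t\<bar> < \<delta>" using d by (simp add: abs_divide)
    with sep[OF st(1,2,4)] show False by simp
  qed
  have im: "f ` S \<subseteq> {0..\<lfloor>len / \<delta>\<rfloor>}"
  proof
    fix z assume "z \<in> f ` S"
    then obtain s where s: "s \<in> S" "z = f s" by auto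
    from sub s have "0 \<le> s - lo" "s - lo \<le> len" by auto
    with d show "z \<in> {0..\<lfloor>len / \<delta>\<rfloor>}" unfolding s(2) f_def
      by (auto intro!: floor_mono divide_right_mono)
  qed
  have "finite S" using finite_imageD[OF finite_subset[OF im] inj] by simp
  moreover have "card S \<le> nat (\<lfloor>len / \<delta>\<rfloor> + 1)"
    using card_inj_on_le[OF inj im] by simp
  moreover have "0 \<le> len / \<delta>" using d len by simp
  ultimately show ?thesis by linarith
qed

text \<open>A primitive pair with y > 0 is determined by its slope x / y, and two slopes differ by
  the determinant divided by y y', hence by at least \<delta> / (4 Y^2). All slopes lie in an
  interval of length 4 X / Y. The summand 1 survives in small boxes and is the source of every error
  term below.\<close>

lemma card_pairs_spaced_slopes:
  fixes S :: "(int \<times> int) set" and X Y \<delta> :: real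
  assumes X: "X > 0" and Y: "Y > 0" and d: "\<delta> > 0"
    and cop: "\<And>x y. (x,y) \<in> S \<Longrightarrow> coprime x y"
    and box: "\<And>x y. (x,y) \<in> S \<Longrightarrow> \<bar>real_of_int x\<bar> \<le> 2 * X \<and> Y \<le> real_of_int y \<and> real_of_int y \<le> 2 * Y"
    and sep: "\<And>x y x' y'. (x,y) \<in> S \<Longrightarrow> (x',y') \<in> S \<Longrightarrow> x * y' \<noteq> x' * y
        \<Longrightarrow> \<bar>real_of_int (x * y' - x' * y)\<bar> \<ge> \<delta>"
  shows "finite S \<and> real (card S) \<le> 1 + 16 * X * Y / \<delta>"
proof -
  define g :: "int \<times> int \<Rightarrow> real" where "g = (\<lambda>(x,y). real_of_int x / real_of_int y)"
  have ypos: "y > 0" if "(x,y) \<in> S" for x y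
    using box[OF that] Y by linarith
  have eqI: "x = x' \<and> y = y'" if "(x,y) \<in> S" "(x',y') \<in> S" "x * y' = x' * y" for x y x' y'
  proof -
    note p = ypos[OF that(1)] ypos[OF that(2)]
    have "y dvd x * y'" using that(3) by simp
    then have 1: "y dvd y'" using cop[OF that(1)] by (metis coprime_commute coprime_dvd_mult_right_iff)
    have "y' dvd x' * y" using that(3) by (metis dvd_triv_right)
    then have 2: "y' dvd y" using cop[OF that(2)] by (metis coprime_commute coprime_dvd_mult_right_iff)
    from 1 2 p have "y = y'" by (simp add: zdvd_antisym_nonneg)
    with that(3) p show ?thesis by simp
  qed
  have det: "g (x,y) - g (x',y') = real_of_int (x * y' - x' * y) / (y * y')"
    if "(x,y) \<in> S" "(x',y') \<in> S" for x y x' y'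
    using ypos[OF that(1)] ypos[OF that(2)] unfolding g_def by (simp add: field_simps)
  have inj: "inj_on g S"
  proof (rule inj_onI)
    fix p q assume pq: "p \<in> S" "q \<in> S" "g p = g q"
    obtain x y x' y' where e: "p = (x,y)" "q = (x',y')" by (metis surj_pair)
    have "x * y' = x' * y" using pq ypos[of x y] ypos[of x' y'] unfolding e g_def
      by (simp add: field_simps) (metis of_int_eq_iff of_int_mult)
    with eqI[of x y x' y'] pq e show "p = q" by auto
  qed
  have sepg: "\<bar>s - t\<bar> \<ge> \<delta> / (4 * Y^2)" if st: "s \<in> g ` S" "t \<in> g ` S" "s \<noteq> t" for s t
  proof -
    obtain x y x' y' where e: "(x,y) \<in> S" "s = g (x,y)" "(x',y') \<in> S" "t = g (x',y')" using st by auto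
    have ne: "x * y' \<noteq> x' * y"
      using eqI[OF e(1,3)] e st(3) by auto
    have yy: "0 < real_of_int y * real_of_int y'" using ypos[OF e(1)] ypos[OF e(3)] by simp
    have "real_of_int y * real_of_int y' \<le> (2 * Y) * (2 * Y)"
      using box[OF e(1)] box[OF e(3)] Y by (intro mult_mono) auto
    then have le: "real_of_int y * real_of_int y' \<le> 4 * Y^2" by (simp add: power2_eq_square)
    have "\<delta> / (4 * Y^2) \<le> \<delta> / (real_of_int y * real_of_int y')"
      by (rule frac_le) (use le yy d in auto)
    also have "\<dots> \<le> \<bar>real_of_int (x * y' - x' * y)\<bar> / (real_of_int y * real_of_int y')"
      using sep[OF e(1,3) ne] yy by (intro divide_right_mono) auto
    also have "\<dots> = \<bar>s - t\<bar>" unfolding e(2,4) det[OF e(1,3)] using yy by (simp add: abs_divide)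
    finally show ?thesis .
  qed
  have sub: "g ` S \<subseteq> {-(2 * X / Y)..-(2 * X / Y) + 4 * X / Y}"
  proof
    fix s assume "s \<in> g ` S"
    then obtain x y where e: "(x,y) \<in> S" "s = g (x,y)" by auto
    have yp: "real_of_int y > 0" using ypos[OF e(1)] by simp
    have "\<bar>s\<bar> = \<bar>real_of_int x\<bar> / y" using yp by (simp add: e g_def abs_divide)
    also have "\<dots> \<le> 2 * X / Y" using box[OF e(1)] Y X yp by (intro frac_le) auto
    finally have "\<bar>s\<bar> \<le> 2 * X / Y" .
    then have "-(2*X/Y) \<le> s" "s \<le> 2*X/Y" by auto
    moreover have "-(2 * X / Y) + 4 * X / Y = 2*X/Y" using Y by (simp add: field_simps)
    ultimately show "s \<in> {-(2 * X / Y)..-(2 * X / Y) + 4 * X / Y}" by simp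
  qed
  have "finite (g ` S) \<and> real (card (g ` S)) \<le> 1 + (4 * X / Y) / (\<delta> / (4 * Y^2))"
    by (rule card_separated_le[OF sub]) (use X Y d sepg in auto)
  moreover have "(4 * X / Y) / (\<delta> / (4 * Y^2)) = 16 * X * Y / \<delta>"
    using Y d by (simp add: field_simps power2_eq_square)
  ultimately show ?thesis using inj by (auto simp: card_image dest: finite_imageD)
qed

lemma card_le_sum_fibres:
  assumes "finite P" "f ` S \<subseteq> P" and "\<And>p. p \<in> P \<Longrightarrow> finite {s\<in>S. f s = p} \<and> real (card {s\<in>S. f s = p}) \<le> F p"
  shows "finite S \<and> real (card S) \<le> (\<Sum>p\<in>P. F p)"
proof -
  have eq: "S = (\<Union>p\<in>P. {s\<in>S. f s = p})" using assms(2) by auto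
  have fin: "finite S" by (subst eq) (use assms in auto)
  have "card S \<le> (\<Sum>p\<in>P. card {s\<in>S. f s = p})"
    by (subst eq) (rule card_UN_le[OF assms(1)])
  then have "real (card S) \<le> (\<Sum>p\<in>P. real (card {s\<in>S. f s = p}))"
    by (metis of_nat_le_iff of_nat_sum)
  also have "\<dots> \<le> (\<Sum>p\<in>P. F p)" using assms(3) by (intro sum_mono) auto
  finally show ?thesis using fin by simp
qed

text \<open>Eliminating c1 between two solutions shows that c3 divides c1 times the determinant of
  their (x, y) parts, and c1 is invertible modulo c3. So the slopes are spaced with \<delta> = c3,
  while z is recovered from x and y.\<close>

lemma card_plane_box_le:
  fixes c1 c2 c3 :: int and X Y :: real
  assumes c: "c3 > 0" "coprime c1 c3" and X: "X > 0" and Y: "Y > 0"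
    and S: "\<And>x y z. (x,y,z) \<in> S \<Longrightarrow> coprime x y \<and> c1 * x + c2 * y + c3 * z = 0 \<and>
        X \<le> \<bar>real_of_int x\<bar> \<and> \<bar>real_of_int x\<bar> \<le> 2 * X \<and> Y \<le> \<bar>real_of_int y\<bar> \<and> \<bar>real_of_int y\<bar> \<le> 2 * Y"
  shows "finite S \<and> real (card S) \<le> 2 * (1 + 16 * X * Y / c3)"
proof -
  have "finite {s\<in>S. fst (snd s) > 0 \<longleftrightarrow> b} \<and>
      real (card {s\<in>S. fst (snd s) > 0 \<longleftrightarrow> b}) \<le> 1 + 16 * X * Y / c3" for b
  proof -
    let ?R = "{s\<in>S. fst (snd s) > 0 \<longleftrightarrow> b}"
    \<comment> \<open>Slopes are compared for positive second coordinate. Since Y > 0, y is never 0,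
      and multiplying a sign class by \<open>e\<close> makes y positive. The two classes give the
      factor 2.\<close>
    define e :: int where "e = (if b then 1 else -1)"
    define f :: "int \<times> int \<times> int \<Rightarrow> int \<times> int" where "f = (\<lambda>(x,y,z). (e * x, e * y))"
    have e2: "e * e = 1" "\<bar>e\<bar> = 1" "e \<noteq> 0" by (auto simp: e_def)
    have inj: "inj_on f ?R"
    proof (rule inj_onI)
      fix p q assume pq: "p \<in> ?R" "q \<in> ?R" "f p = f q"
      obtain x y z x' y' z' where d: "p = (x,y,z)" "q = (x',y',z')" by (metis surj_pair)
      have xy: "x = x'" "y = y'" using pq(3) e2 by (auto simp: d f_def)
      have "c1 * x + c2 * y + c3 * z = 0" "c1 * x' + c2 * y' + c3 * z' = 0"
        using S[of x y z] S[of x' y' z'] pq by (auto simp: d)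
      then have "c3 * z = c3 * z'" unfolding xy by linarith
      then have "z = z'" using c(1) by simp
      then show "p = q" using xy d by simp
    qed
    have "finite (f ` ?R) \<and> real (card (f ` ?R)) \<le> 1 + 16 * X * Y / real_of_int c3"
    proof (rule card_pairs_spaced_slopes[OF X Y])
      show "0 < real_of_int c3" using c by simp
      fix x y assume "(x,y) \<in> f ` ?R"
      then obtain p q r where pq: "(p,q,r) \<in> S" "x = e * p" "y = e * q" "q > 0 \<longleftrightarrow> b" by (auto simp: f_def)
      note Sp = S[OF pq(1)]
      show "coprime x y" using Sp pq e_def by (auto split: if_splits)
      have yy: "y = \<bar>q\<bar>" using pq by (auto simp: e_def)
      have xx: "\<bar>x\<bar> = \<bar>p\<bar>" using pq by (auto simp: e_def)
      have "real_of_int y = \<bar>real_of_int q\<bar>" using yy by simp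
      moreover have "\<bar>real_of_int x\<bar> = \<bar>real_of_int p\<bar>" using xx by (metis of_int_abs)
      ultimately show "\<bar>real_of_int x\<bar> \<le> 2 * X \<and> Y \<le> real_of_int y \<and> real_of_int y \<le> 2 * Y"
        using Sp by auto
    next
      fix x y x' y' assume a: "(x,y) \<in> f ` ?R" "(x',y') \<in> f ` ?R" "x * y' \<noteq> x' * y"
      obtain p q r where pq: "(p,q,r) \<in> S" "x = e * p" "y = e * q" using a by (auto simp: f_def)
      obtain p' q' r' where pq': "(p',q',r') \<in> S" "x' = e * p'" "y' = e * q'" using a by (auto simp: f_def)
      have r: "c1 * p = - c2 * q - c3 * r" "c1 * p' = - c2 * q' - c3 * r'"
        using S[OF pq(1)] S[OF pq'(1)] by auto
      have "c1 * (p * q' - p' * q) = (c1 * p) * q' - (c1 * p') * q" by (simp add: algebra_simps)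
      also have "\<dots> = c3 * (r' * q - r * q')" unfolding r by (simp add: algebra_simps)
      finally have "c3 dvd c1 * (p * q' - p' * q)" by simp
      then have dv: "c3 dvd p * q' - p' * q" using c(2) by (metis coprime_commute coprime_dvd_mult_right_iff)
      have ee: "x * y' - x' * y = p * q' - p' * q"
        unfolding pq pq' using e2(1) by (metis (no_types, opaque_lifting) mult.assoc mult.commute mult.left_commute mult_1)
      have "p * q' - p' * q \<noteq> 0" using a(3) ee by auto
      with dv c have "c3 \<le> \<bar>p * q' - p' * q\<bar>" by (meson dvd_abs_iff zdvd_imp_le zero_less_abs_iff)
      then show "real_of_int c3 \<le> \<bar>real_of_int (x * y' - x' * y)\<bar>" unfolding ee by (metis of_int_abs of_int_le_iff)
    qed
    then show ?thesis using inj by (auto simp: card_image dest: finite_imageD)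
  qed
  then have "finite S \<and> real (card S) \<le> (\<Sum>b\<in>{True,False}. 1 + 16 * X * Y / real_of_int c3)"
    by (intro card_le_sum_fibres[where f = "\<lambda>s. fst (snd s) > 0"]) auto
  then show ?thesis by (simp add: algebra_simps)
qed

text \<open>No square root modulo m is extracted: one solution (x0, y0) serves as base point.
  Eliminating q2 against it shows that m divides (x y0 - x0 y) (x y0 + x0 y). The gcd D of the first
  factor with m sorts the solutions into at most tau(m) classes. In one class D and m / D divide one
  linear form each, so m divides twice the determinant of any two members.\<close>

lemma card_binary_conic_box_le:
  fixes q1 q2 m :: int and X Y :: real
  assumes m: "m > 0" "coprime q1 m" and X: "X > 0" and Y: "Y > 0"
    and S: "\<And>x y. (x,y) \<in> S \<Longrightarrow> coprime x y \<and> coprime x m \<and> coprime y m \<and> m dvd q1 * x^2 + q2 * y^2 \<and>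
        \<bar>real_of_int x\<bar> \<le> 2 * X \<and> Y \<le> real_of_int y \<and> real_of_int y \<le> 2 * Y"
  shows "finite S \<and> real (card S) \<le> card {d. d dvd nat m} * (1 + 32 * X * Y / m)"
proof (cases "S = {}")
  case True
  then show ?thesis using X Y m by simp
next
  case False
  then obtain x0 y0 where s0: "(x0,y0) \<in> S" by auto
  have fm: "finite {d. d dvd nat m}" using m(1) by simp
  define f where "f = (\<lambda>(x,y). nat (gcd (x * y0 - x0 * y) m))"
  have im: "f ` S \<subseteq> {d. d dvd nat m}"
    using m(1) by (auto simp: f_def nat_dvd_iff intro!: nat_dvd_iff[THEN iffD2])
  have prod: "m dvd (x * y0 - x0 * y) * (x * y0 + x0 * y)" if "(x,y) \<in> S" for x y
  proof -
    have "m dvd y0^2 * (q1 * x^2 + q2 * y^2) - y^2 * (q1 * x0^2 + q2 * y0^2)"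
      using S[OF that] S[OF s0] by (intro dvd_diff dvd_mult) auto
    also have "\<dots> = q1 * ((x * y0 - x0 * y) * (x * y0 + x0 * y))"
      by (simp add: algebra_simps power2_eq_square)
    finally show ?thesis using m(2) by (metis coprime_commute coprime_dvd_mult_right_iff)
  qed
  have c0: "coprime m y0" "coprime m x0" using S[OF s0] by (auto simp: coprime_commute)
  have fib: "finite {s\<in>S. f s = d} \<and> real (card {s\<in>S. f s = d}) \<le> 1 + 32 * X * Y / m"
    if "d \<in> {d. d dvd nat m}" for d
  proof -
    have "finite {s\<in>S. f s = d} \<and> real (card {s\<in>S. f s = d}) \<le> 1 + 16 * X * Y / (m / 2)"
    proof (rule card_pairs_spaced_slopes[OF X Y])
      show "0 < real_of_int m / 2" using m by simp
      fix x y x' y' assume a: "(x,y) \<in> {s\<in>S. f s = d}" "(x',y') \<in> {s\<in>S. f s = d}" "x * y' \<noteq> x' * y"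
      define D where "D = gcd (x * y0 - x0 * y) m"
      have Dpos: "D > 0" using m by (simp add: D_def)
      have "nat D = d" "nat (gcd (x' * y0 - x0 * y') m) = d" using a by (auto simp: f_def D_def)
      then have D': "D = gcd (x' * y0 - x0 * y') m" using Dpos by (metis eq_nat_nat_iff gcd_ge_0_int less_le)
      obtain E where E: "m = D * E" using D_def by (metis dvdE gcd_dvd2)
      have Epos: "E > 0" using E m Dpos by (simp add: zero_less_mult_iff)
      \<comment> \<open>Because D is the full gcd, the quotient of u y0 - x0 v by D is coprime to E
        = m / D, so E has to divide the other factor.\<close>
      have cof: "E dvd u * y0 + x0 * v" if uv: "(u,v) \<in> S" "D = gcd (u * y0 - x0 * v) m" for u v
      proof -
        obtain t where t: "u * y0 - x0 * v = D * t" using uv(2) by (metis dvdE gcd_dvd1)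
        have ct: "coprime E t"
        proof -
          have "D * gcd t E = gcd (D * t) (D * E)" using Dpos by (metis abs_of_pos gcd_mult_distrib_int)
          also have "\<dots> = D" unfolding t[symmetric] E[symmetric] using uv(2) by simp
          finally show ?thesis using Dpos by (simp add: coprime_iff_gcd_eq_1 gcd.commute)
        qed
        have "D * E dvd D * (t * (u * y0 + x0 * v))" using prod[OF uv(1)] E by (simp add: t mult.assoc)
        then have "E dvd t * (u * y0 + x0 * v)" using Dpos by simp
        then show ?thesis using ct by (simp add: coprime_dvd_mult_right_iff)
      qed
      have E1: "E dvd x * y0 + x0 * y" "E dvd x' * y0 + x0 * y'" using cof a D_def D' by auto
      have D1: "D dvd x * y0 - x0 * y" "D dvd x' * y0 - x0 * y'" using D_def D' by (metis gcd_dvd1)+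
      have Dm: "coprime D y0" and Em: "coprime E y0" using c0 E by auto
      let ?t = "x * y' - x' * y"
      have "D dvd y' * (x * y0 - x0 * y) - y * (x' * y0 - x0 * y')" using D1 by auto
      also have "\<dots> = y0 * ?t" by (simp add: algebra_simps)
      finally have Dt: "D dvd ?t" using Dm by (simp add: coprime_dvd_mult_right_iff)
      have "E dvd y' * (x * y0 + x0 * y) - y * (x' * y0 + x0 * y')" using E1 by auto
      also have "\<dots> = y0 * ?t" by (simp add: algebra_simps)
      finally have Et: "E dvd ?t" using Em by (simp add: coprime_dvd_mult_right_iff)
      \<comment> \<open>A common divisor of D and E divides the sum 2 x y0 of the two linear forms,
        and x and y0 are units modulo m. This factor 2 is why 16 becomes 32.\<close>
      have g2: "gcd D E dvd 2"
      proof -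
        have "gcd D E dvd (x * y0 + x0 * y) + (x * y0 - x0 * y)"
          using E1(1) D1(1) by (meson dvd_add dvd_trans gcd_dvd1 gcd_dvd2)
        then have "gcd D E dvd (2 * x) * y0" by (simp add: algebra_simps)
        moreover have "coprime (gcd D E) y0" using Dm by (meson coprime_divisors dvd_refl gcd_dvd1)
        ultimately have 1: "gcd D E dvd 2 * x" by (simp add: coprime_dvd_mult_left_iff)
        have "coprime D x" using S[of x y] a E by (auto simp: coprime_commute)
        then have "coprime (gcd D E) x" by (meson coprime_divisors dvd_refl gcd_dvd1)
        with 1 show ?thesis by (simp add: coprime_dvd_mult_left_iff)
      qed
      have "m dvd 2 * ?t"
      proof -
        have "m = gcd D E * lcm D E" using E Dpos Epos by (simp add: prod_gcd_lcm_int)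
        moreover have "lcm D E dvd ?t" using Dt Et by (rule lcm_least)
        ultimately show ?thesis using g2 mult_dvd_mono by metis
      qed
      moreover have "2 * ?t \<noteq> 0" using a(3) by simp
      ultimately have "m \<le> \<bar>2 * ?t\<bar>" using m by (meson dvd_abs_iff zdvd_imp_le zero_less_abs_iff)
      then have "real_of_int m \<le> \<bar>real_of_int (2 * ?t)\<bar>" by (metis of_int_abs of_int_le_iff)
      then show "real_of_int m / 2 \<le> \<bar>real_of_int ?t\<bar>" by (simp only: of_int_mult abs_mult) simp
    qed (use S in auto)
    then show ?thesis by simp
  qed
  have "finite S \<and> real (card S) \<le> (\<Sum>d\<in>{d. d dvd nat m}. 1 + 32 * X * Y / m)"
    by (rule card_le_sum_fibres[OF fm im fib])
  then show ?thesis by simp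
qed

section \<open>Divisor sums and dyadic sums\<close>

lemma card_divisors_mult_le:
  fixes m n :: nat
  assumes "m > 0" "n > 0"
  shows "card {d. d dvd m * n} \<le> card {d. d dvd m} * card {d. d dvd n}"
proof -
  have fin: "finite {d. d dvd m}" "finite {d. d dvd n}" using assms by auto
  have sub: "{d. d dvd m * n} \<subseteq> (\<lambda>(a,b). a * b) ` ({d. d dvd m} \<times> {d. d dvd n})"
  proof
    fix d assume "d \<in> {d. d dvd m * n}"
    then obtain a b where "d = a * b" "a dvd m" "b dvd n" by (metis division_decomp mem_Collect_eq)
    then show "d \<in> (\<lambda>(a,b). a * b) ` ({d. d dvd m} \<times> {d. d dvd n})" by force
  qed
  have "card {d. d dvd m * n} \<le> card ({d. d dvd m} \<times> {d. d dvd n})"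
    using surj_card_le[OF _ sub] fin by simp
  then show ?thesis by (simp add: card_cartesian_product)
qed

text \<open>A pair of w and a divisor d is a factorisation w = d e with d, e <= N, and g w = g d * g
  e. So the left side is a part of the expanded square on the right.\<close>

lemma sum_divisor_count_le:
  fixes g :: "nat \<Rightarrow> real"
  assumes g0: "\<And>n. n > 0 \<Longrightarrow> g n \<ge> 0" and gm: "\<And>m n. m > 0 \<Longrightarrow> n > 0 \<Longrightarrow> g (m * n) = g m * g n"
  shows "(\<Sum>w\<in>{1..N}. real (card {d. d dvd w}) * g w) \<le> (\<Sum>n\<in>{1..N}. g n)^2"
proof -
  have "(\<Sum>w\<in>{1..N}. real (card {d. d dvd w}) * g w) = (\<Sum>w\<in>{1..N}. \<Sum>d\<in>{d. d dvd w}. g w)"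
    by simp
  also have "\<dots> = (\<Sum>(w,d)\<in>Sigma {1..N} (\<lambda>w. {d. d dvd w}). g w)"
    by (rule sum.Sigma) auto
  also have "\<dots> \<le> (\<Sum>(a,b)\<in>{1..N} \<times> {1..N}. g a * g b)"
  proof (rule sum_le_included[where i = "\<lambda>(a,b). (a * b, a)"])
    show "\<forall>y\<in>{1..N} \<times> {1..N}. 0 \<le> (case y of (a, b) \<Rightarrow> g a * g b)" using g0 by auto
    show "\<forall>x\<in>SIGMA w:{1..N}. {d. d dvd w}.
       \<exists>y\<in>{1..N} \<times> {1..N}. (case y of (a, b) \<Rightarrow> (a * b, a)) = x \<and>
          (case x of (w, d) \<Rightarrow> g w) \<le> (case y of (a, b) \<Rightarrow> g a * g b)"
    proof safe
      fix w d :: nat assume w: "w \<in> {1..N}" "d dvd w"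
      then obtain e where e: "w = d * e" by auto
      then have "d > 0" "e > 0" using w by auto
      moreover have "d \<le> w" "e \<le> w" using w dvd_imp_le[of d w] dvd_imp_le[of e w] e by auto
      ultimately show "\<exists>y\<in>{1..N} \<times> {1..N}. (case y of (a, b) \<Rightarrow> (a * b, a)) = (w,d) \<and>
          g w \<le> (case y of (a, b) \<Rightarrow> g a * g b)"
        using w(1) gm[of d e] unfolding e[symmetric] by (intro bexI[of _ "(d,e)"]) (auto simp: e[symmetric])
    qed
  qed auto
  also have "\<dots> = (\<Sum>n\<in>{1..N}. g n)^2"
    by (simp add: sum_product sum.cartesian_product power2_eq_square)
  finally show ?thesis .
qed

text \<open>A pair of divisors $d, e$ of $u$ factors $u$ into the four numbers
  $\gcd(d,e)$, $d/\gcd(d,e)$, $e/\gcd(d,e)$ and $u/\mathrm{lcm}(d,e)$, which determine $u$, $d$ and $e$.\<close>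
lemma sum_divisor_count_square_le:
  "(\<Sum>u\<in>{1..N}. real (card {d. d dvd u})^2 / real u) \<le> (\<Sum>n\<in>{1..N}. 1 / real n)^4"
proof -
  let ?I = "{1..N}"
  let ?D = "\<lambda>u::nat. {d. d dvd u}"
  let ?g = "\<lambda>n. 1 / real n"
  have "(\<Sum>u\<in>?I. real (card (?D u))^2 / real u) = (\<Sum>u\<in>?I. \<Sum>p\<in>?D u \<times> ?D u. ?g u)"
    by (simp add: card_cartesian_product power2_eq_square)
  also have "\<dots> = (\<Sum>(u,p)\<in>Sigma ?I (\<lambda>u. ?D u \<times> ?D u). ?g u)"
    by (rule sum.Sigma) auto
  also have "\<dots> \<le> (\<Sum>(a,b,c,d)\<in>?I \<times> ?I \<times> ?I \<times> ?I. ?g a * (?g b * (?g c * ?g d)))"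
  proof (rule sum_le_included[where i = "\<lambda>(a,b,c,d). (a * b * c * d, a * b, a * c)"])
    show "\<forall>x\<in>Sigma ?I (\<lambda>u. ?D u \<times> ?D u).
       \<exists>y\<in>?I \<times> ?I \<times> ?I \<times> ?I. (case y of (a,b,c,d) \<Rightarrow> (a * b * c * d, a * b, a * c)) = x \<and>
          (case x of (u,p) \<Rightarrow> ?g u) \<le> (case y of (a,b,c,d) \<Rightarrow> ?g a * (?g b * (?g c * ?g d)))"
    proof safe
      fix u d e :: nat assume u: "u \<in> ?I" "d dvd u" "e dvd u"
      have d0: "d > 0" "e > 0" using u by (auto intro!: Nat.gr0I)
      obtain b c where bc: "d = gcd d e * b" "e = gcd d e * c" by (meson dvdE gcd_dvd1 gcd_dvd2)
      obtain z where z: "u = lcm d e * z" using u by (meson dvdE lcm_least)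
      define a where "a = gcd d e"
      have "lcm d e * a = d * e" by (simp add: a_def mult.commute)
      also have "\<dots> = (a * b * c) * a" using bc by (metis a_def mult.assoc mult.commute)
      finally have "lcm d e * a = (a * b * c) * a" .
      moreover have "a > 0" using d0 by (simp add: a_def)
      ultimately have "lcm d e = a * b * c" by (metis mult_right_cancel less_not_refl2)
      with z have uz: "u = a * b * c * z" by simp
      have pos: "a > 0" "b > 0" "c > 0" "z > 0" using uz u by (auto intro!: Nat.gr0I)
      have "a dvd u" "b dvd u" "c dvd u" "z dvd u" using uz by auto
      then have "a \<le> u" "b \<le> u" "c \<le> u" "z \<le> u" using u by (auto intro: dvd_imp_le)
      then have "(a,b,c,z) \<in> ?I \<times> ?I \<times> ?I \<times> ?I" using pos u(1) by auto
      then show "\<exists>y\<in>?I \<times> ?I \<times> ?I \<times> ?I. (case y of (a,b,c,d) \<Rightarrow> (a * b * c * d, a * b, a * c)) = (u,d,e) \<and>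
          ?g u \<le> (case y of (a,b,c,d) \<Rightarrow> ?g a * (?g b * (?g c * ?g d)))"
        by (rule bexI[rotated]) (simp add: uz bc[folded a_def] mult.assoc)
    qed
  qed auto
  also have "\<dots> = (\<Sum>a\<in>?I. \<Sum>b\<in>?I. \<Sum>c\<in>?I. \<Sum>d\<in>?I. ?g a * (?g b * (?g c * ?g d)))"
    by (simp only: sum.cartesian_product[symmetric])
  also have "\<dots> = (\<Sum>n\<in>?I. ?g n)^4"
    by (simp only: sum_distrib_left[symmetric] sum_distrib_right[symmetric]) (simp only: power4_eq_xxxx mult.assoc)
  finally show ?thesis .
qed

section \<open>Sums over dyadic scales, bounded by their largest terms\<close>

lemma sum_dyadic_powr_le:
  fixes p Q :: real
  assumes "finite I" "\<And>i. i \<in> I \<Longrightarrow> 2 ^ i \<le> Q" "p > 0" "Q > 0"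
  shows "(\<Sum>i\<in>I. (2 ^ i) powr p) \<le> Q powr p / (1 - 2 powr (-p))"
proof (cases "I = {}")
  case True
  have "2 powr (-p) < (1::real)" using assms by (simp add: powr_less_one)
  then show ?thesis using True by simp
next
  case False
  define n where "n = Max I"
  define r :: real where "r = 2 powr p"
  have r: "r > 1" using assms(3) by (simp add: r_def)
  have nI: "n \<in> I" and sub: "I \<subseteq> {..n}" using assms False by (auto simp: n_def)
  have pw: "(2 ^ i) powr p = r ^ i" for i :: nat
    by (simp add: r_def powr_powr powr_realpow[symmetric] mult.commute)
  \<comment> \<open>Distinct powers of r > 1 add up to at most the full geometric sum up to the
    largest of them, which is that power times 1 / (1 - 1/r).\<close>
  have "(\<Sum>i\<in>I. (2 ^ i) powr p) \<le> (\<Sum>i\<le>n. r ^ i)"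
    unfolding pw using sub r by (intro sum_mono2) auto
  also have "\<dots> = (r ^ Suc n - 1) / (r - 1)"
    using r by (simp only: lessThan_Suc_atMost[symmetric]) (rule geometric_sum, simp)
  also have "\<dots> \<le> r ^ Suc n / (r - 1)" using r by (intro divide_right_mono) auto
  also have "\<dots> = r ^ n / (1 - 2 powr (-p))"
    using r by (simp add: r_def powr_minus field_simps)
  also have "\<dots> \<le> Q powr p / (1 - 2 powr (-p))"
  proof (rule divide_right_mono)
    show "r ^ n \<le> Q powr p" unfolding pw[symmetric] using assms nI by (intro powr_mono2) auto
    have "2 powr (-p) < (1::real)" using assms by (simp add: powr_less_one)
    then show "0 \<le> 1 - 2 powr (-p)" by simp
  qed
  finally show ?thesis .
qed

lemma sum_dyadic_le:
  fixes Q :: real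
  assumes "finite I" "\<And>i. i \<in> I \<Longrightarrow> 2 ^ i \<le> Q" "Q > 0"
  shows "(\<Sum>i\<in>I. 2 ^ i) \<le> 2 * Q"
  using sum_dyadic_powr_le[of I Q 1] assms by simp

lemma sum_dyadic_sqrt_le:
  fixes Q :: real
  assumes "finite I" "\<And>i. i \<in> I \<Longrightarrow> 2 ^ i \<le> Q" "Q > 0"
  shows "(\<Sum>i\<in>I. (2 ^ i) powr (1/2)) \<le> 4 * Q powr (1/2)"
proof -
  \<comment> \<open>This makes 1 - 2^(-1/2) at least 1/4, whence the 4 in the statement.\<close>
  have "2 powr (-(1/2)) \<le> (3/4 :: real)"
  proof -
    have "(4/3::real) \<le> sqrt 2" by (rule real_le_rsqrt) (simp add: power2_eq_square)
    then have "inverse (sqrt 2) \<le> inverse (4/3::real)" by (intro le_imp_inverse_le) auto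
    then show ?thesis by (simp add: powr_minus powr_half_sqrt)
  qed
  then have "Q powr (1/2) / (1 - 2 powr (-(1/2))) \<le> Q powr (1/2) / (1/4)"
    by (intro divide_left_mono) auto
  then show ?thesis using sum_dyadic_powr_le[of I Q "1/2"] assms by simp
qed

text \<open>For fixed i the first constraint caps 2^j at sqrt (Z / 2^i), so the sum over j leaves a
  multiple of (Z 2^i)^(1/2). Together the two constraints give 2^(3 i) <= 4 \<kappa>^2 Z, which caps
  i. Both sums are geometric, so the sizes of a1 and a2 cost no logarithm in the main term.\<close>

lemma sum_dyadic_region_le:
  fixes Z \<kappa> :: real
  assumes fin: "finite R" and Z: "Z > 0" and k: "\<kappa> > 0"
    and R: "\<And>i j. (i,j) \<in> R \<Longrightarrow> 2 ^ i * (2 ^ j)^2 \<le> Z \<and> 2 ^ i \<le> 2 * \<kappa> * 2 ^ j"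
  shows "(\<Sum>(i,j)\<in>R. 2 ^ i * 2 ^ j) \<le> 16 * Z powr (2/3) * \<kappa> powr (1/3)"
proof -
  define T where "T = (\<lambda>i. {j. (i,j) \<in> R})"
  have fT: "finite (T i)" for i
    by (rule finite_subset[of _ "snd ` R"]) (use fin in \<open>force simp: T_def\<close>)+
  have ReqS: "R = Sigma (fst ` R) T" by (force simp: T_def)
  have "(\<Sum>(i,j)\<in>R. 2 ^ i * 2 ^ j) = (\<Sum>i\<in>fst ` R. \<Sum>j\<in>T i. 2 ^ i * (2 ^ j :: real))"
    by (subst ReqS, rule sum.Sigma[symmetric]) (use fin fT in auto)
  also have "\<dots> \<le> (\<Sum>i\<in>fst ` R. 2 * Z powr (1/2) * (2 ^ i) powr (1/2))"
  proof (rule sum_mono)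
    fix i assume i: "i \<in> fst ` R"
    have "(\<Sum>j\<in>T i. 2 ^ j) \<le> 2 * (Z / 2 ^ i) powr (1/2)"
    proof (rule sum_dyadic_le[OF fT])
      fix j assume "j \<in> T i"
      then have "2 ^ i * (2 ^ j)^2 \<le> Z" using R by (simp add: T_def)
      then have "(2 ^ j)^2 \<le> Z / 2 ^ i" by (simp add: field_simps)
      then show "2 ^ j \<le> (Z / 2 ^ i) powr (1/2)" using Z by (subst powr_half_sqrt) (auto intro: real_le_rsqrt)
    qed (use Z in simp)
    then have "2 ^ i * (\<Sum>j\<in>T i. 2 ^ j) \<le> 2 ^ i * (2 * (Z / 2 ^ i) powr (1/2))" by simp
    also have "\<dots> = 2 * Z powr (1/2) * (2 ^ i) powr (1/2)"
    proof -
      have "2 ^ i = (2 ^ i) powr (1/2) * ((2::real) ^ i) powr (1/2)"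
        by (simp add: powr_add[symmetric])
      then show ?thesis using Z by (simp add: powr_divide field_simps)
    qed
    finally show "(\<Sum>j\<in>T i. 2 ^ i * 2 ^ j) \<le> 2 * Z powr (1/2) * (2 ^ i) powr (1/2)"
      by (simp add: sum_distrib_left)
  qed
  also have "\<dots> = 2 * Z powr (1/2) * (\<Sum>i\<in>fst ` R. (2 ^ i) powr (1/2))" by (simp add: sum_distrib_left)
  also have "\<dots> \<le> 2 * Z powr (1/2) * (4 * ((4 * \<kappa>^2 * Z) powr (1/3)) powr (1/2))"
  proof (rule mult_left_mono[OF sum_dyadic_sqrt_le])
    fix i assume "i \<in> fst ` R"
    then obtain j where ij: "(i,j) \<in> R" by auto
    note r = R[OF ij]
    have "((2::real) ^ i)^3 = 2 ^ i * (2 ^ i)^2" by (simp add: power2_eq_square power3_eq_cube)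
    also have "\<dots> \<le> 2 ^ i * (2 * \<kappa> * 2 ^ j)^2" using r by (intro mult_left_mono power_mono) auto
    also have "\<dots> = 4 * \<kappa>^2 * (2 ^ i * (2 ^ j)^2)" by (simp add: power_mult_distrib)
    also have "\<dots> \<le> 4 * \<kappa>^2 * Z" using r by (intro mult_left_mono) auto
    finally have "(((2::real) ^ i)^3) powr (1/3) \<le> (4 * \<kappa>^2 * Z) powr (1/3)" by (intro powr_mono2) auto
    then show "2 ^ i \<le> (4 * \<kappa>^2 * Z) powr (1/3)"
      by (simp add: powr_realpow[symmetric] powr_powr)
  qed (use fin Z k in auto)
  also have "\<dots> = 8 * 4 powr (1/6) * Z powr (2/3) * \<kappa> powr (1/3)"
  proof -
    have "(\<kappa>^2) powr (1/6) = \<kappa> powr (1/3)" using k by (simp add: powr_realpow[symmetric] powr_powr del: powr_numeral)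
    moreover have "Z powr (1/2) * Z powr (1/6) = Z powr (2/3)" by (simp add: powr_add[symmetric])
    ultimately show ?thesis using Z k by (simp add: powr_powr powr_mult algebra_simps)
  qed
  also have "\<dots> \<le> 16 * Z powr (2/3) * \<kappa> powr (1/3)"
  proof -
    have "4 powr (1/6) \<le> (4::real) powr (1/2)" by (intro powr_mono) auto
    then have "4 powr (1/6) \<le> (2::real)" by (simp add: powr_half_sqrt)
    then show ?thesis by (intro mult_right_mono) auto
  qed
  finally show ?thesis .
qed

lemma sum_powr_minus_two_thirds_le:
  fixes Q :: real
  assumes "finite I" "\<And>n. n \<in> I \<Longrightarrow> n > 0 \<and> real n \<le> Q"
  shows "(\<Sum>n\<in>I. real n powr (-2/3)) \<le> 3 * Q powr (1/3)"
proof (cases "I = {}")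
  case False
  \<comment> \<open>If x and y are the cube roots of N + 1 and N, then 1 = x^3 - y^3 <= 3 (x - y)
    x^2. So the new term is at most 3 (x - y), and the bound telescopes.\<close>
  have key: "(\<Sum>n\<in>{1..N}. real n powr (-2/3)) \<le> 3 * real N powr (1/3)" for N :: nat
  proof (induction N)
    case (Suc N)
    define x where "x = real (Suc N) powr (1/3)"
    define y where "y = real N powr (1/3)"
    have x: "x > 0" "y \<ge> 0" "y \<le> x" by (auto simp: x_def y_def intro!: powr_mono2)
    have c: "x^3 = real (Suc N)" "y^3 = real N"
      by (auto simp: x_def y_def powr_realpow[symmetric] powr_powr)
         (cases "N = 0"; simp add: powr_powr powr_realpow[symmetric])
    have "x powr (-2) = real (Suc N) powr (-2/3)" by (simp add: x_def powr_powr)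
    then have e: "real (Suc N) powr (-2/3) = 1 / x^2"
      using x by (simp add: powr_minus_divide powr_numeral)
    have "1 = x^3 - y^3" using c by simp
    also have "\<dots> = (x - y) * (x^2 + x * y + y^2)" by (simp add: algebra_simps power2_eq_square power3_eq_cube)
    also have "\<dots> \<le> (x - y) * (x^2 + x * x + x^2)"
      using x by (intro mult_left_mono add_mono power_mono) auto
    finally have "1 \<le> 3 * (x - y) * x^2" by (simp add: power2_eq_square algebra_simps)
    then have "1 / x^2 \<le> 3 * (x - y)" using x by (simp add: field_simps)
    then have "real (Suc N) powr (-2/3) \<le> 3 * x - 3 * y" using e by simp
    then show ?case using Suc by (simp add: x_def y_def)
  qed simp
  have Q: "Q > 0" using assms False by fastforce
  have "I \<subseteq> {1..nat \<lfloor>Q\<rfloor>}" using assms(2) by (auto simp: Suc_le_eq le_nat_floor)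
  then have "(\<Sum>n\<in>I. real n powr (-2/3)) \<le> (\<Sum>n\<in>{1..nat \<lfloor>Q\<rfloor>}. real n powr (-2/3))"
    by (intro sum_mono2) auto
  also note key
  also have "3 * real (nat \<lfloor>Q\<rfloor>) powr (1/3) \<le> 3 * Q powr (1/3)"
    using Q by (intro mult_left_mono powr_mono2) auto
  finally show ?thesis .
qed simp

section \<open>Harmonic sums and the number of dyadic scales in terms of log B\<close>

lemma harmonic_sum_le:
  assumes "N \<ge> 1"
  shows "(\<Sum>n\<in>{1..N}. 1 / real n) \<le> 1 + ln (real N)"
  using assms
proof (induction N rule: nat_induct_at_least)
  case (Suc N)
  have "ln (real N / real (Suc N)) \<le> real N / real (Suc N) - 1"
    using Suc by (intro ln_le_minus_one) auto
  also have "\<dots> = - 1 / real (Suc N)" by (simp add: field_simps)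
  finally have "1 / real (Suc N) \<le> ln (real (Suc N)) - ln (real N)"
    using Suc by (simp add: ln_div)
  then show ?case using Suc by simp
qed simp

text \<open>For B >= 2 constants are absorbed by powers of B: 3 B <= B^3 and 6 B <= B^4. The last
  bound rests on ln 2 >= 2/3.\<close>

lemma ln_times_le:
  assumes "B \<ge> (2::real)"
  shows "ln (3 * B) \<le> 3 * ln B" "ln (6 * B) \<le> 4 * ln B" "1 \<le> 3/2 * ln B"
proof -
  have "ln 2 \<le> ln B" using assms by simp
  then show "1 \<le> 3/2 * ln B" using ln2_ge_two_thirds by linarith
  have B2: "2 * 2 \<le> B * B" using assms by (intro mult_mono) auto
  then have "3 * B \<le> B^2 * B" using assms by (intro mult_right_mono) (auto simp: power2_eq_square)
  then have "ln (3 * B) \<le> ln (B^3)" using assms by (simp add: power2_eq_square power3_eq_cube)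
  then show "ln (3 * B) \<le> 3 * ln B" using assms by (simp add: ln_realpow)
  have "2 * 4 \<le> B * (B * B)" using assms B2 by (intro mult_mono) auto
  then have "6 * B \<le> B^3 * B" using assms by (intro mult_right_mono) (auto simp: power3_eq_cube)
  then have "ln (6 * B) \<le> ln (B^4)" using assms by (intro ln_mono) (auto simp: power3_eq_cube power4_eq_xxxx)
  then show "ln (6 * B) \<le> 4 * ln B" using assms by (simp add: ln_realpow)
qed

text \<open>The range reaches 6 B because a dyadic block that starts at or below 3 B may end near 6
  B. The constant 6 covers 3/2 for the summand 1 and 4 for ln (6 B).\<close>

lemma harmonic_sum_le_ln:
  assumes "B \<ge> (2::real)" "N \<le> nat \<lfloor>6 * B\<rfloor>"
  shows "(\<Sum>n\<in>{1..N}. 1 / real n) \<le> 6 * ln B"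
proof -
  have "(\<Sum>n\<in>{1..N}. 1 / real n) \<le> (\<Sum>n\<in>{1..nat \<lfloor>6 * B\<rfloor>}. 1 / real n)"
    using assms by (intro sum_mono2) auto
  also have "\<dots> \<le> 1 + ln (real (nat \<lfloor>6 * B\<rfloor>))"
    using assms by (intro harmonic_sum_le) linarith
  also have "ln (real (nat \<lfloor>6 * B\<rfloor>)) \<le> ln (6 * B)"
    using assms by (intro ln_mono) linarith+
  finally show ?thesis using ln_times_le[OF assms(1)] by linarith
qed

text \<open>The largest exponent is at most 3 ln B / ln 2 <= (9/2) ln B, and the exponent 0 adds 1
  <= (3/2) ln B.\<close>

lemma card_dyadic_le_ln:
  assumes "B \<ge> (2::real)"
  shows "real (card {0..floor_log (nat \<lfloor>3 * B\<rfloor>)}) \<le> 6 * ln B"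
proof -
  let ?N = "nat \<lfloor>3 * B\<rfloor>"
  have N: "?N > 0" "real ?N \<le> 3 * B" using assms by linarith+
  have "(2::real) ^ floor_log ?N \<le> real ?N"
    using floor_log_exp2_le[OF N(1)] by (metis of_nat_le_iff of_nat_numeral of_nat_power)
  then have "(2::real) ^ floor_log ?N \<le> 3 * B" using N(2) by (rule order_trans)
  then have "ln ((2::real) ^ floor_log ?N) \<le> ln (3 * B)" by (intro ln_mono) auto
  then have "real (floor_log ?N) * ln 2 \<le> 3 * ln B" using ln_times_le[OF assms] by (simp add: ln_realpow)
  moreover have "real (floor_log ?N) * (2/3) \<le> real (floor_log ?N) * ln 2"
    using ln2_ge_two_thirds by (intro mult_left_mono) auto
  ultimately show ?thesis using ln_times_le[OF assms] by simp
qed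

section \<open>The universal torsor\<close>

text \<open>With c = gcd n t, the cofactor v of c in n is coprime to t / c and hence divides c. Then
  v^2 divides n, which forces v = 1.\<close>

lemma squarefree_dvd_square_imp_dvd:
  fixes n t :: nat
  assumes "squarefree n" "n dvd t^2" "t > 0"
  shows "n dvd t"
proof -
  define c where "c = gcd n t"
  have c0: "c > 0" using assms by (simp add: c_def)
  obtain v s where vs: "n = c * v" "t = c * s" "coprime v s"
    using gcd_coprime_exists[of n t] assms by (metis c_def gcd_eq_0_iff mult.commute not_gr_zero)
  have "c * v dvd c * (c * s^2)" using assms(2) vs by (simp add: power2_eq_square ac_simps)
  then have "v dvd c * s^2" using c0 by simp
  then have "v dvd c" using vs(3) by (simp add: coprime_dvd_mult_left_iff)
  then have "v^2 dvd n" using vs by (simp add: power2_eq_square)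
  then have "v = 1" using squarefreeD[OF assms(1)] by simp
  then show ?thesis using vs by simp
qed

text \<open>No prime factor of g divides both Y and D. The primes of g that divide Y are moved into
  k one at a time; what remains of g at the end is h.\<close>

lemma split_coprime_factors:
  fixes g Y D :: nat
  assumes "g > 0" "gcd g (gcd Y D) = 1"
  shows "\<exists>h k. g = h * k \<and> coprime h Y \<and> coprime k D"
  using assms
proof (induction g rule: less_induct)
  case (less g)
  show ?case
  proof (cases "coprime g Y")
    case True
    then show ?thesis by (intro exI[of _ g] exI[of _ 1]) simp
  next
    case False
    then obtain p where p: "prime p" "p dvd g" "p dvd Y"
      by (metis coprime_iff_gcd_eq_1 gcd_dvd1 gcd_dvd2 prime_factor_nat dvd_trans)
    have pD: "\<not> p dvd D"
      using less.prems(2) p by (metis gcd_greatest not_prime_unit)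
    obtain q where q: "g = p * q" using p by auto
    have "q > 0" "q < g" using q less.prems p prime_gt_1_nat[OF p(1)] by (auto intro!: Nat.gr0I)
    moreover have "gcd q (gcd Y D) = 1"
    proof -
      have "gcd q (gcd Y D) dvd gcd g (gcd Y D)" unfolding q by (intro gcd_mono) auto
      then show ?thesis using less.prems by simp
    qed
    ultimately obtain h k where "q = h * k" "coprime h Y" "coprime k D" using less.IH[of q] by auto
    moreover have "coprime p D" using p pD by (simp add: prime_imp_coprime)
    ultimately show ?thesis using q by (intro exI[of _ h] exI[of _ "p * k"]) auto
  qed
qed

text \<open>Since h is coprime to Y, its cube divides D. The cofactor of h^3 in D is coprime to k,
  so it divides Z1 Z2 Z3 and splits as A1 A2 A3. The cofactors b_i of the A_i satisfy k^3 b1 b2 b3 =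
  Y^2. Writing b_i = w_i u_i^2 with w_i squarefree, k has to be W times a square, and w0 is the root
  of that square.\<close>

lemma torsor_parametrization_nat:
  fixes g Z1 Z2 Z3 D Y :: nat
  assumes pos: "g > 0" "Z1 > 0" "Z2 > 0" "Z3 > 0" "D > 0" "Y > 0"
    and eq: "g^3 * (Z1 * Z2 * Z3) = D * Y^2" and cop: "gcd g (gcd Y D) = 1"
    and Z: "coprime Z1 Z2" "coprime Z1 Z3" "coprime Z2 Z3"
  shows "\<exists>h w0 w1 w2 w3 u1 u2 u3 A1 A2 A3.
     g = h * w0^2 * (w1 * w2 * w3) \<and> Z1 = w1 * u1^2 * A1 \<and> Z2 = w2 * u2^2 * A2 \<and> Z3 = w3 * u3^2 * A3
     \<and> Y = w0^3 * (w1 * w2 * w3)^2 * (u1 * u2 * u3)"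
proof -
  obtain h k where hk: "g = h * k" "coprime h Y" "coprime k D" using split_coprime_factors[OF pos(1) cop] by blast
  have hk0: "h > 0" "k > 0" using hk pos by auto
  have "h^3 dvd D * Y^2" unfolding eq[symmetric] hk by (simp add: power_mult_distrib)
  moreover have "coprime (h^3) (Y^2)" using hk by simp
  ultimately have "h^3 dvd D" by (simp add: coprime_dvd_mult_left_iff)
  then obtain E where E: "D = h^3 * E" by auto
  have "h^3 * (k^3 * (Z1 * Z2 * Z3)) = h^3 * (E * Y^2)"
    using eq by (simp add: hk E power_mult_distrib ac_simps)
  then have eq2: "k^3 * (Z1 * Z2 * Z3) = E * Y^2" using hk0 by simp
  have "coprime E (k^3)" using hk(3) E by (simp add: coprime_commute)
  moreover have "E dvd k^3 * (Z1 * Z2 * Z3)" unfolding eq2 by simp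
  ultimately have "E dvd Z1 * (Z2 * Z3)" by (simp add: coprime_dvd_mult_right_iff mult.assoc)
  then obtain A1 E' where A1: "E = A1 * E'" "A1 dvd Z1" "E' dvd Z2 * Z3" using division_decomp by blast
  then obtain A2 A3 where A2: "E' = A2 * A3" "A2 dvd Z2" "A3 dvd Z3" using division_decomp by blast
  obtain b1 b2 b3 where b: "Z1 = A1 * b1" "Z2 = A2 * b2" "Z3 = A3 * b3" using A1 A2 by (meson dvdE)
  have E0: "E > 0" using E pos by (auto intro!: Nat.gr0I)
  have "E * (k^3 * (b1 * b2 * b3)) = E * Y^2" using eq2 by (simp add: b A1 A2 ac_simps)
  then have eq3: "k^3 * (b1 * b2 * b3) = Y^2" using E0 by simp
  have b0: "b1 > 0" "b2 > 0" "b3 > 0" using b pos by (auto intro!: Nat.gr0I)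
  have bc: "coprime b1 b2" "coprime b1 b3" "coprime b2 b3" using Z unfolding b by auto
  define w1 w2 w3 where w: "w1 = squarefree_part b1" "w2 = squarefree_part b2" "w3 = squarefree_part b3"
  define u1 u2 u3 where u: "u1 = square_part b1" "u2 = square_part b2" "u3 = square_part b3"
  have bw: "b1 = w1 * u1^2" "b2 = w2 * u2^2" "b3 = w3 * u3^2"
    unfolding w u by (rule squarefree_decompose)+
  define W U where WU: "W = w1 * w2 * w3" "U = u1 * u2 * u3"
  have wc: "coprime w1 w2" "coprime w1 w3" "coprime w2 w3" using bc unfolding bw by auto
  \<comment> \<open>Pairwise coprimality of the b_i makes the whole product W squarefree, so that k
    W = t^2 below forces W to divide t.\<close>
  have "squarefree (w1 * w2)" unfolding w using wc[unfolded w] by (intro squarefree_mult_coprime) auto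
  then have sqW: "squarefree W" unfolding WU using wc by (intro squarefree_mult_coprime) (auto simp: w)
  have eq4: "(k * U)^2 * (k * W) = Y^2"
    using eq3 by (simp add: bw WU power2_eq_square power3_eq_cube ac_simps)
  then have "(k * U)^2 dvd Y^2" by (metis dvd_triv_left)
  then have "k * U dvd Y" by simp
  then obtain t where t: "Y = k * U * t" by auto
  have t0: "t > 0" "k * U > 0" using t pos by auto
  have "(k * U)^2 * (k * W) = (k * U)^2 * t^2" using eq4 by (simp add: t power_mult_distrib)
  then have kW: "k * W = t^2" using t0 by simp
  then have "W dvd t" using squarefree_dvd_square_imp_dvd[OF sqW _ t0(1)] by (metis dvd_triv_right)
  then obtain s where s: "t = W * s" by auto
  have W0: "W > 0" using t0 s by auto
  have "W * k = W * (W * s^2)" using kW by (simp add: s power2_eq_square ac_simps)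
  then have k: "k = W * s^2" using W0 by simp
  have "Y = s^3 * W^2 * U" unfolding t s k by (simp add: power2_eq_square power3_eq_cube ac_simps)
  moreover have "g = h * s^2 * W" unfolding hk k by (simp add: ac_simps)
  moreover have "Z1 = w1 * u1^2 * A1" "Z2 = w2 * u2^2 * A2" "Z3 = w3 * u3^2 * A3"
    using b bw by (simp_all add: ac_simps)
  ultimately have "g = h * s^2 * (w1 * w2 * w3) \<and> Z1 = w1 * u1^2 * A1 \<and> Z2 = w2 * u2^2 * A2 \<and> Z3 = w3 * u3^2 * A3
     \<and> Y = s^3 * (w1 * w2 * w3)^2 * (u1 * u2 * u3)"
    unfolding WU by (intro conjI)
  then show ?thesis by (intro exI)
qed

text \<open>All signs go into the a_i, and the other coordinates stay natural numbers. After
  division by the gcd of x1 and x2, the zero sum spreads the coprimality of z1 and z2 to all three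
  pairs.\<close>

lemma torsor_parametrization:
  fixes x1 x2 x3 d y :: int
  assumes sum: "x1 + x2 + x3 = 0" and eq: "x1 * x2 * x3 = d * y^2"
    and nz: "x1 \<noteq> 0" "x2 \<noteq> 0" "x3 \<noteq> 0" and cop: "gcd (gcd x1 x2) (gcd y d) = 1"
  shows "\<exists>h w0 w1 w2 w3 u1 u2 u3 :: nat. \<exists>a1 a2 a3 :: int.
     h > 0 \<and> w0 > 0 \<and> w1 > 0 \<and> w2 > 0 \<and> w3 > 0 \<and> u1 > 0 \<and> u2 > 0 \<and> u3 > 0 \<and> a1 \<noteq> 0 \<and> a2 \<noteq> 0 \<and> a3 \<noteq> 0 \<and>
     x1 = int (h * w0^2 * (w1 * w2 * w3)) * (int (w1 * u1^2) * a1) \<and>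
     x2 = int (h * w0^2 * (w1 * w2 * w3)) * (int (w2 * u2^2) * a2) \<and>
     x3 = int (h * w0^2 * (w1 * w2 * w3)) * (int (w3 * u3^2) * a3) \<and>
     \<bar>y\<bar> = int (w0^3 * (w1 * w2 * w3)^2 * (u1 * u2 * u3)) \<and> d = int (h^3) * (a1 * a2 * a3) \<and>
     int (w1 * u1^2) * a1 + int (w2 * u2^2) * a2 + int (w3 * u3^2) * a3 = 0 \<and>
     coprime (int (w1 * u1^2) * a1) (int (w2 * u2^2) * a2) \<and>
     coprime (int (w1 * u1^2) * a1) (int (w3 * u3^2) * a3) \<and>
     coprime (int (w2 * u2^2) * a2) (int (w3 * u3^2) * a3)"
proof -
  define g where "g = gcd x1 x2"
  have g0: "g > 0" using nz by (simp add: g_def)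
  obtain z1 z2 where z: "x1 = g * z1" "x2 = g * z2" "coprime z1 z2"
    using gcd_coprime_exists[of x1 x2] g0 by (metis g_def less_irrefl mult.commute)
  define z3 where "z3 = - z1 - z2"
  have x3: "x3 = g * z3" using sum by (simp add: z z3_def algebra_simps)
  have c13: "coprime z1 z3" "coprime z2 z3"
  proof -
    have "gcd z1 z3 = gcd z1 z2" unfolding z3_def by (metis gcd.commute gcd_add1 gcd_neg2 minus_add_distrib add.commute diff_conv_add_uminus)
    then show "coprime z1 z3" using z(3) by (simp add: coprime_iff_gcd_eq_1)
    have "gcd z2 z3 = gcd z2 z1" unfolding z3_def by (metis gcd.commute gcd_add1 gcd_neg2 minus_add_distrib add.commute diff_conv_add_uminus)
    then show "coprime z2 z3" using z(3) by (simp add: coprime_iff_gcd_eq_1 gcd.commute)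
  qed
  have znz: "z1 \<noteq> 0" "z2 \<noteq> 0" "z3 \<noteq> 0" using nz z x3 by auto
  have dy: "d \<noteq> 0" "y \<noteq> 0" using eq nz by auto
  have eqz: "g^3 * (z1 * z2 * z3) = d * y^2" using eq by (simp add: z x3 power3_eq_cube ac_simps)
  define G Z1 Z2 Z3 D Y where n: "G = nat g" "Z1 = nat \<bar>z1\<bar>" "Z2 = nat \<bar>z2\<bar>" "Z3 = nat \<bar>z3\<bar>" "D = nat \<bar>d\<bar>" "Y = nat \<bar>y\<bar>"
  have i: "int G = g" "int Z1 = \<bar>z1\<bar>" "int Z2 = \<bar>z2\<bar>" "int Z3 = \<bar>z3\<bar>" "int D = \<bar>d\<bar>" "int Y = \<bar>y\<bar>"
    using g0 by (auto simp: n)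
  have "int (G^3 * (Z1 * Z2 * Z3)) = \<bar>g^3 * (z1 * z2 * z3)\<bar>" using g0 by (simp add: i abs_mult)
  also have "\<dots> = int (D * Y^2)" unfolding eqz by (simp add: i abs_mult)
  finally have "G^3 * (Z1 * Z2 * Z3) = D * Y^2" by (simp only: of_nat_eq_iff)
  moreover have "gcd G (gcd Y D) = 1"
  proof -
    have "int (gcd G (gcd Y D)) = gcd g (gcd y d)" by (simp add: gcd_int_int_eq[symmetric] i del: gcd_int_int_eq)
    then show ?thesis using cop by (simp add: g_def)
  qed
  moreover have "coprime Z1 Z2" "coprime Z1 Z3" "coprime Z2 Z3"
    using z(3) c13 by (auto simp: coprime_int_iff[symmetric] i simp del: coprime_int_iff)
  moreover have "G > 0" "Z1 > 0" "Z2 > 0" "Z3 > 0" "D > 0" "Y > 0" using g0 znz dy by (auto simp: n)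
  ultimately have "\<exists>h w0 w1 w2 w3 u1 u2 u3 A1 A2 A3.
     G = h * w0^2 * (w1 * w2 * w3) \<and> Z1 = w1 * u1^2 * A1 \<and> Z2 = w2 * u2^2 * A2 \<and> Z3 = w3 * u3^2 * A3
     \<and> Y = w0^3 * (w1 * w2 * w3)^2 * (u1 * u2 * u3)"
    by (intro torsor_parametrization_nat)
  then obtain h w0 w1 w2 w3 u1 u2 u3 A1 A2 A3 where r:
     "G = h * w0^2 * (w1 * w2 * w3)" "Z1 = w1 * u1^2 * A1" "Z2 = w2 * u2^2 * A2" "Z3 = w3 * u3^2 * A3"
     "Y = w0^3 * (w1 * w2 * w3)^2 * (u1 * u2 * u3)"
    by (elim exE conjE)
  define a1 a2 a3 where a: "a1 = sgn z1 * int A1" "a2 = sgn z2 * int A2" "a3 = sgn z3 * int A3"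
  have zz: "z1 = int (w1 * u1^2) * a1" "z2 = int (w2 * u2^2) * a2" "z3 = int (w3 * u3^2) * a3"
  proof -
    have "z1 = sgn z1 * int Z1" "z2 = sgn z2 * int Z2" "z3 = sgn z3 * int Z3"
      by (simp_all add: i sgn_mult_abs)
    then show "z1 = int (w1 * u1^2) * a1" "z2 = int (w2 * u2^2) * a2" "z3 = int (w3 * u3^2) * a3"
      unfolding r a by (simp_all add: ac_simps)
  qed
  have gg: "g = int (h * w0^2 * (w1 * w2 * w3))" using r(1) i(1) by simp
  have yy: "\<bar>y\<bar> = int (w0^3 * (w1 * w2 * w3)^2 * (u1 * u2 * u3))" using r(5) i(6) by simp
  have pos: "h > 0" "w0 > 0" "w1 > 0" "w2 > 0" "w3 > 0" "u1 > 0" "u2 > 0" "u3 > 0"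
    using \<open>G > 0\<close> \<open>Y > 0\<close> unfolding r by auto
  have anz: "a1 \<noteq> 0" "a2 \<noteq> 0" "a3 \<noteq> 0" using znz zz by auto
  \<comment> \<open>The value of d, including its sign, comes from cancelling y^2 in the equation of
    the surface.\<close>
  have dd: "d = int (h^3) * (a1 * a2 * a3)"
  proof -
    have "d * y^2 = g^3 * (z1 * z2 * z3)" using eqz by simp
    also have "\<dots> = (int (h^3) * (a1 * a2 * a3)) * \<bar>y\<bar>^2"
      unfolding gg yy zz by (simp add: power2_eq_square power3_eq_cube)
    finally show ?thesis using dy by simp
  qed
  have s0: "z1 + z2 + z3 = 0" by (simp add: z3_def)
  have zx: "x1 = int (h * w0^2 * (w1 * w2 * w3)) * z1" "x2 = int (h * w0^2 * (w1 * w2 * w3)) * z2"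
    "x3 = int (h * w0^2 * (w1 * w2 * w3)) * z3" using z(1,2) x3 unfolding gg by simp_all
  show ?thesis
    by (rule exI[of _ h], rule exI[of _ w0], rule exI[of _ w1], rule exI[of _ w2], rule exI[of _ w3],
        rule exI[of _ u1], rule exI[of _ u2], rule exI[of _ u3],
        rule exI[of _ a1], rule exI[of _ a2], rule exI[of _ a3])
      (intro conjI pos anz zx[unfolded zz] yy dd s0[unfolded zz] z(3)[unfolded zz] c13[unfolded zz])
qed

section \<open>Ternary conics in boxes\<close>

definition divisor_count :: "nat \<Rightarrow> nat" where
  "divisor_count n = card {d. d dvd n}"

text \<open>Leaving out 0 avoids an additive constant, since for R < 1 the set is empty. Box counts
  therefore stay pure products, even for very short boxes.\<close>

lemma card_nonzero_ints_le:
  assumes "R \<ge> (0::real)"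
  shows "finite {a::int. a \<noteq> 0 \<and> \<bar>real_of_int a\<bar> \<le> R} \<and> real (card {a::int. a \<noteq> 0 \<and> \<bar>real_of_int a\<bar> \<le> R}) \<le> 2 * R"
proof -
  let ?A = "{a::int. a \<noteq> 0 \<and> \<bar>real_of_int a\<bar> \<le> R}"
  have sub: "?A \<subseteq> {-\<lfloor>R\<rfloor>..-1} \<union> {1..\<lfloor>R\<rfloor>}"
  proof
    fix a assume a: "a \<in> ?A"
    then have "a \<le> \<lfloor>R\<rfloor>" "- a \<le> \<lfloor>R\<rfloor>" unfolding le_floor_iff by auto
    then show "a \<in> {-\<lfloor>R\<rfloor>..-1} \<union> {1..\<lfloor>R\<rfloor>}" using a by auto
  qed
  have "card ?A \<le> card ({-\<lfloor>R\<rfloor>..-1} \<union> {1..\<lfloor>R\<rfloor>})" using sub by (intro card_mono) auto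
  also have "\<dots> \<le> card {-\<lfloor>R\<rfloor>..-1} + card {1..\<lfloor>R\<rfloor>}" by (rule card_Un_le)
  also have "\<dots> = 2 * nat \<lfloor>R\<rfloor>" by simp
  finally have "real (card ?A) \<le> 2 * real (nat \<lfloor>R\<rfloor>)" by (metis of_nat_le_iff of_nat_mult of_nat_numeral)
  also have "\<dots> \<le> 2 * R" using assms by simp
  finally show ?thesis using finite_subset[OF sub] by auto
qed

lemma divisor_count_mult_square_le:
  assumes "q > 0" "u > 0"
  shows "divisor_count (q * u^2) \<le> divisor_count q * divisor_count u ^ 2"
proof -
  have "divisor_count (q * u^2) \<le> divisor_count q * divisor_count (u^2)"
    unfolding divisor_count_def using assms by (intro card_divisors_mult_le) auto
  also have "divisor_count (u^2) \<le> divisor_count u ^ 2"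
    unfolding divisor_count_def power2_eq_square using assms by (intro card_divisors_mult_le) auto
  finally show ?thesis by simp
qed

text \<open>For fixed a, b and u the equation is a quadratic congruence for (x, y) modulo q3 u^2,
  and it then determines c. The coordinates are functions on an abstract set \<open>S\<close>, so
  that the same torsor points can be fed in with the three indices permuted.\<close>

lemma card_ternary_conic_le:
  fixes S :: "'s set" and x y u :: "'s \<Rightarrow> nat" and a b c :: "'s \<Rightarrow> int" and q1 q2 q3 :: nat
    and X Y R1 R2 :: real and U :: nat
  assumes inj: "inj_on (\<lambda>s. (x s, y s, u s, a s, b s, c s)) S"
    and q: "q3 > 0" and XY: "X > 0" "Y > 0" "U > 0" "R1 \<ge> 0" "R2 \<ge> 0"
    and S: "\<And>s. s \<in> S \<Longrightarrow>
       X \<le> real (x s) \<and> real (x s) \<le> 2 * X \<and> Y \<le> real (y s) \<and> real (y s) \<le> 2 * Y \<and> u s \<in> {U..<2 * U} \<and>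
       a s \<noteq> 0 \<and> b s \<noteq> 0 \<and> \<bar>real_of_int (a s)\<bar> \<le> R1 \<and> \<bar>real_of_int (b s)\<bar> \<le> R2 \<and>
       int (q1 * x s ^ 2) * a s + int (q2 * y s ^ 2) * b s + int (q3 * u s ^ 2) * c s = 0 \<and>
       coprime (int (q1 * x s ^ 2) * a s) (int (q2 * y s ^ 2) * b s) \<and>
       coprime (int (q1 * x s ^ 2) * a s) (int (q3 * u s ^ 2) * c s) \<and>
       coprime (int (q2 * y s ^ 2) * b s) (int (q3 * u s ^ 2) * c s)"
  shows "finite S \<and> real (card S) \<le> 4 * R1 * R2 * divisor_count q3 * (1 + 32 * X * Y / (q3 * U^2))
           * (\<Sum>u\<in>{U..<2 * U}. real (divisor_count u) ^ 2)"
proof -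
  let ?A = "\<lambda>R::real. {a::int. a \<noteq> 0 \<and> \<bar>real_of_int a\<bar> \<le> R}"
  define P where "P = ?A R1 \<times> ?A R2 \<times> {U..<2 * U}"
  define F where "F = (\<lambda>(p::int \<times> int \<times> nat). real (divisor_count q3) * real (divisor_count (snd (snd p)))^2 * (1 + 32 * X * Y / (q3 * U^2)))"
  have fP: "finite P" unfolding P_def using card_nonzero_ints_le XY by auto
  have "finite S \<and> real (card S) \<le> (\<Sum>p\<in>P. F p)"
  proof (rule card_le_sum_fibres[OF fP, where f = "\<lambda>s. (a s, b s, u s)"])
    show "(\<lambda>s. (a s, b s, u s)) ` S \<subseteq> P" using S by (auto simp: P_def)
    fix p assume p: "p \<in> P"
    obtain a0 b0 u0 where p0: "p = (a0,b0,u0)" by (metis surj_pair)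
    let ?R = "{s \<in> S. (a s, b s, u s) = p}"
    define m where "m = int (q3 * u0^2)"
    define f where "f = (\<lambda>s. (int (x s), int (y s)))"
    have u0: "u0 > 0" "U \<le> u0" using p XY by (auto simp: p0 P_def)
    have m0: "m > 0" using u0 q by (simp add: m_def)
    have injf: "inj_on f ?R"
    proof (rule inj_onI)
      fix s t assume st: "s \<in> ?R" "t \<in> ?R" "f s = f t"
      have eqs: "x s = x t" "y s = y t" "a s = a0" "a t = a0" "b s = b0" "b t = b0" "u s = u0" "u t = u0"
        using st by (auto simp: p0 f_def)
      have "int (q1 * x s ^ 2) * a s + int (q2 * y s ^ 2) * b s + int (q3 * u s ^ 2) * c s = 0"
        "int (q1 * x t ^ 2) * a t + int (q2 * y t ^ 2) * b t + int (q3 * u t ^ 2) * c t = 0"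
        using S st by blast+
      then have "m * c s = m * c t" unfolding m_def eqs by linarith
      then have "c s = c t" using m0 by simp
      then show "s = t" using inj st by (auto simp: inj_on_def f_def p0)
    qed
    have "finite (f ` ?R) \<and> real (card (f ` ?R)) \<le> card {d. d dvd nat m} * (1 + 32 * X * Y / m)"
    proof (cases "?R = {}")
      case True
      show ?thesis unfolding True using m0 XY by simp
    next
      case False
      then obtain s0 where s0: "s0 \<in> S" "a s0 = a0" "b s0 = b0" "u s0 = u0" by (auto simp: p0)
      show ?thesis
      proof (rule card_binary_conic_box_le[where ?q1.0 = "int q1 * a0" and ?q2.0 = "int q2 * b0", OF m0 _ XY(1,2)])
        show "coprime (int q1 * a0) m" using S[OF s0(1)] s0 by (auto simp: m_def)
        fix X' Y' assume "(X',Y') \<in> f ` ?R"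
        then obtain s where s: "s \<in> S" "a s = a0" "b s = b0" "u s = u0" "X' = int (x s)" "Y' = int (y s)"
          by (auto simp: f_def p0)
        note Ss = S[OF s(1)]
        have c: "coprime X' Y'" "coprime X' m" "coprime Y' m"
          using Ss by (auto simp: s m_def)
        have "int q1 * a0 * X'^2 + int q2 * b0 * Y'^2 = m * (- c s)"
          using Ss by (simp add: s m_def algebra_simps)
        then have "m dvd int q1 * a0 * X'^2 + int q2 * b0 * Y'^2" by simp
        then show "coprime X' Y' \<and> coprime X' m \<and> coprime Y' m \<and> m dvd int q1 * a0 * X'^2 + int q2 * b0 * Y'^2 \<and>
          \<bar>real_of_int X'\<bar> \<le> 2 * X \<and> Y \<le> real_of_int Y' \<and> real_of_int Y' \<le> 2 * Y"
          using c Ss by (auto simp: s)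
      qed
    qed
    then have "finite ?R" "real (card ?R) \<le> card {d. d dvd nat m} * (1 + 32 * X * Y / m)"
      using injf by (auto simp: card_image dest: finite_imageD)
    moreover have "card {d. d dvd nat m} * (1 + 32 * X * Y / m) \<le> F p"
    proof -
      have "nat m = q3 * u0^2" by (simp add: m_def nat_mult_distrib nat_power_eq)
      then have "card {d. d dvd nat m} \<le> divisor_count q3 * divisor_count u0 ^ 2"
        using divisor_count_mult_square_le[OF q u0(1)] by (simp add: divisor_count_def)
      then have 1: "real (card {d. d dvd nat m}) \<le> real (divisor_count q3) * real (divisor_count u0) ^ 2"
        by (metis of_nat_le_iff of_nat_mult of_nat_power)
      have "real q3 * real U^2 \<le> real q3 * real u0^2" using u0 by (intro mult_left_mono power_mono) auto
      then have "32 * X * Y / m \<le> 32 * X * Y / (q3 * U^2)"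
        unfolding m_def using XY q by (intro frac_le) auto
      then have 2: "1 + 32 * X * Y / m \<le> 1 + 32 * X * Y / (q3 * U^2)" by simp
      have "0 \<le> 1 + 32 * X * Y / m" using m0 XY by simp
      then show ?thesis unfolding F_def p0 using 1 2 by (auto intro!: mult_mono)
    qed
    ultimately show "finite ?R \<and> real (card ?R) \<le> F p" by linarith
  qed
  moreover have "(\<Sum>p\<in>P. F p) \<le> 4 * R1 * R2 * divisor_count q3 * (1 + 32 * X * Y / (q3 * U^2))
           * (\<Sum>u\<in>{U..<2 * U}. real (divisor_count u) ^ 2)"
  proof -
    let ?K = "real (divisor_count q3) * (1 + 32 * X * Y / (q3 * U^2))"
    let ?s = "\<Sum>u\<in>{U..<2 * U}. real (divisor_count u) ^ 2"
    have K0: "?K \<ge> 0" using XY by simp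
    have "(\<Sum>p\<in>P. F p) = (\<Sum>a\<in>?A R1. \<Sum>b\<in>?A R2. \<Sum>u\<in>{U..<2 * U}. ?K * real (divisor_count u)^2)"
      unfolding P_def F_def sum.cartesian_product by (intro sum.cong) (auto simp: algebra_simps)
    also have "\<dots> = real (card (?A R1)) * real (card (?A R2)) * (?K * ?s)"
      by (simp add: sum_distrib_left mult.assoc)
    also have "\<dots> \<le> (2 * R1) * (2 * R2) * (?K * ?s)"
      using card_nonzero_ints_le XY K0 by (intro mult_right_mono mult_mono mult_nonneg_nonneg sum_nonneg) auto
    finally show ?thesis by (simp add: mult.assoc)
  qed
  ultimately show ?thesis by linarith
qed


lemma le_cube_root_mult:
  fixes W V A :: real
  assumes "A > 0" "V > 0" "W > 0" "A^3 \<le> W * V^3"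
  shows "A \<le> W powr (1/3) * V"
proof -
  have "(A^3) powr (1/3) \<le> (W * V^3) powr (1/3)" using assms by (intro powr_mono2) auto
  moreover have "(A^3) powr (1/3) = A" "(V^3) powr (1/3) = V"
    using powr_powr[of A 3 "1/3"] powr_powr[of V 3 "1/3"] assms by simp_all
  ultimately show ?thesis using assms by (simp add: powr_mult)
qed

text \<open>Over all r these blocks add up to a sum of tau(u)^2 / u, where (log B)^4 arises. Within
  a block, 1 / u differs from 2^(-r) by at most a factor 2.\<close>

definition dyadic_divisor_sum :: "nat \<Rightarrow> real" where
  "dyadic_divisor_sum r = (\<Sum>u\<in>{2 ^ r..<2 * 2 ^ r}. real (divisor_count u) ^ 2 / real u)"

lemma dyadic_divisor_sum_nonneg: "dyadic_divisor_sum r \<ge> 0"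
  by (simp add: dyadic_divisor_sum_def sum_nonneg)

lemma sum_divisor_count_square_dyadic_le:
  "(\<Sum>u\<in>{2 ^ r..<2 * 2 ^ r}. real (divisor_count u) ^ 2) \<le> 2 * 2 ^ r * dyadic_divisor_sum r"
  unfolding dyadic_divisor_sum_def sum_distrib_left
proof (rule sum_mono)
  fix u :: nat assume u: "u \<in> {2 ^ r..<2 * 2 ^ r}"
  then have u1: "u \<ge> 2 ^ r" "u \<le> 2 * 2 ^ r" by auto
  have "(0::nat) < 2 ^ r" by simp
  with u1 have u0: "u > 0" by linarith
  have "real u \<le> real (2 * 2 ^ r)" using u1(2) by (simp only: of_nat_le_iff)
  then have "real u \<le> 2 * 2 ^ r" by simp
  then have "real (divisor_count u) ^ 2 * real u \<le> real (divisor_count u) ^ 2 * (2 * 2 ^ r)"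
    by (intro mult_left_mono) auto
  then show "real (divisor_count u) ^ 2 \<le> 2 * 2 ^ r * (real (divisor_count u) ^ 2 / real u)"
    using u0 by (simp add: le_divide_eq ac_simps)
qed

text \<open>The hypothesis \<open>min\<close> is what makes the summand $1$ in the count of pairs harmless:
  it gives $q_3 U_3^2 \le (q_1 q_2 q_3)^{1/3} U_1 U_2$.\<close>
lemma card_conic_box_min_le:
  fixes S :: "'s set" and x y u :: "'s \<Rightarrow> nat" and a b c :: "'s \<Rightarrow> int" and q1 q2 q3 r1 r2 r3 :: nat
    and P :: real
  assumes inj: "inj_on (\<lambda>s. (x s, y s, u s, a s, b s, c s)) S"
    and q: "q1 > 0" "q2 > 0" "q3 > 0" and P: "P > 0"
    and min: "q3 * 8 ^ r3 \<le> q1 * 8 ^ r1" "q3 * 8 ^ r3 \<le> q2 * 8 ^ r2"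
    and S: "\<And>s. s \<in> S \<Longrightarrow>
       x s \<in> {2 ^ r1..<2 * 2 ^ r1} \<and> y s \<in> {2 ^ r2..<2 * 2 ^ r2} \<and> u s \<in> {2 ^ r3..<2 * 2 ^ r3} \<and>
       a s \<noteq> 0 \<and> b s \<noteq> 0 \<and> \<bar>real_of_int (a s)\<bar> \<le> 16 * P / (q1 * 4 ^ r1) \<and> \<bar>real_of_int (b s)\<bar> \<le> 16 * P / (q2 * 4 ^ r2) \<and>
       int (q1 * x s ^ 2) * a s + int (q2 * y s ^ 2) * b s + int (q3 * u s ^ 2) * c s = 0 \<and>
       coprime (int (q1 * x s ^ 2) * a s) (int (q2 * y s ^ 2) * b s) \<and>
       coprime (int (q1 * x s ^ 2) * a s) (int (q3 * u s ^ 2) * c s) \<and>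
       coprime (int (q2 * y s ^ 2) * b s) (int (q3 * u s ^ 2) * c s)"
  shows "finite S \<and> real (card S) \<le> 70000 * P^2 * real (q1 * q2 * q3) powr (-2/3) / 2 ^ (r1 + r2 + r3)
           * (divisor_count q3 * dyadic_divisor_sum r3)"
proof -
  define R1 R2 X Y U W where d: "R1 = 16 * P / (q1 * 4 ^ r1)" "R2 = 16 * P / (q2 * 4 ^ r2)"
    "X = (2::real) ^ r1" "Y = (2::real) ^ r2" "U = (2::real) ^ r3" "W = real (q1 * q2 * q3)"
  have pos: "R1 > 0" "R2 > 0" "X > 0" "Y > 0" "U > 0" "W > 0" using q P by (auto simp: d)
  have four: "(4::real) ^ r1 = X^2" "(4::real) ^ r2 = Y^2" "(4::real) ^ r3 = U^2"
    by (simp_all add: d power_mult[symmetric] mult.commute[of _ 2] power_mult)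
  have R12: "R1 = 16 * P / (real q1 * X^2)" "R2 = 16 * P / (real q2 * Y^2)" by (simp_all add: d(1,2) four)
  have eight: "(8::real) ^ r1 = X^3" "(8::real) ^ r2 = Y^3" "(8::real) ^ r3 = U^3"
    by (simp_all add: d power_mult[symmetric] mult.commute[of _ 3] power_mult)
  have 1: "finite S \<and> real (card S) \<le> 4 * R1 * R2 * divisor_count q3 * (1 + 32 * X * Y / real (q3 * (2 ^ r3)^2))
           * (\<Sum>u\<in>{2 ^ r3..<2 * 2 ^ r3}. real (divisor_count u) ^ 2)"
  proof (rule card_ternary_conic_le[where X = X and Y = Y and U = "2 ^ r3" and ?R1.0 = R1 and ?R2.0 = R2, OF inj q(3)])
    fix s assume s: "s \<in> S"
    have "real (2 ^ r1) \<le> real (x s)" "real (x s) \<le> real (2 * 2 ^ r1)" "real (2 ^ r2) \<le> real (y s)" "real (y s) \<le> real (2 * 2 ^ r2)"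
      using S[OF s] by (simp_all only: of_nat_le_iff) auto
    then have "X \<le> real (x s)" "real (x s) \<le> 2 * X" "Y \<le> real (y s)" "real (y s) \<le> 2 * Y" by (simp_all add: d)
    then show "X \<le> real (x s) \<and> real (x s) \<le> 2 * X \<and> Y \<le> real (y s) \<and> real (y s) \<le> 2 * Y \<and> u s \<in> {2 ^ r3..<2 * 2 ^ r3} \<and>
       a s \<noteq> 0 \<and> b s \<noteq> 0 \<and> \<bar>real_of_int (a s)\<bar> \<le> R1 \<and> \<bar>real_of_int (b s)\<bar> \<le> R2 \<and>
       int (q1 * x s ^ 2) * a s + int (q2 * y s ^ 2) * b s + int (q3 * u s ^ 2) * c s = 0 \<and>
       coprime (int (q1 * x s ^ 2) * a s) (int (q2 * y s ^ 2) * b s) \<and>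
       coprime (int (q1 * x s ^ 2) * a s) (int (q3 * u s ^ 2) * c s) \<and>
       coprime (int (q2 * y s ^ 2) * b s) (int (q3 * u s ^ 2) * c s)"
      using S[OF s] unfolding d(1,2) by blast
  qed (use pos in auto)
  have e: "real (q3 * (2 ^ r3)^2) = q3 * U^2" by (simp add: d)
  have main: "1 + 32 * X * Y / (q3 * U^2) \<le> 33 * W powr (1/3) * (X * Y / (q3 * U^2))"
  proof -
    have m: "q3 * U^3 \<le> q1 * X^3" "q3 * U^3 \<le> q2 * Y^3"
      using min[THEN of_nat_mono[where ?'a = real]] by (simp_all add: eight)
    \<comment> \<open>The smallest of three positive numbers is at most their geometric mean, here
      W^(1/3) X Y U. Dividing by U compares the modulus q3 U^2 with X Y.\<close>
    have "(q3 * U^3)^3 = (q3 * U^3) * (q3 * U^3) * (q3 * U^3)" by (simp add: power3_eq_cube)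
    also have "\<dots> \<le> (q1 * X^3) * (q2 * Y^3) * (q3 * U^3)"
      using mult_mono[OF m] pos by (intro mult_right_mono) auto
    also have "\<dots> = W * (X * Y * U)^3" by (simp add: d power_mult_distrib)
    finally have "q3 * U^3 \<le> W powr (1/3) * (X * Y * U)"
      using pos q by (intro le_cube_root_mult) auto
    then have "(q3 * U^2) * U \<le> (W powr (1/3) * (X * Y)) * U" by (simp add: power2_eq_square power3_eq_cube mult.assoc)
    then have "q3 * U^2 \<le> W powr (1/3) * (X * Y)" using pos by simp
    then have A: "1 \<le> W powr (1/3) * (X * Y / (q3 * U^2))" using pos q by (simp add: field_simps)
    have "1 \<le> q1 * q2 * q3" using q by (simp add: Suc_le_eq)
    from of_nat_mono[OF this, where ?'a = real] have "1 \<le> W" by (simp add: d)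
    then have "1 \<le> W powr (1/3)" by (simp add: ge_one_powr_ge_zero)
    then have B: "1 * (X * Y / (q3 * U^2)) \<le> W powr (1/3) * (X * Y / (q3 * U^2))" using pos by (intro mult_right_mono) auto
    have gen: "1 + 32 * z \<le> 33 * v" if "1 \<le> v" "1 * z \<le> v" for z v :: real using that by linarith
    have "32 * X * Y / (q3 * U^2) = 32 * (X * Y / (q3 * U^2))"
      "33 * W powr (1/3) * (X * Y / (q3 * U^2)) = 33 * (W powr (1/3) * (X * Y / (q3 * U^2)))" by simp_all
    then show ?thesis using gen[OF A B] by (simp only:)
  qed
  have "4 * R1 * R2 * divisor_count q3 * (1 + 32 * X * Y / real (q3 * (2 ^ r3)^2))
           * (\<Sum>u\<in>{2 ^ r3..<2 * 2 ^ r3}. real (divisor_count u) ^ 2)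
      \<le> 4 * R1 * R2 * divisor_count q3 * (33 * W powr (1/3) * (X * Y / (q3 * U^2))) * (2 * U * dyadic_divisor_sum r3)"
    using main sum_divisor_count_square_dyadic_le[of r3] pos unfolding e
    by (intro mult_mono mult_left_mono) (auto simp: d(5) intro!: sum_nonneg)
  \<comment> \<open>67584 = 4 * 16 * 16 * 33 * 2: the 4 and the two 16 count the choices of a and b,
    33 the pairs in one lattice, and 2 comes from the block of u.\<close>
  also have "\<dots> = 67584 * (P^2 * (W powr (1/3) / W) / (X * Y * U) * (divisor_count q3 * dyadic_divisor_sum r3))"
    unfolding R12 using pos q by (simp add: d(6) field_simps power2_eq_square)
  also have "W powr (1/3) / W = W powr (-2/3)"
  proof -
    have "W powr (1/3) / W = W powr (1/3) / W powr 1" using pos by simp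
    also have "\<dots> = W powr (-2/3)" by (subst powr_diff[symmetric]) simp
    finally show ?thesis .
  qed
  also have "67584 * (P^2 * W powr (-2/3) / (X * Y * U) * (divisor_count q3 * dyadic_divisor_sum r3))
     \<le> 70000 * (P^2 * W powr (-2/3) / (X * Y * U) * (divisor_count q3 * dyadic_divisor_sum r3))"
    using pos dyadic_divisor_sum_nonneg by (intro mult_right_mono mult_nonneg_nonneg divide_nonneg_nonneg) auto
  finally have "4 * R1 * R2 * divisor_count q3 * (1 + 32 * X * Y / real (q3 * (2 ^ r3)^2))
           * (\<Sum>u\<in>{2 ^ r3..<2 * 2 ^ r3}. real (divisor_count u) ^ 2)
      \<le> 70000 * (P^2 * W powr (-2/3) / (X * Y * U) * (divisor_count q3 * dyadic_divisor_sum r3))" .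
  moreover have "X * Y * U = 2 ^ (r1 + r2 + r3)" by (simp add: d power_add)
  ultimately show ?thesis using 1 unfolding d(6) by (simp add: mult.assoc)
qed

lemma divisor_count_pos: "n > 0 \<Longrightarrow> divisor_count n \<ge> 1"
  unfolding divisor_count_def by (simp add: Suc_le_eq card_gt_0_iff) auto

text \<open>One of the three numbers q_i 8^(r_i) is smallest, and permuting the indices makes it the
  third. To get a bound that does not depend on which one it is, the divisor counts, each at least
  1, are multiplied and the nonnegative dyadic sums are added.\<close>

lemma card_conic_box_le:
  fixes S :: "'s set" and x y u :: "'s \<Rightarrow> nat" and a b c :: "'s \<Rightarrow> int" and q1 q2 q3 r1 r2 r3 :: nat
    and P :: real
  assumes inj: "inj_on (\<lambda>s. (x s, y s, u s, a s, b s, c s)) S"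
    and q: "q1 > 0" "q2 > 0" "q3 > 0" and P: "P > 0"
    and S: "\<And>s. s \<in> S \<Longrightarrow>
       x s \<in> {2 ^ r1..<2 * 2 ^ r1} \<and> y s \<in> {2 ^ r2..<2 * 2 ^ r2} \<and> u s \<in> {2 ^ r3..<2 * 2 ^ r3} \<and>
       a s \<noteq> 0 \<and> b s \<noteq> 0 \<and> c s \<noteq> 0 \<and> \<bar>real_of_int (a s)\<bar> \<le> 16 * P / (q1 * 4 ^ r1) \<and>
       \<bar>real_of_int (b s)\<bar> \<le> 16 * P / (q2 * 4 ^ r2) \<and> \<bar>real_of_int (c s)\<bar> \<le> 16 * P / (q3 * 4 ^ r3) \<and>
       int (q1 * x s ^ 2) * a s + int (q2 * y s ^ 2) * b s + int (q3 * u s ^ 2) * c s = 0 \<and>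
       coprime (int (q1 * x s ^ 2) * a s) (int (q2 * y s ^ 2) * b s) \<and>
       coprime (int (q1 * x s ^ 2) * a s) (int (q3 * u s ^ 2) * c s) \<and>
       coprime (int (q2 * y s ^ 2) * b s) (int (q3 * u s ^ 2) * c s)"
  shows "finite S \<and> real (card S) \<le> 70000 * P^2 * real (q1 * q2 * q3) powr (-2/3) / 2 ^ (r1 + r2 + r3)
           * (real (divisor_count q1 * divisor_count q2 * divisor_count q3)
              * (dyadic_divisor_sum r1 + dyadic_divisor_sum r2 + dyadic_divisor_sum r3))"
proof -
  let ?K = "70000 * P^2 * real (q1 * q2 * q3) powr (-2/3) / 2 ^ (r1 + r2 + r3)"
  let ?D = "real (divisor_count q1 * divisor_count q2 * divisor_count q3)"
  let ?s = "dyadic_divisor_sum r1 + dyadic_divisor_sum r2 + dyadic_divisor_sum r3"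
  have K0: "?K \<ge> 0" by simp
  note t1 = divisor_count_pos[OF q(1)] divisor_count_pos[OF q(2)] divisor_count_pos[OF q(3)]
  have fin: "real (divisor_count qk) * dyadic_divisor_sum rk \<le> ?D * ?s"
    if "qk \<in> {q1,q2,q3}" "rk \<in> {r1,r2,r3}" for qk rk
  proof (rule mult_mono)
    have "divisor_count qk dvd divisor_count q1 * divisor_count q2 * divisor_count q3" using that by auto
    then show "real (divisor_count qk) \<le> ?D" using t1 by (simp only: of_nat_le_iff) (intro dvd_imp_le, auto)
    show "dyadic_divisor_sum rk \<le> ?s"
      using that dyadic_divisor_sum_nonneg[of r1] dyadic_divisor_sum_nonneg[of r2] dyadic_divisor_sum_nonneg[of r3] by auto
  qed (use dyadic_divisor_sum_nonneg in auto)
  consider "q3 * 8 ^ r3 \<le> q1 * 8 ^ r1" "q3 * 8 ^ r3 \<le> q2 * 8 ^ r2"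
    | "q2 * 8 ^ r2 \<le> q1 * 8 ^ r1" "q2 * 8 ^ r2 \<le> q3 * 8 ^ r3"
    | "q1 * 8 ^ r1 \<le> q2 * 8 ^ r2" "q1 * 8 ^ r1 \<le> q3 * 8 ^ r3" by linarith
  then have "\<exists>qk\<in>{q1,q2,q3}. \<exists>rk\<in>{r1,r2,r3}. finite S \<and> real (card S) \<le> ?K * (real (divisor_count qk) * dyadic_divisor_sum rk)"
  proof cases
    case 1
    have "finite S \<and> real (card S) \<le> ?K * (real (divisor_count q3) * dyadic_divisor_sum r3)"
      by (rule card_conic_box_min_le[OF inj q P 1]) (use S in blast)
    then show ?thesis by blast
  next
    case 2
    have inj2: "inj_on (\<lambda>s. (x s, u s, y s, a s, c s, b s)) S" using inj by (auto simp: inj_on_def)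
    have "finite S \<and> real (card S) \<le> 70000 * P^2 * real (q1 * q3 * q2) powr (-2/3) / 2 ^ (r1 + r3 + r2) * (real (divisor_count q2) * dyadic_divisor_sum r2)"
    proof (rule card_conic_box_min_le[OF inj2 q(1,3,2) P 2])
      fix s assume "s \<in> S"
      then show "x s \<in> {2 ^ r1..<2 * 2 ^ r1} \<and> u s \<in> {2 ^ r3..<2 * 2 ^ r3} \<and> y s \<in> {2 ^ r2..<2 * 2 ^ r2} \<and>
       a s \<noteq> 0 \<and> c s \<noteq> 0 \<and> \<bar>real_of_int (a s)\<bar> \<le> 16 * P / (q1 * 4 ^ r1) \<and> \<bar>real_of_int (c s)\<bar> \<le> 16 * P / (q3 * 4 ^ r3) \<and>
       int (q1 * x s ^ 2) * a s + int (q3 * u s ^ 2) * c s + int (q2 * y s ^ 2) * b s = 0 \<and>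
       coprime (int (q1 * x s ^ 2) * a s) (int (q3 * u s ^ 2) * c s) \<and>
       coprime (int (q1 * x s ^ 2) * a s) (int (q2 * y s ^ 2) * b s) \<and>
       coprime (int (q3 * u s ^ 2) * c s) (int (q2 * y s ^ 2) * b s)"
        by (intro conjI; insert S[of s]; (linarith | blast intro: coprime_commute[THEN iffD1]))
    qed
    then have "finite S \<and> real (card S) \<le> ?K * (real (divisor_count q2) * dyadic_divisor_sum r2)"
      by (simp only: ac_simps)
    then show ?thesis by blast
  next
    case 3
    have inj2: "inj_on (\<lambda>s. (y s, u s, x s, b s, c s, a s)) S" using inj by (auto simp: inj_on_def)
    have "finite S \<and> real (card S) \<le> 70000 * P^2 * real (q2 * q3 * q1) powr (-2/3) / 2 ^ (r2 + r3 + r1) * (real (divisor_count q1) * dyadic_divisor_sum r1)"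
    proof (rule card_conic_box_min_le[OF inj2 q(2,3,1) P 3])
      fix s assume "s \<in> S"
      then show "y s \<in> {2 ^ r2..<2 * 2 ^ r2} \<and> u s \<in> {2 ^ r3..<2 * 2 ^ r3} \<and> x s \<in> {2 ^ r1..<2 * 2 ^ r1} \<and>
       b s \<noteq> 0 \<and> c s \<noteq> 0 \<and> \<bar>real_of_int (b s)\<bar> \<le> 16 * P / (q2 * 4 ^ r2) \<and> \<bar>real_of_int (c s)\<bar> \<le> 16 * P / (q3 * 4 ^ r3) \<and>
       int (q2 * y s ^ 2) * b s + int (q3 * u s ^ 2) * c s + int (q1 * x s ^ 2) * a s = 0 \<and>
       coprime (int (q2 * y s ^ 2) * b s) (int (q3 * u s ^ 2) * c s) \<and>
       coprime (int (q2 * y s ^ 2) * b s) (int (q1 * x s ^ 2) * a s) \<and>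
       coprime (int (q3 * u s ^ 2) * c s) (int (q1 * x s ^ 2) * a s)"
        by (intro conjI; insert S[of s]; (linarith | blast intro: coprime_commute[THEN iffD1]))
    qed
    then have "finite S \<and> real (card S) \<le> ?K * (real (divisor_count q1) * dyadic_divisor_sum r1)"
      by (simp only: ac_simps)
    then show ?thesis by blast
  qed
  then obtain qk rk where k: "qk \<in> {q1,q2,q3}" "rk \<in> {r1,r2,r3}" "finite S"
    "real (card S) \<le> ?K * (real (divisor_count qk) * dyadic_divisor_sum rk)" by blast
  show ?thesis using k(3,4) mult_left_mono[OF fin[OF k(1,2)] K0] by (meson order_trans)
qed

section \<open>Torsor points in the two zones\<close>

text \<open>The three height conditions bound |x3|, |y| and |d|. The constants 2 and 3 arise because
  an x_i may be minus the sum of two original coordinates, and y is the sum of three. The ordering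
  passes the bound for |x3| on to x1 and x2.\<close>

definition torsor_pt ::
    "real \<Rightarrow> nat \<Rightarrow> nat \<Rightarrow> nat \<Rightarrow> nat \<Rightarrow> nat \<Rightarrow> nat \<Rightarrow> nat \<Rightarrow> nat \<Rightarrow> int \<Rightarrow> int \<Rightarrow> int \<Rightarrow> bool" where
  "torsor_pt B w0 w1 w2 w3 u1 u2 u3 h a1 a2 a3 \<longleftrightarrow>
     w0 > 0 \<and> w1 > 0 \<and> w2 > 0 \<and> w3 > 0 \<and> u1 > 0 \<and> u2 > 0 \<and> u3 > 0 \<and> h > 0 \<and> a1 \<noteq> 0 \<and> a2 \<noteq> 0 \<and> a3 \<noteq> 0 \<and>
     int (w1 * u1^2) * a1 + int (w2 * u2^2) * a2 + int (w3 * u3^2) * a3 = 0 \<and>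
     coprime (int (w1 * u1^2) * a1) (int (w2 * u2^2) * a2) \<and>
     coprime (int (w1 * u1^2) * a1) (int (w3 * u3^2) * a3) \<and>
     coprime (int (w2 * u2^2) * a2) (int (w3 * u3^2) * a3) \<and>
     w1 * u1^2 * nat \<bar>a1\<bar> \<le> w2 * u2^2 * nat \<bar>a2\<bar> \<and> w2 * u2^2 * nat \<bar>a2\<bar> \<le> w3 * u3^2 * nat \<bar>a3\<bar> \<and>
     real (h * w0^2 * (w1 * w2 * w3) * (w3 * u3^2 * nat \<bar>a3\<bar>)) \<le> 2 * B \<and>
     real (w0^3 * (w1 * w2 * w3)^2 * (u1 * u2 * u3)) \<le> 3 * B \<and>
     real (h^3 * (nat \<bar>a1\<bar> * nat \<bar>a2\<bar> * nat \<bar>a3\<bar>)) \<le> B"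

type_synonym torsor_tuple = "(nat \<times> nat \<times> nat \<times> nat) \<times> (nat \<times> nat \<times> nat) \<times> nat \<times> (int \<times> int \<times> int)"

definition torsor_set :: "real \<Rightarrow> torsor_tuple set" where
  "torsor_set B = {((w0,w1,w2,w3),(u1,u2,u3),h,(a1,a2,a3)) | w0 w1 w2 w3 u1 u2 u3 h a1 a2 a3.
      torsor_pt B w0 w1 w2 w3 u1 u2 u3 h a1 a2 a3}"

definition lg_abs :: "int \<Rightarrow> nat" where
  "lg_abs a = floor_log (nat \<bar>a\<bar>)"

lemma lg_abs_bounds:
  assumes "a \<noteq> 0"
  shows "2 ^ lg_abs a \<le> nat \<bar>a\<bar>" "nat \<bar>a\<bar> < 2 * 2 ^ lg_abs a"
proof -
  have "nat \<bar>a\<bar> > 0" using assms by simp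
  then show "2 ^ lg_abs a \<le> nat \<bar>a\<bar>" unfolding lg_abs_def by (rule floor_log_exp2_le)
  show "nat \<bar>a\<bar> < 2 * 2 ^ lg_abs a" unfolding lg_abs_def by (rule floor_log_exp2_gt)
qed

text \<open>In the conic zone the variables $u_i$ outnumber the variables $a_i$, and fixing two of the $a_i$
  is more efficient than fixing the $u_i$.\<close>
definition conic_zone :: "nat \<Rightarrow> nat \<Rightarrow> nat \<Rightarrow> nat \<Rightarrow> nat \<Rightarrow> nat \<Rightarrow> nat \<Rightarrow> bool" where
  "conic_zone w1 w2 w3 r1 r2 r3 j \<longleftrightarrow>
     real (w2 * 4 ^ r2 * 2 ^ j) < 2 ^ (r1 + r2 + r3) * real (w1 * w2 * w3) powr (1/3)"

text \<open>Every w_i, h and u_i divides |x3| or |y|, which are positive integers of size at most 3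
  B. For a1 and a2 the ordering of the terms is used. A common range for all variables keeps the
  multiple sums uniform.\<close>

lemma torsor_pt_range:
  assumes "torsor_pt B w0 w1 w2 w3 u1 u2 u3 h a1 a2 a3" "B \<ge> 2"
  defines "N \<equiv> nat \<lfloor>3 * B\<rfloor>"
  shows "w0 \<in> {1..N}" "w1 \<in> {1..N}" "w2 \<in> {1..N}" "w3 \<in> {1..N}" "u1 \<in> {1..N}" "u2 \<in> {1..N}" "u3 \<in> {1..N}"
    "h \<in> {1..N}" "floor_log u1 \<in> {0..floor_log N}" "floor_log u2 \<in> {0..floor_log N}" "floor_log u3 \<in> {0..floor_log N}"
    "lg_abs a1 \<in> {0..floor_log N}" "lg_abs a2 \<in> {0..floor_log N}"
proof -
  note t = assms(1)[unfolded torsor_pt_def]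
  let ?A = "\<lambda>a::int. nat \<bar>a\<bar>"
  let ?M = "h * w0^2 * (w1 * w2 * w3) * (w3 * u3^2 * ?A a3)"
  let ?V = "w0^3 * (w1 * w2 * w3)^2 * (u1 * u2 * u3)"
  have "real ?M \<le> 3 * B" using t assms(2) by linarith
  then have M: "?M \<le> N" unfolding N_def by (rule le_nat_floor)
  have "real ?V \<le> 3 * B" using t by blast
  then have V: "?V \<le> N" unfolding N_def by (rule le_nat_floor)
  have M0: "?M > 0" "?V > 0" using t by auto
  have dM: "d \<le> N" if "d dvd ?M" for d using dvd_imp_le[OF that M0(1)] M by linarith
  have dV: "d \<le> N" if "d dvd ?V" for d using dvd_imp_le[OF that M0(2)] V by linarith
  have "w0 dvd ?M" by (simp add: power2_eq_square)
  then show "w0 \<in> {1..N}" using dM t by (auto simp: Suc_le_eq)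
  have "w1 dvd ?M" by simp
  then show "w1 \<in> {1..N}" using dM t by (auto simp: Suc_le_eq)
  have "w2 dvd ?M" by simp
  then show "w2 \<in> {1..N}" using dM t by (auto simp: Suc_le_eq)
  have "w3 dvd ?M" by simp
  then show "w3 \<in> {1..N}" using dM t by (auto simp: Suc_le_eq)
  have "h dvd ?M" by (simp add: mult.assoc)
  then show "h \<in> {1..N}" using dM t by (auto simp: Suc_le_eq)
  have "u1 dvd ?V" by simp
  then show u1: "u1 \<in> {1..N}" using dV t by (auto simp: Suc_le_eq)
  have "u2 dvd ?V" by simp
  then show u2: "u2 \<in> {1..N}" using dV t by (auto simp: Suc_le_eq)
  have "u3 dvd ?V" by simp
  then show u3: "u3 \<in> {1..N}" using dV t by (auto simp: Suc_le_eq)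
  have "w3 * u3^2 * ?A a3 dvd ?M" by simp
  then have c3: "w3 * u3^2 * ?A a3 \<le> N" by (rule dM)
  have "?A a2 \<le> w2 * u2^2 * ?A a2" "?A a1 \<le> w1 * u1^2 * ?A a1" using t by simp_all
  then have "?A a2 \<le> N" "?A a1 \<le> N" using t c3 by linarith+
  with u1 u2 u3 show "floor_log u1 \<in> {0..floor_log N}" "floor_log u2 \<in> {0..floor_log N}" "floor_log u3 \<in> {0..floor_log N}"
    "lg_abs a1 \<in> {0..floor_log N}" "lg_abs a2 \<in> {0..floor_log N}"
    by (auto simp: lg_abs_def intro: floor_log_le_iff)
qed

text \<open>The three terms add up to zero, so the largest is at most the sum of the other two.
  Hence the middle term has the size of the largest, and the dyadic sizes of u2 and a2 suffice to
  define P.\<close>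

lemma torsor_pt_top_two:
  assumes "torsor_pt B w0 w1 w2 w3 u1 u2 u3 h a1 a2 a3"
  shows "w3 * u3^2 * nat \<bar>a3\<bar> \<le> 2 * (w2 * u2^2 * nat \<bar>a2\<bar>)"
proof -
  note t = assms[unfolded torsor_pt_def]
  have "int (w3 * u3^2) * a3 = - (int (w1 * u1^2) * a1) - int (w2 * u2^2) * a2" using t by linarith
  then have "\<bar>int (w3 * u3^2) * a3\<bar> \<le> \<bar>int (w1 * u1^2) * a1\<bar> + \<bar>int (w2 * u2^2) * a2\<bar>" by linarith
  then have "int (w3 * u3^2 * nat \<bar>a3\<bar>) \<le> int (w1 * u1^2 * nat \<bar>a1\<bar>) + int (w2 * u2^2 * nat \<bar>a2\<bar>)"
    by (simp add: abs_mult)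
  moreover have "w1 * u1^2 * nat \<bar>a1\<bar> \<le> w2 * u2^2 * nat \<bar>a2\<bar>" using t by blast
  ultimately show ?thesis by linarith
qed

text \<open>Rounding u2^2 and |a2| down to powers of 2 loses at most 4 and 2, and passing from the
  middle to the largest term loses another 2; hence 16.\<close>

lemma torsor_pt_boxes:
  assumes t: "torsor_pt B w0 w1 w2 w3 u1 u2 u3 h a1 a2 a3"
  defines "P \<equiv> real (w2 * 4 ^ floor_log u2 * 2 ^ lg_abs a2)"
  shows "real_of_int \<bar>a1\<bar> \<le> 16 * P / (w1 * 4 ^ floor_log u1)"
    "real_of_int \<bar>a2\<bar> \<le> 16 * P / (w2 * 4 ^ floor_log u2)"
    "real_of_int \<bar>a3\<bar> \<le> 16 * P / (w3 * 4 ^ floor_log u3)"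
    "real (h * w0^2 * (w1 * w2 * w3)) * P \<le> 2 * B"
    "P > 0"
proof -
  note p = t[unfolded torsor_pt_def]
  let ?A = "\<lambda>a::int. nat \<bar>a\<bar>"
  let ?P = "w2 * 4 ^ floor_log u2 * 2 ^ lg_abs a2"
  have lo: "4 ^ floor_log u \<le> u^2" if "u > 0" for u :: nat
    using power_mono[OF floor_log_exp2_le[OF that], of 2] by (simp add: power_mult[symmetric] power2_eq_square flip: power_mult_distrib)
  have hi: "u^2 \<le> 4 * 4 ^ floor_log u" for u :: nat
    using power_mono[OF floor_log_exp2_ge[of u], of 2] by (simp add: power2_eq_square flip: power_mult_distrib)
  have P2: "w2 * u2^2 * ?A a2 \<le> 8 * ?P"
  proof -
    have "w2 * u2^2 * ?A a2 \<le> w2 * (4 * 4 ^ floor_log u2) * (2 * 2 ^ lg_abs a2)"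
      using hi lg_abs_bounds(2)[of a2] p by (intro mult_mono) auto
    then show ?thesis by simp
  qed
  have P1: "?P \<le> w2 * u2^2 * ?A a2" using lo lg_abs_bounds(1)[of a2] p by (intro mult_mono) auto
  have gen: "real_of_int \<bar>a\<bar> \<le> 16 * P / (w * 4 ^ floor_log u)"
    if w: "w > 0" "u > 0" and le: "w * u^2 * ?A a \<le> 16 * ?P" for w u a
  proof -
    have "w * 4 ^ floor_log u * ?A a \<le> w * u^2 * ?A a" using lo[OF w(2)] by (intro mult_mono) auto
    then have "w * 4 ^ floor_log u * ?A a \<le> 16 * ?P" using le by linarith
    then have "real (w * 4 ^ floor_log u * ?A a) \<le> real (16 * ?P)" by (simp only: of_nat_le_iff)
    then have "real w * 4 ^ floor_log u * real_of_int \<bar>a\<bar> \<le> 16 * P" unfolding P_def by simp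
    then show ?thesis using w by (simp add: field_simps)
  qed
  show "real_of_int \<bar>a1\<bar> \<le> 16 * P / (w1 * 4 ^ floor_log u1)" using p P2 by (intro gen) linarith+
  show "real_of_int \<bar>a2\<bar> \<le> 16 * P / (w2 * 4 ^ floor_log u2)" using p P2 by (intro gen) linarith+
  show "real_of_int \<bar>a3\<bar> \<le> 16 * P / (w3 * 4 ^ floor_log u3)"
    using p P2 torsor_pt_top_two[OF t] by (intro gen) linarith+
  have "?P \<le> w3 * u3^2 * ?A a3" using P1 p by linarith
  then have "h * w0^2 * (w1 * w2 * w3) * ?P \<le> h * w0^2 * (w1 * w2 * w3) * (w3 * u3^2 * ?A a3)" by (intro mult_left_mono) auto
  then have "real (h * w0^2 * (w1 * w2 * w3) * ?P) \<le> real (h * w0^2 * (w1 * w2 * w3) * (w3 * u3^2 * ?A a3))"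
    by (simp only: of_nat_le_iff)
  also have "\<dots> \<le> 2 * B" using p by blast
  finally show "real (h * w0^2 * (w1 * w2 * w3)) * P \<le> 2 * B" unfolding P_def by simp
  show "P > 0" unfolding P_def using p by simp
qed

section \<open>Counting torsor points in the conic zone\<close>

text \<open>With P = w2 4^r2 2^j, the first factor bounds the number of h, by h w0^2 W P <= 2 B, and
  the second is the bound of \<open>card_conic_box_le\<close>. The value 0 outside the zone lets all
  exponents be summed freely.\<close>

definition conic_fibre_bound :: "real \<Rightarrow> nat \<Rightarrow> nat \<Rightarrow> nat \<Rightarrow> nat \<Rightarrow> nat \<Rightarrow> nat \<Rightarrow> nat \<Rightarrow> nat \<Rightarrow> real" where
  "conic_fibre_bound B w0 w1 w2 w3 r1 r2 r3 j =
     (if conic_zone w1 w2 w3 r1 r2 r3 j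
      then 2 * B / (real (w0^2 * (w1 * w2 * w3)) * real (w2 * 4 ^ r2 * 2 ^ j)) *
        (70000 * real (w2 * 4 ^ r2 * 2 ^ j)^2 * real (w1 * w2 * w3) powr (-2/3) / 2 ^ (r1 + r2 + r3)
           * (real (divisor_count w1 * divisor_count w2 * divisor_count w3)
              * (dyadic_divisor_sum r1 + dyadic_divisor_sum r2 + dyadic_divisor_sum r3)))
      else 0)"

definition var_range :: "real \<Rightarrow> nat set" where
  "var_range B = {1..nat \<lfloor>3 * B\<rfloor>}"

definition exp_range :: "real \<Rightarrow> nat set" where
  "exp_range B = {0..floor_log (nat \<lfloor>3 * B\<rfloor>)}"

definition conic_sum :: "real \<Rightarrow> real" where
  "conic_sum B = (let I = var_range B; J = exp_range B in
     \<Sum>(w0,w1,w2,w3,r1,r2,r3,j)\<in>I \<times> I \<times> I \<times> I \<times> J \<times> J \<times> J \<times> J. conic_fibre_bound B w0 w1 w2 w3 r1 r2 r3 j)"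

definition conic_points :: "real \<Rightarrow> torsor_tuple set" where
  "conic_points B = {((w0,w1,w2,w3),(u1,u2,u3),h,(a1,a2,a3)) | w0 w1 w2 w3 u1 u2 u3 h a1 a2 a3.
      torsor_pt B w0 w1 w2 w3 u1 u2 u3 h a1 a2 a3 \<and>
      conic_zone w1 w2 w3 (floor_log u1) (floor_log u2) (floor_log u3) (lg_abs a2)}"

text \<open>The points are sorted by the w's and by the dyadic exponents of the u's and of a2, and
  then by h. What remains is a box for the ternary conic: through \<open>torsor_pt_boxes\<close> the
  size P controls all three a_i.\<close>

lemma card_conic_points_le:
  assumes B: "B \<ge> 2"
  shows "finite (conic_points B) \<and> real (card (conic_points B)) \<le> conic_sum B"
proof -
  define I J S where "I = var_range B" and "J = exp_range B" and S_def': "S = conic_points B"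
  note I_def = \<open>I = var_range B\<close>[unfolded var_range_def] and J_def = \<open>J = exp_range B\<close>[unfolded exp_range_def]
    and S_def = S_def'[unfolded conic_points_def]
  define f :: "torsor_tuple \<Rightarrow> _" where
    "f = (\<lambda>((w0,w1,w2,w3),(u1,u2,u3),h,(a1,a2,a3)). (w0,w1,w2,w3,floor_log u1,floor_log u2,floor_log u3,lg_abs a2))"
  show ?thesis
    unfolding conic_sum_def Let_def S_def'[symmetric] \<open>I = var_range B\<close>[symmetric] \<open>J = exp_range B\<close>[symmetric]
  proof (rule card_le_sum_fibres[where f = f])
    show "f ` S \<subseteq> I \<times> I \<times> I \<times> I \<times> J \<times> J \<times> J \<times> J"
    proof (rule image_subsetI)
      fix s assume "s \<in> S"
      then obtain w0 w1 w2 w3 u1 u2 u3 h a1 a2 a3 where s: "s = ((w0,w1,w2,w3),(u1,u2,u3),h,(a1,a2,a3))"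
        and t: "torsor_pt B w0 w1 w2 w3 u1 u2 u3 h a1 a2 a3" unfolding S_def by blast
      show "f s \<in> I \<times> I \<times> I \<times> I \<times> J \<times> J \<times> J \<times> J"
        unfolding s f_def I_def J_def prod.case by (intro SigmaI torsor_pt_range[OF t B])
    qed
    fix p assume "p \<in> I \<times> I \<times> I \<times> I \<times> J \<times> J \<times> J \<times> J"
    then obtain w0 w1 w2 w3 r1 r2 r3 j where p: "p = (w0,w1,w2,w3,r1,r2,r3,j)"
      and wI: "w0 \<in> I" "w1 \<in> I" "w2 \<in> I" "w3 \<in> I" by auto
    have w: "w0 > 0" "w1 > 0" "w2 > 0" "w3 > 0" using wI by (auto simp: I_def)
    let ?R = "{s \<in> S. f s = p}"
    have R: "\<exists>u1 u2 u3 h a1 a2 a3. s = ((w0,w1,w2,w3),(u1,u2,u3),h,(a1,a2,a3)) \<and>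
       torsor_pt B w0 w1 w2 w3 u1 u2 u3 h a1 a2 a3 \<and> conic_zone w1 w2 w3 r1 r2 r3 j \<and>
       floor_log u1 = r1 \<and> floor_log u2 = r2 \<and> floor_log u3 = r3 \<and> lg_abs a2 = j" if "s \<in> ?R" for s
      using that unfolding S_def f_def p by auto
    show "finite ?R \<and> real (card ?R) \<le> (case p of (w0,w1,w2,w3,r1,r2,r3,j) \<Rightarrow> conic_fibre_bound B w0 w1 w2 w3 r1 r2 r3 j)"
    proof (cases "conic_zone w1 w2 w3 r1 r2 r3 j")
      case False
      then have e: "?R = {}" using R by blast
      show ?thesis unfolding e using False by (simp add: p conic_fibre_bound_def)
    next
      case True
      define P where "P = real (w2 * 4 ^ r2 * 2 ^ j)"
      define X where "X = 2 * B / (real (w0^2 * (w1 * w2 * w3)) * P)"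
      define K where "K = 70000 * P^2 * real (w1 * w2 * w3) powr (-2/3) / 2 ^ (r1 + r2 + r3)
           * (real (divisor_count w1 * divisor_count w2 * divisor_count w3)
              * (dyadic_divisor_sum r1 + dyadic_divisor_sum r2 + dyadic_divisor_sum r3))"
      have P0: "P > 0" using w by (simp add: P_def)
      have X0: "X \<ge> 0" using B P0 by (simp add: X_def)
      have K0: "K \<ge> 0" using dyadic_divisor_sum_nonneg by (simp add: K_def)
      have "finite ?R \<and> real (card ?R) \<le> (\<Sum>h\<in>{1..nat \<lfloor>X\<rfloor>}. K)"
      proof (rule card_le_sum_fibres[where f = "\<lambda>(w,u,h,a). h"])
        show "(\<lambda>(w,u,h,a). h) ` ?R \<subseteq> {1..nat \<lfloor>X\<rfloor>}"
        proof
          fix h assume "h \<in> (\<lambda>(w,u,h,a). h) ` ?R"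
          then obtain s where s: "s \<in> ?R" "h = (\<lambda>(w,u,h,a). h) s" by blast
          from R[OF s(1)] s(2) obtain u1 u2 u3 a1 a2 a3 where t: "torsor_pt B w0 w1 w2 w3 u1 u2 u3 h a1 a2 a3"
            "floor_log u2 = r2" "lg_abs a2 = j" by auto
          have "real (h * w0^2 * (w1 * w2 * w3)) * P \<le> 2 * B"
            using torsor_pt_boxes(4)[OF t(1)] unfolding t(2,3) P_def .
          then have "real h * (real (w0^2 * (w1 * w2 * w3)) * P) \<le> 2 * B" by (simp add: mult.assoc)
          moreover have "real (w0^2 * (w1 * w2 * w3)) * P > 0" using w P0 by simp
          ultimately have "real h \<le> X" unfolding X_def by (subst pos_le_divide_eq) auto
          moreover have "h > 0" using t by (simp add: torsor_pt_def)
          ultimately show "h \<in> {1..nat \<lfloor>X\<rfloor>}" by (simp add: le_nat_floor Suc_le_eq)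
        qed
        fix h0 assume "h0 \<in> {1..nat \<lfloor>X\<rfloor>}"
        let ?Q = "{s \<in> ?R. (case s of (w,u,h,a) \<Rightarrow> h) = h0}"
        have Q: "\<exists>u1 u2 u3 a1 a2 a3. s = ((w0,w1,w2,w3),(u1,u2,u3),h0,(a1,a2,a3)) \<and>
           torsor_pt B w0 w1 w2 w3 u1 u2 u3 h0 a1 a2 a3 \<and>
           floor_log u1 = r1 \<and> floor_log u2 = r2 \<and> floor_log u3 = r3 \<and> lg_abs a2 = j" if s: "s \<in> ?Q" for s
        proof -
          from s have "s \<in> ?R" "(case s of (w,u,h,a) \<Rightarrow> h) = h0" by simp_all
          moreover obtain u1 u2 u3 h a1 a2 a3 where "s = ((w0,w1,w2,w3),(u1,u2,u3),h,(a1,a2,a3))"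
            "torsor_pt B w0 w1 w2 w3 u1 u2 u3 h a1 a2 a3"
            "floor_log u1 = r1" "floor_log u2 = r2" "floor_log u3 = r3" "lg_abs a2 = j"
            using R[OF calculation(1)] by blast
          ultimately show ?thesis by auto
        qed
        define U1 U2 U3 :: "torsor_tuple \<Rightarrow> nat"
          where "U1 = (\<lambda>(_,(u1,_,_),_). u1)" and "U2 = (\<lambda>(_,(_,u2,_),_). u2)" and "U3 = (\<lambda>(_,(_,_,u3),_). u3)"
        define A1 A2 A3 :: "torsor_tuple \<Rightarrow> int"
          where "A1 = (\<lambda>(_,_,_,(a1,_,_)). a1)" and "A2 = (\<lambda>(_,_,_,(_,a2,_)). a2)" and "A3 = (\<lambda>(_,_,_,(_,_,a3)). a3)"
        note sel = U1_def U2_def U3_def A1_def A2_def A3_def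
        show "finite ?Q \<and> real (card ?Q) \<le> K"
          unfolding K_def
        proof (rule card_conic_box_le[where x = U1 and y = U2 and u = U3 and a = A1 and b = A2 and c = A3,
              OF _ w(2,3,4) P0])
          show "inj_on (\<lambda>s. (U1 s, U2 s, U3 s, A1 s, A2 s, A3 s)) ?Q"
          proof (rule inj_onI)
            fix s t assume "s \<in> ?Q" "t \<in> ?Q" and e: "(U1 s, U2 s, U3 s, A1 s, A2 s, A3 s) = (U1 t, U2 t, U3 t, A1 t, A2 t, A3 t)"
            from Q[OF \<open>s \<in> ?Q\<close>] Q[OF \<open>t \<in> ?Q\<close>] e show "s = t" by (elim exE conjE) (simp add: sel)
          qed
          fix s assume "s \<in> ?Q"
          from Q[OF this] obtain u1 u2 u3 a1 a2 a3 where s: "s = ((w0,w1,w2,w3),(u1,u2,u3),h0,(a1,a2,a3))"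
            and t: "torsor_pt B w0 w1 w2 w3 u1 u2 u3 h0 a1 a2 a3"
            and r: "floor_log u1 = r1" "floor_log u2 = r2" "floor_log u3 = r3" "lg_abs a2 = j" by blast
          note tb = torsor_pt_boxes[OF t, unfolded r, folded P_def, unfolded of_int_abs]
          have dy: "v \<in> {2 ^ floor_log v..<2 * 2 ^ floor_log v}" if "v > 0" for v
            using floor_log_exp2_le[OF that] floor_log_exp2_gt[of v] by simp
          have u: "u1 \<in> {2 ^ r1..<2 * 2 ^ r1}" "u2 \<in> {2 ^ r2..<2 * 2 ^ r2}" "u3 \<in> {2 ^ r3..<2 * 2 ^ r3}"
            using dy[of u1] dy[of u2] dy[of u3] t unfolding r torsor_pt_def by blast+
          have e: "U1 s = u1" "U2 s = u2" "U3 s = u3" "A1 s = a1" "A2 s = a2" "A3 s = a3" by (simp_all add: s sel)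
          show "U1 s \<in> {2 ^ r1..<2 * 2 ^ r1} \<and> U2 s \<in> {2 ^ r2..<2 * 2 ^ r2} \<and> U3 s \<in> {2 ^ r3..<2 * 2 ^ r3} \<and>
             A1 s \<noteq> 0 \<and> A2 s \<noteq> 0 \<and> A3 s \<noteq> 0 \<and> \<bar>real_of_int (A1 s)\<bar> \<le> 16 * P / (w1 * 4 ^ r1) \<and>
             \<bar>real_of_int (A2 s)\<bar> \<le> 16 * P / (w2 * 4 ^ r2) \<and> \<bar>real_of_int (A3 s)\<bar> \<le> 16 * P / (w3 * 4 ^ r3) \<and>
             int (w1 * U1 s ^ 2) * A1 s + int (w2 * U2 s ^ 2) * A2 s + int (w3 * U3 s ^ 2) * A3 s = 0 \<and>
             coprime (int (w1 * U1 s ^ 2) * A1 s) (int (w2 * U2 s ^ 2) * A2 s) \<and>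
             coprime (int (w1 * U1 s ^ 2) * A1 s) (int (w3 * U3 s ^ 2) * A3 s) \<and>
             coprime (int (w2 * U2 s ^ 2) * A2 s) (int (w3 * U3 s ^ 2) * A3 s)"
            unfolding e using t[unfolded torsor_pt_def] u tb by blast
        qed
      qed simp
      moreover have "(\<Sum>h\<in>{1..nat \<lfloor>X\<rfloor>}. K) \<le> X * K"
        using X0 K0 by (simp add: mult_right_mono)
      ultimately have "finite ?R \<and> real (card ?R) \<le> X * K" by linarith
      then show ?thesis using True by (simp add: p conic_fibre_bound_def X_def K_def P_def)
    qed
  qed (simp add: I_def J_def)
qed

section \<open>Counting torsor points outside the conic zone\<close>

text \<open>This is the summand 1 of \<open>card_plane_box_le\<close>, doubled. The condition
  records what makes its sum small: the point lies outside the conic zone, and the height restricts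
  h.\<close>

definition lattice_error :: "real \<Rightarrow> nat \<Rightarrow> nat \<Rightarrow> nat \<Rightarrow> nat \<Rightarrow> nat \<Rightarrow> nat \<Rightarrow> nat \<Rightarrow> nat \<Rightarrow> nat \<Rightarrow> real" where
  "lattice_error B w0 w1 w2 w3 u1 u2 u3 j h =
     (if \<not> conic_zone w1 w2 w3 (floor_log u1) (floor_log u2) (floor_log u3) j \<and>
        real (h * w0^2 * (w1 * w2 * w3)) * real (w2 * 4 ^ floor_log u2 * 2 ^ j) \<le> 2 * B
      then 2 else 0)"

text \<open>This is the area term of \<open>card_plane_box_le\<close>, with 32 = 2 * 16. Writing c_i
  = w_i u_i^2, the second condition is h^3 |a1 a2 a3| <= B with |a3| replaced by its lower bound c2
  |a2| / c3. The third is c1 |a1| <= c2 |a2| after dyadic rounding.\<close>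

definition lattice_main :: "real \<Rightarrow> nat \<Rightarrow> nat \<Rightarrow> nat \<Rightarrow> nat \<Rightarrow> nat \<Rightarrow> nat \<Rightarrow> nat \<Rightarrow> nat \<Rightarrow> nat \<Rightarrow> nat \<Rightarrow> real" where
  "lattice_main B w0 w1 w2 w3 u1 u2 u3 i j h =
     (if real (w0^3 * (w1 * w2 * w3)^2 * (u1 * u2 * u3)) \<le> 3 * B \<and>
        real (h^3 * (2 ^ i * (2 ^ j)^2) * (w2 * u2^2)) \<le> B * real (w3 * u3^2) \<and>
        w1 * u1^2 * 2 ^ i \<le> 2 * (w2 * u2^2) * 2 ^ j
      then 32 * 2 ^ i * 2 ^ j / real (w3 * u3^2) else 0)"

lemma lattice_error_nonneg: "lattice_error B w0 w1 w2 w3 u1 u2 u3 j h \<ge> 0"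
  by (simp add: lattice_error_def)

lemma lattice_main_nonneg: "lattice_main B w0 w1 w2 w3 u1 u2 u3 i j h \<ge> 0"
  by (simp add: lattice_main_def)

definition lattice_sum :: "real \<Rightarrow> real" where
  "lattice_sum B = (let I = var_range B; J = exp_range B in
     \<Sum>(w0,w1,w2,w3,u1,u2,u3,i,j,h)\<in>I \<times> I \<times> I \<times> I \<times> I \<times> I \<times> I \<times> J \<times> J \<times> I.
       lattice_error B w0 w1 w2 w3 u1 u2 u3 j h + lattice_main B w0 w1 w2 w3 u1 u2 u3 i j h)"

definition lattice_points :: "real \<Rightarrow> torsor_tuple set" where
  "lattice_points B = {((w0,w1,w2,w3),(u1,u2,u3),h,(a1,a2,a3)) | w0 w1 w2 w3 u1 u2 u3 h a1 a2 a3.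
      torsor_pt B w0 w1 w2 w3 u1 u2 u3 h a1 a2 a3 \<and>
      \<not> conic_zone w1 w2 w3 (floor_log u1) (floor_log u2) (floor_log u3) (lg_abs a2)}"

text \<open>With w, u and h fixed, the a_i lie in a box on a plane through the origin. Any point of
  a nonempty fibre certifies the conditions in \<open>lattice_error\<close> and
  \<open>lattice_main\<close>; for an empty fibre nonnegativity is enough.\<close>

lemma card_lattice_points_le:
  assumes B: "B \<ge> 2"
  shows "finite (lattice_points B) \<and> real (card (lattice_points B)) \<le> lattice_sum B"
proof -
  define I J S where "I = var_range B" and "J = exp_range B" and S_def': "S = lattice_points B"
  note I_def = \<open>I = var_range B\<close>[unfolded var_range_def] and J_def = \<open>J = exp_range B\<close>[unfolded exp_range_def]
    and S_def = S_def'[unfolded lattice_points_def]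
  define f :: "torsor_tuple \<Rightarrow> _" where
    "f = (\<lambda>((w0,w1,w2,w3),(u1,u2,u3),h,(a1,a2,a3)). (w0,w1,w2,w3,u1,u2,u3,lg_abs a1,lg_abs a2,h))"
  show ?thesis
    unfolding lattice_sum_def Let_def S_def'[symmetric] \<open>I = var_range B\<close>[symmetric] \<open>J = exp_range B\<close>[symmetric]
  proof (rule card_le_sum_fibres[where f = f])
    show "f ` S \<subseteq> I \<times> I \<times> I \<times> I \<times> I \<times> I \<times> I \<times> J \<times> J \<times> I"
    proof (rule image_subsetI)
      fix s assume "s \<in> S"
      then obtain w0 w1 w2 w3 u1 u2 u3 h a1 a2 a3 where s: "s = ((w0,w1,w2,w3),(u1,u2,u3),h,(a1,a2,a3))"
        and t: "torsor_pt B w0 w1 w2 w3 u1 u2 u3 h a1 a2 a3" unfolding S_def by blast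
      show "f s \<in> I \<times> I \<times> I \<times> I \<times> I \<times> I \<times> I \<times> J \<times> J \<times> I"
        unfolding s f_def I_def J_def prod.case by (intro SigmaI torsor_pt_range[OF t B])
    qed
    fix p assume "p \<in> I \<times> I \<times> I \<times> I \<times> I \<times> I \<times> I \<times> J \<times> J \<times> I"
    obtain w0 w1 w2 w3 u1 u2 u3 i j h where p: "p = (w0,w1,w2,w3,u1,u2,u3,i,j,h)" by (metis surj_pair)
    let ?R = "{s \<in> S. f s = p}"
    have R: "\<exists>a1 a2 a3. s = ((w0,w1,w2,w3),(u1,u2,u3),h,(a1,a2,a3)) \<and>
       torsor_pt B w0 w1 w2 w3 u1 u2 u3 h a1 a2 a3 \<and>
       \<not> conic_zone w1 w2 w3 (floor_log u1) (floor_log u2) (floor_log u3) j \<and> lg_abs a1 = i \<and> lg_abs a2 = j"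
      if "s \<in> ?R" for s
      using that unfolding S_def f_def p by auto
    show "finite ?R \<and> real (card ?R) \<le> (case p of (w0,w1,w2,w3,u1,u2,u3,i,j,h) \<Rightarrow>
         lattice_error B w0 w1 w2 w3 u1 u2 u3 j h + lattice_main B w0 w1 w2 w3 u1 u2 u3 i j h)"
    proof (cases "?R = {}")
      case True
      show ?thesis unfolding True using lattice_error_nonneg lattice_main_nonneg by (simp add: p)
    next
      case False
      then obtain s0 where "s0 \<in> ?R" by blast
      from R[OF this] obtain a1 a2 a3 where t: "torsor_pt B w0 w1 w2 w3 u1 u2 u3 h a1 a2 a3"
        and z: "\<not> conic_zone w1 w2 w3 (floor_log u1) (floor_log u2) (floor_log u3) j"
        and ij: "lg_abs a1 = i" "lg_abs a2 = j" by blast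
      note tp = t[unfolded torsor_pt_def]
      have l1: "2 ^ i \<le> nat \<bar>a1\<bar>" "nat \<bar>a1\<bar> < 2 * 2 ^ i" "2 ^ j \<le> nat \<bar>a2\<bar>" "nat \<bar>a2\<bar> < 2 * 2 ^ j"
        using lg_abs_bounds[of a1] lg_abs_bounds[of a2] tp unfolding ij by blast+
      have err: "lattice_error B w0 w1 w2 w3 u1 u2 u3 j h = 2"
        using z torsor_pt_boxes(4)[OF t] unfolding ij lattice_error_def by simp
      have main: "lattice_main B w0 w1 w2 w3 u1 u2 u3 i j h = 32 * 2 ^ i * 2 ^ j / real (w3 * u3^2)"
      proof -
        have "w1 * u1^2 * 2 ^ i \<le> w1 * u1^2 * nat \<bar>a1\<bar>" using l1 by simp
        also have "\<dots> \<le> w2 * u2^2 * nat \<bar>a2\<bar>" using tp by blast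
        also have "\<dots> \<le> w2 * u2^2 * (2 * 2 ^ j)" using l1 by (intro mult_left_mono) auto
        finally have 1: "w1 * u1^2 * 2 ^ i \<le> 2 * (w2 * u2^2) * 2 ^ j" by (simp add: ac_simps)
        have "h^3 * (2 ^ i * (2 ^ j)^2) * (w2 * u2^2) = h^3 * 2 ^ i * 2 ^ j * (w2 * u2^2 * 2 ^ j)"
          by (simp add: power2_eq_square ac_simps)
        also have "\<dots> \<le> h^3 * nat \<bar>a1\<bar> * nat \<bar>a2\<bar> * (w2 * u2^2 * nat \<bar>a2\<bar>)"
          using l1 by (intro mult_mono) auto
        also have "\<dots> \<le> h^3 * nat \<bar>a1\<bar> * nat \<bar>a2\<bar> * (w3 * u3^2 * nat \<bar>a3\<bar>)"
          using tp by (intro mult_left_mono) auto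
        also have "\<dots> = (h^3 * (nat \<bar>a1\<bar> * nat \<bar>a2\<bar> * nat \<bar>a3\<bar>)) * (w3 * u3^2)" by (simp add: ac_simps)
        finally have "real (h^3 * (2 ^ i * (2 ^ j)^2) * (w2 * u2^2)) \<le> real ((h^3 * (nat \<bar>a1\<bar> * nat \<bar>a2\<bar> * nat \<bar>a3\<bar>)) * (w3 * u3^2))"
          by (simp only: of_nat_le_iff)
        also have "\<dots> = real (h^3 * (nat \<bar>a1\<bar> * nat \<bar>a2\<bar> * nat \<bar>a3\<bar>)) * real (w3 * u3^2)" by (rule of_nat_mult)
        also have "\<dots> \<le> B * real (w3 * u3^2)" using tp by (intro mult_right_mono) auto
        finally show ?thesis unfolding lattice_main_def using 1 tp by simp
      qed
      let ?g = "\<lambda>s::torsor_tuple. snd (snd (snd s))"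
      have inj: "inj_on ?g ?R"
      proof (rule inj_onI)
        fix s t assume "s \<in> ?R" "t \<in> ?R" "?g s = ?g t"
        with R[OF \<open>s \<in> ?R\<close>] R[OF \<open>t \<in> ?R\<close>] show "s = t" by (elim exE conjE) simp
      qed
      have "finite (?g ` ?R) \<and> real (card (?g ` ?R)) \<le> 2 * (1 + 16 * 2 ^ i * 2 ^ j / real_of_int (int (w3 * u3^2)))"
      proof (rule card_plane_box_le[where ?c1.0 = "int (w1 * u1^2)" and ?c2.0 = "int (w2 * u2^2)"])
        show "0 < int (w3 * u3^2)" using tp by simp
        have "coprime (int (w1 * u1^2) * a1) (int (w3 * u3^2) * a3)" using tp by blast
        then show "coprime (int (w1 * u1^2)) (int (w3 * u3^2))" by (rule coprime_divisors[rotated 2]) (rule dvd_triv_left)+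
        fix x y z assume "(x,y,z) \<in> ?g ` ?R"
        then obtain s where s: "s \<in> ?R" "?g s = (x,y,z)" by force
        with R[OF s(1)] have t': "torsor_pt B w0 w1 w2 w3 u1 u2 u3 h x y z" "lg_abs x = i" "lg_abs y = j" by auto
        note tp' = t'(1)[unfolded torsor_pt_def]
        have "coprime (int (w1 * u1^2) * x) (int (w2 * u2^2) * y)" using tp' by blast
        then have c: "coprime x y" by (rule coprime_divisors[rotated 2]) (rule dvd_triv_right)+
        have l: "2 ^ i \<le> nat \<bar>x\<bar>" "nat \<bar>x\<bar> \<le> 2 * 2 ^ i" "2 ^ j \<le> nat \<bar>y\<bar>" "nat \<bar>y\<bar> \<le> 2 * 2 ^ j"
          using lg_abs_bounds[of x] lg_abs_bounds[of y] tp' unfolding t'(2,3) by (blast intro: less_imp_le)+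
        have "real (2 ^ i) \<le> real (nat \<bar>x\<bar>)" "real (nat \<bar>x\<bar>) \<le> real (2 * 2 ^ i)"
          "real (2 ^ j) \<le> real (nat \<bar>y\<bar>)" "real (nat \<bar>y\<bar>) \<le> real (2 * 2 ^ j)"
          using l by (simp_all only: of_nat_le_iff)
        then have "2 ^ i \<le> \<bar>real_of_int x\<bar> \<and> \<bar>real_of_int x\<bar> \<le> 2 * 2 ^ i \<and> 2 ^ j \<le> \<bar>real_of_int y\<bar> \<and> \<bar>real_of_int y\<bar> \<le> 2 * 2 ^ j"
          by simp
        then show "coprime x y \<and> int (w1 * u1^2) * x + int (w2 * u2^2) * y + int (w3 * u3^2) * z = 0 \<and>
          2 ^ i \<le> \<bar>real_of_int x\<bar> \<and> \<bar>real_of_int x\<bar> \<le> 2 * 2 ^ i \<and> 2 ^ j \<le> \<bar>real_of_int y\<bar> \<and> \<bar>real_of_int y\<bar> \<le> 2 * 2 ^ j"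
          using c tp' by blast
      qed auto
      then have "finite ?R \<and> real (card ?R) \<le> 2 * (1 + 16 * 2 ^ i * 2 ^ j / real_of_int (int (w3 * u3^2)))"
        using inj by (auto simp only: card_image dest: finite_imageD)
      moreover have "2 * (1 + 16 * 2 ^ i * 2 ^ j / real_of_int (int (w3 * u3^2))) = 2 + 32 * 2 ^ i * 2 ^ j / real (w3 * u3^2)"
        by simp
      ultimately show ?thesis unfolding p prod.case err main by simp
    qed
  qed (simp add: I_def J_def)
qed

section \<open>Summation over the torsor variables\<close>

text \<open>The term at n = 0 vanishes, as 0 \<open>powr\<close> x = 0, so this is the zeta function
  at 4/3. The exponent is the one that the switch between the two counts produces for w1, w2 and
  w3.\<close>

definition zeta_four_thirds :: real where
  "zeta_four_thirds = (\<Sum>n. real n powr (-4/3))"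

lemma sum_powr_minus_four_thirds_le:
  assumes "finite A"
  shows "(\<Sum>n\<in>A. real n powr (-4/3)) \<le> zeta_four_thirds"
  unfolding zeta_four_thirds_def
  by (rule sum_le_suminf) (use assms in \<open>auto simp: summable_real_powr_iff\<close>)

lemma zeta_four_thirds_nonneg: "zeta_four_thirds \<ge> 0"
  using sum_powr_minus_four_thirds_le[of "{}"] by simp

text \<open>Weakening 1 / n^2 in this way lets one constant serve for w0, h and the w_i.\<close>

lemma inverse_square_le: "n > 0 \<Longrightarrow> 1 / real n ^ 2 \<le> real n powr (-4/3)"
proof -
  assume n: "n > 0"
  have "1 / real n ^ 2 = real n powr (-2)" using n by (simp add: powr_minus_divide powr_numeral)
  also have "\<dots> \<le> real n powr (-4/3)" using n by (intro powr_mono) auto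
  finally show ?thesis .
qed

lemma sum_inverse_square_le: "(\<Sum>n\<in>{1..N}. 1 / real n ^ 2) \<le> zeta_four_thirds"
proof -
  have "(\<Sum>n\<in>{1..N}. 1 / real n ^ 2) \<le> (\<Sum>n\<in>{1..N}. real n powr (-4/3))"
    by (intro sum_mono inverse_square_le) auto
  then show ?thesis using sum_powr_minus_four_thirds_le[of "{1..N}"] by simp
qed

lemma sum_divisor_count_four_thirds_le:
  "(\<Sum>w\<in>{1..N}. real (divisor_count w) * real w powr (-4/3)) \<le> zeta_four_thirds ^ 2"
proof -
  have "(\<Sum>w\<in>{1..N}. real (divisor_count w) * real w powr (-4/3)) \<le> (\<Sum>n\<in>{1..N}. real n powr (-4/3)) ^ 2"
    unfolding divisor_count_def by (rule sum_divisor_count_le) (auto simp: powr_mult)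
  also have "\<dots> \<le> zeta_four_thirds ^ 2"
    by (intro power_mono sum_powr_minus_four_thirds_le sum_nonneg) auto
  finally show ?thesis .
qed

text \<open>The dyadic blocks are disjoint, with \<open>floor_log\<close> recovering the block of u,
  so the sum over r is part of a single sum of tau(u)^2 / u up to 6 B.\<close>

lemma sum_dyadic_divisor_sum_le:
  assumes "B \<ge> 2"
  shows "(\<Sum>r\<in>{0..floor_log (nat \<lfloor>3 * B\<rfloor>)}. dyadic_divisor_sum r) \<le> (6 * ln B) ^ 4"
proof -
  let ?N = "nat \<lfloor>3 * B\<rfloor>" and ?M = "nat \<lfloor>6 * B\<rfloor>"
  let ?J = "{0..floor_log ?N}"
  let ?f = "\<lambda>u. real (divisor_count u) ^ 2 / real u"
  have "(\<Sum>r\<in>?J. dyadic_divisor_sum r) = (\<Sum>(r,u)\<in>Sigma ?J (\<lambda>r. {2 ^ r..<2 * 2 ^ r}). ?f u)"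
    unfolding dyadic_divisor_sum_def by (rule sum.Sigma) auto
  also have "\<dots> \<le> (\<Sum>u\<in>{1..?M}. ?f u)"
  proof (rule sum_le_included[where i = "\<lambda>u. (floor_log u, u)"])
    show "\<forall>x\<in>Sigma ?J (\<lambda>r. {2 ^ r..<2 * 2 ^ r}). \<exists>y\<in>{1..?M}. (floor_log y, y) = x \<and> (case x of (r,u) \<Rightarrow> ?f u) \<le> ?f y"
    proof safe
      fix r u :: nat assume r: "r \<in> ?J" and u: "u \<in> {2 ^ r..<2 * 2 ^ r}"
      have "(1::nat) \<le> 2 ^ r" by simp
      then have u1: "u \<ge> 1" using u by (simp only: atLeastLessThan_iff) linarith
      have fl: "floor_log u = r" using u by (intro floor_log_eqI) auto
      have "?N > 0" using assms by linarith
      then have "2 ^ floor_log ?N \<le> ?N" by (rule floor_log_exp2_le)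
      moreover have "(2::nat) ^ r \<le> 2 ^ floor_log ?N" using r by (intro power_increasing) auto
      ultimately have "u \<le> 2 * ?N" using u by (simp only: atLeastLessThan_iff) linarith
      then have "u \<le> ?M" using assms by linarith
      with u1 fl show "\<exists>y\<in>{1..?M}. (floor_log y, y) = (r,u) \<and> ?f u \<le> ?f y"
        by (intro bexI[of _ u]) auto
    qed
  qed auto
  also have "\<dots> \<le> (\<Sum>n\<in>{1..?M}. 1 / real n) ^ 4"
    unfolding divisor_count_def by (rule sum_divisor_count_square_le)
  also have "\<dots> \<le> (6 * ln B) ^ 4"
    using assms by (intro power_mono harmonic_sum_le_ln sum_nonneg) auto
  finally show ?thesis .
qed

section \<open>Summing the bound for the conic zone\<close>

text \<open>The bound is proportional to P, hence to 2^j, and the zone ends at P = V W^(1/3) with V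
  = 2^(r1 + r2 + r3). So the sum over j is at most twice the value at that end. There V cancels, and
  the exponents of W add up to -1 - 2/3 + 1/3 = -4/3. The constant is 2 * 70000 * 2.\<close>

lemma sum_conic_fibre_bound_j_le:
  assumes B: "B \<ge> 2" and w: "w0 > 0" "w1 > 0" "w2 > 0" "w3 > 0"
  shows "(\<Sum>j\<in>{0..n}. conic_fibre_bound B w0 w1 w2 w3 r1 r2 r3 j) \<le>
     280000 * B * (real w0 powr (-4/3) * ((real (divisor_count w1) * real w1 powr (-4/3)) *
       ((real (divisor_count w2) * real w2 powr (-4/3)) * ((real (divisor_count w3) * real w3 powr (-4/3)) *
       (dyadic_divisor_sum r1 + dyadic_divisor_sum r2 + dyadic_divisor_sum r3)))))"
proof -
  define W where "W = real (w1 * w2 * w3)"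
  define V where "V = (2::real) ^ (r1 + r2 + r3)"
  define c where "c = real (w2 * 4 ^ r2)"
  define D where "D = real (divisor_count w1 * divisor_count w2 * divisor_count w3)"
  define s where "s = dyadic_divisor_sum r1 + dyadic_divisor_sum r2 + dyadic_divisor_sum r3"
  define J where "J = {j \<in> {0..n}. conic_zone w1 w2 w3 r1 r2 r3 j}"
  have pos: "W > 0" "V > 0" "c > 0" using w by (simp_all add: W_def V_def c_def)
  have s0: "s \<ge> 0" using dyadic_divisor_sum_nonneg by (simp add: s_def)
  have D0: "D \<ge> 0" by (simp add: D_def)
  have "(\<Sum>j\<in>{0..n}. conic_fibre_bound B w0 w1 w2 w3 r1 r2 r3 j) = (\<Sum>j\<in>J. conic_fibre_bound B w0 w1 w2 w3 r1 r2 r3 j)"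
    unfolding J_def by (rule sum.mono_neutral_right) (auto simp: conic_fibre_bound_def)
  also have "\<dots> = (\<Sum>j\<in>J. 140000 * B * c * (W powr (-2/3) * D * s / (real w0^2 * W * V)) * 2 ^ j)"
  proof (rule sum.cong[OF refl])
    fix j assume "j \<in> J"
    then have z: "conic_zone w1 w2 w3 r1 r2 r3 j" by (simp add: J_def)
    have e: "real (w2 * 4 ^ r2 * 2 ^ j) = c * 2 ^ j" "real (w0^2 * (w1 * w2 * w3)) = real w0^2 * W"
      by (simp_all add: c_def W_def)
    show "conic_fibre_bound B w0 w1 w2 w3 r1 r2 r3 j = 140000 * B * c * (W powr (-2/3) * D * s / (real w0^2 * W * V)) * 2 ^ j"
      unfolding conic_fibre_bound_def if_P[OF z] e
      unfolding W_def[symmetric] V_def[symmetric] D_def[symmetric] s_def[symmetric]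
      using pos w by (simp add: field_simps power2_eq_square)
  qed
  also have "\<dots> = 140000 * B * c * (W powr (-2/3) * D * s / (real w0^2 * W * V)) * (\<Sum>j\<in>J. 2 ^ j)"
    by (simp add: sum_distrib_left)
  also have "\<dots> \<le> 140000 * B * c * (W powr (-2/3) * D * s / (real w0^2 * W * V)) * (2 * (V * W powr (1/3) / c))"
  proof (rule mult_left_mono)
    show "(\<Sum>j\<in>J. 2 ^ j) \<le> 2 * (V * W powr (1/3) / c)"
    proof (rule sum_dyadic_le)
      fix j assume "j \<in> J"
      then have "c * 2 ^ j < V * W powr (1/3)" by (simp add: J_def conic_zone_def c_def V_def W_def)
      then show "2 ^ j \<le> V * W powr (1/3) / c" using pos by (simp add: field_simps)
    qed (use pos in \<open>auto simp: J_def\<close>)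
  qed (use pos s0 D0 B in auto)
  also have "\<dots> = 280000 * B * (1 / real w0^2 * (D * (W powr (-2/3) * W powr (1/3) / W) * s))"
    using pos w by (simp add: field_simps)
  also have "W powr (-2/3) * W powr (1/3) / W = W powr (-4/3)"
  proof -
    have "W powr (-2/3) * W powr (1/3) / W = W powr (-2/3) * W powr (1/3) / W powr 1" using pos by simp
    also have "\<dots> = W powr (-4/3)" by (simp add: powr_add[symmetric] powr_diff[symmetric] del: powr_one')
    finally show ?thesis .
  qed
  also have "280000 * B * (1 / real w0^2 * (D * W powr (-4/3) * s)) \<le> 280000 * B * (real w0 powr (-4/3) * (D * W powr (-4/3) * s))"
    using inverse_square_le[OF w(1)] B D0 s0 by (intro mult_left_mono mult_right_mono) auto
  also have "D * W powr (-4/3) * s = (real (divisor_count w1) * real w1 powr (-4/3)) *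
       ((real (divisor_count w2) * real w2 powr (-4/3)) * ((real (divisor_count w3) * real w3 powr (-4/3)) * s))"
    using w by (simp add: D_def W_def powr_mult)
  finally show ?thesis unfolding s_def .
qed

lemma conic_sum_le:
  "\<exists>C\<ge>0. \<forall>B\<ge>2. conic_sum B \<le> C * B * ln B ^ 6"
proof (intro exI[of _ "280000 * (zeta_four_thirds * (zeta_four_thirds^2 * (zeta_four_thirds^2 * (zeta_four_thirds^2 * (3 * 6^6)))))"] conjI allI impI)
  let ?Z = zeta_four_thirds
  show "0 \<le> 280000 * (?Z * (?Z^2 * (?Z^2 * (?Z^2 * (3 * 6^6)))))" using zeta_four_thirds_nonneg by simp
  fix B :: real assume B: "B \<ge> 2"
  define I J where "I = var_range B" and "J = exp_range B"
  note I_def = \<open>I = var_range B\<close>[unfolded var_range_def] and J_def = \<open>J = exp_range B\<close>[unfolded exp_range_def]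
  define f where "f = (\<lambda>w. real w powr (-4/3))"
  define g where "g = (\<lambda>w. real (divisor_count w) * real w powr (-4/3))"
  define L where "L = 6 * ln B"
  have L0: "L \<ge> 0" using B by (simp add: L_def)
  have bnd: "(\<Sum>w\<in>I. f w) \<le> ?Z" "(\<Sum>w\<in>I. g w) \<le> ?Z^2" "real (card J) \<le> L" "(\<Sum>r\<in>J. dyadic_divisor_sum r) \<le> L^4"
    using sum_powr_minus_four_thirds_le[of I] sum_divisor_count_four_thirds_le card_dyadic_le_ln[OF B] sum_dyadic_divisor_sum_le[OF B]
    by (simp_all add: f_def g_def I_def J_def L_def)
  have nn: "(\<Sum>w\<in>I. f w) \<ge> 0" "(\<Sum>w\<in>I. g w) \<ge> 0" "(\<Sum>r\<in>J. dyadic_divisor_sum r) \<ge> 0"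
    by (auto intro!: sum_nonneg simp: f_def g_def dyadic_divisor_sum_nonneg)
  have ipos: "w > 0" if "w \<in> I" for w using that by (auto simp: I_def)
  have "(\<Sum>(w0,w1,w2,w3,r1,r2,r3,j)\<in>I \<times> I \<times> I \<times> I \<times> J \<times> J \<times> J \<times> J. conic_fibre_bound B w0 w1 w2 w3 r1 r2 r3 j)
     = (\<Sum>w0\<in>I. \<Sum>w1\<in>I. \<Sum>w2\<in>I. \<Sum>w3\<in>I. \<Sum>r1\<in>J. \<Sum>r2\<in>J. \<Sum>r3\<in>J. \<Sum>j\<in>J. conic_fibre_bound B w0 w1 w2 w3 r1 r2 r3 j)"
    by (simp only: sum.cartesian_product[symmetric])
  also have "\<dots> \<le> (\<Sum>w0\<in>I. \<Sum>w1\<in>I. \<Sum>w2\<in>I. \<Sum>w3\<in>I. \<Sum>r1\<in>J. \<Sum>r2\<in>J. \<Sum>r3\<in>J.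
      280000 * B * (f w0 * (g w1 * (g w2 * (g w3 * (dyadic_divisor_sum r1 + dyadic_divisor_sum r2 + dyadic_divisor_sum r3))))))"
    unfolding f_def g_def J_def by (intro sum_mono sum_conic_fibre_bound_j_le B ipos)
  also have "\<dots> = 280000 * B * ((\<Sum>w\<in>I. f w) * ((\<Sum>w\<in>I. g w) * ((\<Sum>w\<in>I. g w) * ((\<Sum>w\<in>I. g w) *
       (\<Sum>r1\<in>J. \<Sum>r2\<in>J. \<Sum>r3\<in>J. dyadic_divisor_sum r1 + dyadic_divisor_sum r2 + dyadic_divisor_sum r3)))))"
    by (simp only: sum_distrib_left[symmetric] sum_distrib_right[symmetric])
  \<comment> \<open>The three summands contribute equally. In each, two exponents run freely and
    give L^2, and the third gives L^4.\<close>
  also have "(\<Sum>r1\<in>J. \<Sum>r2\<in>J. \<Sum>r3\<in>J. dyadic_divisor_sum r1 + dyadic_divisor_sum r2 + dyadic_divisor_sum r3)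
      = 3 * (real (card J) ^ 2 * (\<Sum>r\<in>J. dyadic_divisor_sum r))"
    by (simp add: sum.distrib sum_distrib_left[symmetric] power2_eq_square)
  also have "280000 * B * ((\<Sum>w\<in>I. f w) * ((\<Sum>w\<in>I. g w) * ((\<Sum>w\<in>I. g w) * ((\<Sum>w\<in>I. g w) *
       (3 * (real (card J) ^ 2 * (\<Sum>r\<in>J. dyadic_divisor_sum r)))))))
      \<le> 280000 * B * (?Z * (?Z^2 * (?Z^2 * (?Z^2 * (3 * (L^2 * L^4))))))"
    using bnd nn L0 B zeta_four_thirds_nonneg
    by (intro mult_mono mult_left_mono power_mono mult_nonneg_nonneg) auto
  also have "L^2 * L^4 = 6^6 * ln B ^ 6" unfolding power_add[symmetric] by (simp add: L_def power_mult_distrib)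
  also have "280000 * B * (?Z * (?Z^2 * (?Z^2 * (?Z^2 * (3 * (6^6 * ln B ^ 6))))))
    = 280000 * (?Z * (?Z^2 * (?Z^2 * (?Z^2 * (3 * 6^6))))) * B * ln B ^ 6" by simp
  finally show "conic_sum B \<le> 280000 * (?Z * (?Z^2 * (?Z^2 * (?Z^2 * (3 * 6^6))))) * B * ln B ^ 6"
    unfolding conic_sum_def Let_def \<open>I = var_range B\<close> \<open>J = exp_range B\<close> .
qed

section \<open>Summing the bound outside the conic zone\<close>

text \<open>Outside the conic zone P >= V W^(1/3), so at most 2 B / (w0^2 W^(4/3) V) values of h
  occur. Since V >= u1 u2 u3 / 8, the sums over the w's converge and those over the u's are
  harmonic.\<close>

lemma sum_lattice_error_h_le:
  assumes B: "B \<ge> 2" and w: "w0 > 0" "w1 > 0" "w2 > 0" "w3 > 0" and u: "u1 > 0" "u2 > 0" "u3 > 0"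
  shows "(\<Sum>h\<in>{1..n}. lattice_error B w0 w1 w2 w3 u1 u2 u3 j h) \<le>
     32 * B * (real w0 powr (-4/3) * (real w1 powr (-4/3) * (real w2 powr (-4/3) * (real w3 powr (-4/3) *
       (1 / real u1 * (1 / real u2 * (1 / real u3)))))))"
proof (cases "conic_zone w1 w2 w3 (floor_log u1) (floor_log u2) (floor_log u3) j")
  case True
  then show ?thesis using B by (simp add: lattice_error_def)
next
  case False
  define W where "W = real (w1 * w2 * w3)"
  define P where "P = real (w2 * 4 ^ floor_log u2 * 2 ^ j)"
  define V where "V = (2::real) ^ (floor_log u1 + floor_log u2 + floor_log u3)"
  define X where "X = 2 * B / (real w0^2 * W * P)"
  define H where "H = {h\<in>{1..n}. real (h * w0^2 * (w1 * w2 * w3)) * P \<le> 2 * B}"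
  have pos: "W > 0" "P > 0" "V > 0" "W powr (1/3) > 0" using w by (simp_all add: W_def P_def V_def)
  have X0: "X \<ge> 0" using B pos by (simp add: X_def)
  have PV: "V * W powr (1/3) \<le> P" using False by (simp add: conic_zone_def P_def V_def W_def)
  have "(\<Sum>h\<in>{1..n}. lattice_error B w0 w1 w2 w3 u1 u2 u3 j h) = (\<Sum>h\<in>H. lattice_error B w0 w1 w2 w3 u1 u2 u3 j h)"
    unfolding H_def by (rule sum.mono_neutral_right) (auto simp: lattice_error_def P_def)
  also have "\<dots> = (\<Sum>h\<in>H. 2)"
    using False by (intro sum.cong) (auto simp: lattice_error_def H_def P_def)
  also have "\<dots> = 2 * real (card H)" by simp
  also have "\<dots> \<le> 2 * X"
  proof -
    have "H \<subseteq> {1..nat \<lfloor>X\<rfloor>}"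
    proof
      fix h assume h: "h \<in> H"
      then have "real h * (real w0^2 * W * P) \<le> 2 * B" by (simp add: H_def W_def mult.assoc)
      moreover have "real w0^2 * W * P > 0" using w pos by simp
      ultimately have "real h \<le> X" unfolding X_def by (subst pos_le_divide_eq) auto
      then show "h \<in> {1..nat \<lfloor>X\<rfloor>}" using h by (simp add: H_def le_nat_floor)
    qed
    then have "card H \<le> card {1..nat \<lfloor>X\<rfloor>}" by (intro card_mono) auto
    then have "real (card H) \<le> real (nat \<lfloor>X\<rfloor>)" by simp
    also have "\<dots> \<le> X" using X0 by simp
    finally show ?thesis by simp
  qed
  also have "2 * X \<le> 2 * (2 * B / (real w0^2 * W * (V * W powr (1/3))))"
    unfolding X_def using PV pos w B by (intro mult_left_mono divide_left_mono mult_pos_pos) auto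
  also have "\<dots> = 4 * B * (1 / real w0^2 * (1 / (W * W powr (1/3))) * (1 / V))" by simp
  also have "\<dots> \<le> 4 * B * (real w0 powr (-4/3) * (1 / (W * W powr (1/3))) * (8 / (real u1 * real u2 * real u3)))"
  proof -
    have "u1 \<le> 2 * 2 ^ floor_log u1" "u2 \<le> 2 * 2 ^ floor_log u2" "u3 \<le> 2 * 2 ^ floor_log u3"
      by (rule floor_log_exp2_ge)+
    then have "u1 * u2 * u3 \<le> (2 * 2 ^ floor_log u1) * (2 * 2 ^ floor_log u2) * (2 * 2 ^ floor_log u3)"
      by (intro mult_mono) auto
    then have "real (u1 * u2 * u3) \<le> real ((2 * 2 ^ floor_log u1) * (2 * 2 ^ floor_log u2) * (2 * 2 ^ floor_log u3))"
      by (simp only: of_nat_le_iff)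
    also have "\<dots> = 8 * V" by (simp add: V_def power_add)
    finally have "1 / V \<le> 8 / (real u1 * real u2 * real u3)" using u pos by (simp add: field_simps)
    then show ?thesis using inverse_square_le[OF w(1)] pos B u by (intro mult_left_mono mult_mono) auto
  qed
  also have "1 / (W * W powr (1/3)) = W powr (-4/3)"
  proof -
    have "W * W powr (1/3) = W powr 1 * W powr (1/3)" using pos by simp
    also have "\<dots> = W powr (4/3)" by (subst powr_add[symmetric]) simp
    finally show ?thesis by (simp add: powr_minus_divide)
  qed
  also have "4 * B * (real w0 powr (-4/3) * W powr (-4/3) * (8 / (real u1 * real u2 * real u3))) =
     32 * B * (real w0 powr (-4/3) * (real w1 powr (-4/3) * (real w2 powr (-4/3) * (real w3 powr (-4/3) *
       (1 / real u1 * (1 / real u2 * (1 / real u3)))))))"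
    using w by (simp add: W_def powr_mult)
  finally show ?thesis .
qed

text \<open>With Z = B c3 / (h^3 c2) and \<kappa> = c2 / c1, \<open>sum_dyadic_region_le\<close>
  yields Z^(2/3) \<kappa>^(1/3) / c3 = B^(2/3) h^(-2) (c1 c2 c3)^(-1/3). This is symmetric in the
  three indices although the constraints are not. The bound for |y| is kept for the sum over
  u3.\<close>

lemma sum_lattice_main_ij_le:
  assumes B: "B \<ge> 2" and w: "w0 > 0" "w1 > 0" "w2 > 0" "w3 > 0" and u: "u1 > 0" "u2 > 0" "u3 > 0" and h: "h > 0"
  shows "(\<Sum>i\<in>{0..n}. \<Sum>j\<in>{0..n}. lattice_main B w0 w1 w2 w3 u1 u2 u3 i j h) \<le>
     (if real (w0^3 * (w1 * w2 * w3)^2 * (u1 * u2 * u3)) \<le> 3 * B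
      then 512 * B powr (2/3) * (real (w1 * w2 * w3) powr (-1/3) * real (u1 * u2 * u3) powr (-2/3)) * (1 / real h^2) else 0)"
proof (cases "real (w0^3 * (w1 * w2 * w3)^2 * (u1 * u2 * u3)) \<le> 3 * B")
  case False
  then show ?thesis by (simp add: lattice_main_def)
next
  case True
  define c1 c2 c3 where c: "c1 = real (w1 * u1^2)" "c2 = real (w2 * u2^2)" "c3 = real (w3 * u3^2)"
  have pos: "c1 > 0" "c2 > 0" "c3 > 0" using w u by (simp_all add: c)
  define Z where "Z = B * c3 / (real h^3 * c2)"
  define \<kappa> where "\<kappa> = c2 / c1"
  define R where "R = {(i,j) \<in> {0..n} \<times> {0..n}. real (h^3 * (2 ^ i * (2 ^ j)^2) * (w2 * u2^2)) \<le> B * real (w3 * u3^2) \<and>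
        w1 * u1^2 * 2 ^ i \<le> 2 * (w2 * u2^2) * 2 ^ j}"
  have Z0: "Z > 0" "\<kappa> > 0" using pos h B by (simp_all add: Z_def \<kappa>_def)
  have fR: "finite R" unfolding R_def by (rule finite_subset[of _ "{0..n} \<times> {0..n}"]) auto
  have "(\<Sum>i\<in>{0..n}. \<Sum>j\<in>{0..n}. lattice_main B w0 w1 w2 w3 u1 u2 u3 i j h)
      = (\<Sum>(i,j)\<in>{0..n} \<times> {0..n}. lattice_main B w0 w1 w2 w3 u1 u2 u3 i j h)"
    by (rule sum.cartesian_product)
  also have "\<dots> = (\<Sum>(i,j)\<in>R. lattice_main B w0 w1 w2 w3 u1 u2 u3 i j h)"
    unfolding R_def by (rule sum.mono_neutral_right) (auto simp: lattice_main_def split: if_splits)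
  also have "\<dots> = (\<Sum>(i,j)\<in>R. 32 / c3 * (2 ^ i * 2 ^ j))"
    using True by (intro sum.cong) (auto simp: R_def lattice_main_def c)
  also have "\<dots> = 32 / c3 * (\<Sum>(i,j)\<in>R. 2 ^ i * 2 ^ j)" by (simp add: sum_distrib_left case_prod_unfold)
  also have "\<dots> \<le> 32 / c3 * (16 * Z powr (2/3) * \<kappa> powr (1/3))"
  proof (intro mult_left_mono sum_dyadic_region_le[OF fR Z0])
    fix i j assume "(i,j) \<in> R"
    then have r: "real (h^3 * (2 ^ i * (2 ^ j)^2) * (w2 * u2^2)) \<le> B * c3" "w1 * u1^2 * 2 ^ i \<le> 2 * (w2 * u2^2) * 2 ^ j"
      by (auto simp: R_def c)
    have e: "real (h^3 * (2 ^ i * (2 ^ j)^2) * (w2 * u2^2)) = (2 ^ i * (2 ^ j)^2) * (real h^3 * c2)" by (simp add: c)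
    have "(2 ^ i * (2 ^ j)^2) * (real h^3 * c2) \<le> B * c3" using r(1) unfolding e .
    moreover have "real h^3 * c2 > 0" using h pos by simp
    ultimately have 1: "2 ^ i * (2 ^ j)^2 \<le> Z" unfolding Z_def by (simp only: pos_le_divide_eq)
    have "real (w1 * u1^2 * 2 ^ i) \<le> real (2 * (w2 * u2^2) * 2 ^ j)" using r(2) by (simp only: of_nat_le_iff)
    then have "c1 * 2 ^ i \<le> 2 * c2 * 2 ^ j" by (simp add: c)
    then have "2 ^ i \<le> 2 * \<kappa> * 2 ^ j" using pos by (simp add: \<kappa>_def field_simps)
    with 1 show "2 ^ i * (2 ^ j)^2 \<le> Z \<and> 2 ^ i \<le> 2 * \<kappa> * 2 ^ j" by simp
  qed (use pos in auto)
  also have "\<dots> = 512 * (B powr (2/3) * (c1 powr (-1/3) * c2 powr (-1/3) * c3 powr (-1/3)) * (1 / real h^2))"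
  proof -
    have hh: "(real h^3) powr (2/3) = real h^2"
    proof -
      have "(real h^3) powr (2/3) = (real h powr 3) powr (2/3)" using h by (simp add: powr_numeral)
      also have "\<dots> = real h powr 2" by (simp only: powr_powr) simp
      also have "\<dots> = real h^2" using h by (simp add: powr_numeral)
      finally show ?thesis .
    qed
    have c3': "c3 powr (2/3) = c3 * c3 powr (-1/3)"
    proof -
      have "c3 * c3 powr (-1/3) = c3 powr 1 * c3 powr (-1/3)" using pos by simp
      then show ?thesis by (simp add: powr_add[symmetric] del: powr_one powr_one')
    qed
    have c2': "c2 powr (1/3) = c2 powr (2/3) * c2 powr (-1/3)" by (simp add: powr_add[symmetric])
    have c1': "c1 powr (-1/3) = 1 / c1 powr (1/3)" using powr_minus_divide[of c1 "1/3"] by simp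
    have Ze: "Z powr (2/3) = B powr (2/3) * c3 powr (2/3) / (real h^2 * c2 powr (2/3))"
      unfolding Z_def using B pos h by (simp add: powr_divide powr_mult hh)
    have ke: "\<kappa> powr (1/3) = c2 powr (1/3) / c1 powr (1/3)"
      unfolding \<kappa>_def using pos by (simp add: powr_divide)
    show ?thesis unfolding Ze ke unfolding c3' c2' c1' using pos h by (simp add: field_simps)
  qed
  also have "c1 powr (-1/3) * c2 powr (-1/3) * c3 powr (-1/3) = real (w1 * w2 * w3) powr (-1/3) * real (u1 * u2 * u3) powr (-2/3)"
  proof -
    have sq: "(real u^2) powr (-(1/3)) = real u powr (-(2/3))" if "u > 0" for u
    proof -
      have "(real u^2) powr (-(1/3)) = (real u powr 2) powr (-(1/3))" using that by (simp add: powr_numeral)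
      also have "\<dots> = real u powr (-(2/3))" by (simp only: powr_powr) simp
      finally show ?thesis .
    qed
    show ?thesis unfolding c using w u by (simp add: powr_mult sq)
  qed
  finally show ?thesis using True by (simp add: mult.assoc)
qed

text \<open>The sum over h converges. The bound for |y| caps u3 at Q = 3 B / (w0^3 W^2 u1 u2), and
  the sum of u3^(-2/3) is at most 3 Q^(1/3). This supplies the missing B^(1/3) and turns the
  exponents of w0, W, u1 and u2 into -1.\<close>

lemma sum_lattice_main_u3_le:
  assumes B: "B \<ge> 2" and w: "w0 > 0" "w1 > 0" "w2 > 0" "w3 > 0" and u: "u1 > 0" "u2 > 0"
  shows "(\<Sum>u3\<in>{1..m}. \<Sum>i\<in>{0..n}. \<Sum>j\<in>{0..n}. \<Sum>h\<in>{1..l}. lattice_main B w0 w1 w2 w3 u1 u2 u3 i j h) \<le>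
     4608 * zeta_four_thirds * B * (1 / real w0 * (1 / real w1 * (1 / real w2 * (1 / real w3 * (1 / real u1 * (1 / real u2))))))"
proof -
  define W where "W = real (w1 * w2 * w3)"
  define U where "U = real (u1 * u2)"
  define Q where "Q = 3 * B / (real w0^3 * W^2 * U)"
  define A where "A = {u3\<in>{1..m}. real (w0^3 * (w1 * w2 * w3)^2 * (u1 * u2 * u3)) \<le> 3 * B}"
  define K where "K = 512 * B powr (2/3) * (W powr (-1/3) * U powr (-2/3))"
  have pos: "W > 0" "U > 0" "real w0 > 0" "Q > 0" using w u B by (simp_all add: W_def U_def Q_def)
  have K0: "K \<ge> 0" by (simp add: K_def)
  have "(\<Sum>u3\<in>{1..m}. \<Sum>i\<in>{0..n}. \<Sum>j\<in>{0..n}. \<Sum>h\<in>{1..l}. lattice_main B w0 w1 w2 w3 u1 u2 u3 i j h)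
     \<le> (\<Sum>u3\<in>{1..m}. if u3 \<in> A then K * zeta_four_thirds * real u3 powr (-2/3) else 0)"
  proof (rule sum_mono)
    fix u3 assume u3: "u3 \<in> {1..m}"
    have "(\<Sum>i\<in>{0..n}. \<Sum>j\<in>{0..n}. \<Sum>h\<in>{1..l}. lattice_main B w0 w1 w2 w3 u1 u2 u3 i j h)
      = (\<Sum>h\<in>{1..l}. \<Sum>i\<in>{0..n}. \<Sum>j\<in>{0..n}. lattice_main B w0 w1 w2 w3 u1 u2 u3 i j h)"
      by (subst (2) sum.swap, subst sum.swap) (rule refl)
    also have "\<dots> \<le> (\<Sum>h\<in>{1..l}. if u3 \<in> A then K * real u3 powr (-2/3) * (1 / real h^2) else 0)"
    proof (rule sum_mono)
      fix h assume "h \<in> {1..l}"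
      then have h: "h > 0" by simp
      have e: "real (u1 * u2 * u3) powr (-2/3) = U powr (-2/3) * real u3 powr (-2/3)"
        by (simp add: U_def powr_mult)
      show "(\<Sum>i\<in>{0..n}. \<Sum>j\<in>{0..n}. lattice_main B w0 w1 w2 w3 u1 u2 u3 i j h)
        \<le> (if u3 \<in> A then K * real u3 powr (-2/3) * (1 / real h^2) else 0)"
        using sum_lattice_main_ij_le[OF B w u _ h, of u3 n] u3 unfolding e W_def[symmetric] A_def K_def
        by (auto simp: mult.assoc)
    qed
    also have "\<dots> \<le> (if u3 \<in> A then K * zeta_four_thirds * real u3 powr (-2/3) else 0)"
    proof (cases "u3 \<in> A")
      case True
      have "(\<Sum>h\<in>{1..l}. K * real u3 powr (-2/3) * (1 / real h^2)) = K * real u3 powr (-2/3) * (\<Sum>h\<in>{1..l}. 1 / real h^2)"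
        by (simp only: sum_distrib_left)
      also have "\<dots> \<le> K * real u3 powr (-2/3) * zeta_four_thirds"
        using K0 by (intro mult_left_mono sum_inverse_square_le) auto
      finally show ?thesis using True by (simp add: ac_simps)
    qed simp
    finally show "(\<Sum>i\<in>{0..n}. \<Sum>j\<in>{0..n}. \<Sum>h\<in>{1..l}. lattice_main B w0 w1 w2 w3 u1 u2 u3 i j h)
      \<le> (if u3 \<in> A then K * zeta_four_thirds * real u3 powr (-2/3) else 0)" .
  qed
  also have "\<dots> = (\<Sum>u3\<in>A. K * zeta_four_thirds * real u3 powr (-2/3))"
    by (rule sum.mono_neutral_cong_right) (auto simp: A_def)
  also have "\<dots> = K * zeta_four_thirds * (\<Sum>u3\<in>A. real u3 powr (-2/3))" by (simp only: sum_distrib_left)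
  also have "\<dots> \<le> K * zeta_four_thirds * (3 * Q powr (1/3))"
  proof (rule mult_left_mono[OF sum_powr_minus_two_thirds_le])
    fix u3 assume a: "u3 \<in> A"
    then have "real u3 * (real w0^3 * W^2 * U) \<le> 3 * B" by (simp add: A_def W_def U_def ac_simps)
    then have "real u3 \<le> Q" unfolding Q_def using pos by (subst pos_le_divide_eq) auto
    then show "u3 > 0 \<and> real u3 \<le> Q" using a by (auto simp: A_def)
  qed (use K0 zeta_four_thirds_nonneg in \<open>auto simp: A_def\<close>)
  also have "\<dots> = 1536 * 3 powr (1/3) * zeta_four_thirds * B * (1 / (real w0 * W * U))"
  proof -
    have q: "Q powr (1/3) = 3 powr (1/3) * B powr (1/3) / (real w0 * W powr (2/3) * U powr (1/3))"
    proof -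
      have "(real w0^3) powr (1/3) = (real w0 powr 3) powr (1/3)" using pos by (simp add: powr_numeral)
      also have "\<dots> = real w0" using pos by (simp only: powr_powr) simp
      finally have 1: "(real w0^3) powr (1/3) = real w0" .
      have "(W^2) powr (1/3) = (W powr 2) powr (1/3)" using pos by (simp add: powr_numeral)
      also have "\<dots> = W powr (2/3)" by (simp only: powr_powr) simp
      finally have 2: "(W^2) powr (1/3) = W powr (2/3)" .
      show ?thesis unfolding Q_def using pos B by (simp add: powr_divide powr_mult 1 2)
    qed
    have b: "B = B powr (2/3) * B powr (1/3)" using B by (simp add: powr_add[symmetric])
    have wm: "W powr (-1/3) = W powr (2/3) / W"
    proof -
      have "W powr (2/3) / W = W powr (2/3) / W powr 1" using pos by simp
      then show ?thesis by (simp add: powr_diff[symmetric] del: powr_one powr_one')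
    qed
    have um: "U powr (-2/3) = U powr (1/3) / U"
    proof -
      have "U powr (1/3) / U = U powr (1/3) / U powr 1" using pos by simp
      then show ?thesis by (simp add: powr_diff[symmetric] del: powr_one powr_one')
    qed
    have "K * zeta_four_thirds * (3 * Q powr (1/3)) =
        1536 * 3 powr (1/3) * zeta_four_thirds * (B powr (2/3) * B powr (1/3)) * (1 / (real w0 * W * U))"
      unfolding K_def q wm um using pos by (simp add: field_simps)
    then show ?thesis using b by simp
  qed
  also have "\<dots> \<le> 1536 * 3 * zeta_four_thirds * B * (1 / (real w0 * W * U))"
  proof -
    have "3 powr (1/3) \<le> (3::real) powr 1" by (intro powr_mono) auto
    then show ?thesis using zeta_four_thirds_nonneg B pos by (intro mult_right_mono) auto
  qed
  also have "\<dots> = 4608 * zeta_four_thirds * B * (1 / real w0 * (1 / real w1 * (1 / real w2 * (1 / real w3 * (1 / real u1 * (1 / real u2))))))"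
    by (simp add: W_def U_def)
  finally show ?thesis .
qed

lemma lattice_sum_le:
  "\<exists>C\<ge>0. \<forall>B\<ge>2. lattice_sum B \<le> C * B * ln B ^ 6"
proof (intro exI[of _ "48 * zeta_four_thirds^4 * 6^5 + 4608 * zeta_four_thirds * 6^6"] conjI allI impI)
  let ?Z = zeta_four_thirds
  show "0 \<le> 48 * ?Z^4 * 6^5 + 4608 * ?Z * 6^6" using zeta_four_thirds_nonneg by simp
  fix B :: real assume B: "B \<ge> 2"
  define I J where "I = var_range B" and "J = exp_range B"
  note I_def = \<open>I = var_range B\<close>[unfolded var_range_def] and J_def = \<open>J = exp_range B\<close>[unfolded exp_range_def]
  define f where "f = (\<lambda>w. real w powr (-4/3))"
  define g where "g = (\<lambda>w. 1 / real w)"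
  define L where "L = 6 * ln B"
  have L0: "L \<ge> 0" using B by (simp add: L_def)
  have bnd: "(\<Sum>w\<in>I. f w) \<le> ?Z" "(\<Sum>w\<in>I. g w) \<le> L" "real (card J) \<le> L"
  proof -
    have "nat \<lfloor>3 * B\<rfloor> \<le> nat \<lfloor>6 * B\<rfloor>" using B by (intro nat_mono floor_mono) simp
    then show "(\<Sum>w\<in>I. g w) \<le> L" unfolding g_def I_def L_def by (rule harmonic_sum_le_ln[OF B])
  qed (use sum_powr_minus_four_thirds_le[of I] card_dyadic_le_ln[OF B] in \<open>simp_all add: f_def I_def J_def L_def\<close>)
  have nn: "(\<Sum>w\<in>I. f w) \<ge> 0" "(\<Sum>w\<in>I. g w) \<ge> 0"
    by (auto intro!: sum_nonneg simp: f_def g_def)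
  have ipos: "w > 0" if "w \<in> I" for w using that by (auto simp: I_def)
  have err: "(\<Sum>w0\<in>I. \<Sum>w1\<in>I. \<Sum>w2\<in>I. \<Sum>w3\<in>I. \<Sum>u1\<in>I. \<Sum>u2\<in>I. \<Sum>u3\<in>I. \<Sum>i\<in>J. \<Sum>j\<in>J. \<Sum>h\<in>I.
      lattice_error B w0 w1 w2 w3 u1 u2 u3 j h) \<le> 48 * ?Z^4 * 6^5 * B * ln B ^ 6"
  proof -
    have "(\<Sum>w0\<in>I. \<Sum>w1\<in>I. \<Sum>w2\<in>I. \<Sum>w3\<in>I. \<Sum>u1\<in>I. \<Sum>u2\<in>I. \<Sum>u3\<in>I. \<Sum>i\<in>J. \<Sum>j\<in>J. \<Sum>h\<in>I.
        lattice_error B w0 w1 w2 w3 u1 u2 u3 j h)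
      \<le> (\<Sum>w0\<in>I. \<Sum>w1\<in>I. \<Sum>w2\<in>I. \<Sum>w3\<in>I. \<Sum>u1\<in>I. \<Sum>u2\<in>I. \<Sum>u3\<in>I. \<Sum>i\<in>J. \<Sum>j\<in>J.
        32 * B * (f w0 * (f w1 * (f w2 * (f w3 * (g u1 * (g u2 * g u3)))))))"
      unfolding f_def g_def by (intro sum_mono) (unfold I_def, intro sum_lattice_error_h_le[OF B] ipos[unfolded I_def])
    also have "\<dots> = (\<Sum>w0\<in>I. \<Sum>w1\<in>I. \<Sum>w2\<in>I. \<Sum>w3\<in>I. \<Sum>u1\<in>I. \<Sum>u2\<in>I. \<Sum>u3\<in>I.
        32 * B * real (card J)^2 * (f w0 * (f w1 * (f w2 * (f w3 * (g u1 * (g u2 * g u3)))))))"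
      by (simp add: power2_eq_square ac_simps)
    also have "\<dots> = 32 * B * real (card J)^2 * ((\<Sum>w\<in>I. f w) * ((\<Sum>w\<in>I. f w) * ((\<Sum>w\<in>I. f w) * ((\<Sum>w\<in>I. f w) *
        ((\<Sum>w\<in>I. g w) * ((\<Sum>w\<in>I. g w) * (\<Sum>w\<in>I. g w)))))))"
      by (simp only: sum_distrib_left[symmetric] sum_distrib_right[symmetric])
    also have "\<dots> \<le> 32 * B * L^2 * (?Z * (?Z * (?Z * (?Z * (L * (L * L))))))"
      using bnd nn L0 B zeta_four_thirds_nonneg
      by (intro mult_mono mult_left_mono power_mono mult_nonneg_nonneg) auto
    also have "\<dots> = 32 * ?Z^4 * B * L^5" by (simp add: eval_nat_numeral)
    \<comment> \<open>The error term has five logarithms: three harmonic sums over the u's and the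
      ranges of i and j. The inequality 1 <= (3/2) ln B lifts it to the sixth power, and 48 = 32 *
      3/2.\<close>
    also have "\<dots> \<le> 32 * ?Z^4 * B * (3/2 * 6^5 * ln B ^ 6)"
    proof (rule mult_left_mono)
      have "L^5 * 1 \<le> L^5 * (3/2 * ln B)" using ln_times_le(3)[OF B] L0 by (intro mult_left_mono) auto
      also have "\<dots> = 3/2 * 6^5 * ln B ^ 6" by (simp add: L_def power_mult_distrib eval_nat_numeral)
      finally show "L^5 \<le> 3/2 * 6^5 * ln B ^ 6" by simp
    qed (use B in auto)
    finally show ?thesis by simp
  qed
  have main: "(\<Sum>w0\<in>I. \<Sum>w1\<in>I. \<Sum>w2\<in>I. \<Sum>w3\<in>I. \<Sum>u1\<in>I. \<Sum>u2\<in>I. \<Sum>u3\<in>I. \<Sum>i\<in>J. \<Sum>j\<in>J. \<Sum>h\<in>I.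
      lattice_main B w0 w1 w2 w3 u1 u2 u3 i j h) \<le> 4608 * ?Z * 6^6 * B * ln B ^ 6"
  proof -
    have "(\<Sum>w0\<in>I. \<Sum>w1\<in>I. \<Sum>w2\<in>I. \<Sum>w3\<in>I. \<Sum>u1\<in>I. \<Sum>u2\<in>I. \<Sum>u3\<in>I. \<Sum>i\<in>J. \<Sum>j\<in>J. \<Sum>h\<in>I.
        lattice_main B w0 w1 w2 w3 u1 u2 u3 i j h)
      \<le> (\<Sum>w0\<in>I. \<Sum>w1\<in>I. \<Sum>w2\<in>I. \<Sum>w3\<in>I. \<Sum>u1\<in>I. \<Sum>u2\<in>I.
        4608 * ?Z * B * (g w0 * (g w1 * (g w2 * (g w3 * (g u1 * g u2))))))"
    proof (intro sum_mono)
      fix w0 w1 w2 w3 u1 u2 assume "w0 \<in> I" "w1 \<in> I" "w2 \<in> I" "w3 \<in> I" "u1 \<in> I" "u2 \<in> I"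
      then show "(\<Sum>u3\<in>I. \<Sum>i\<in>J. \<Sum>j\<in>J. \<Sum>h\<in>I. lattice_main B w0 w1 w2 w3 u1 u2 u3 i j h)
          \<le> 4608 * ?Z * B * (g w0 * (g w1 * (g w2 * (g w3 * (g u1 * g u2)))))"
        unfolding g_def I_def J_def by (intro sum_lattice_main_u3_le[OF B]) auto
    qed
    also have "\<dots> = 4608 * ?Z * B * ((\<Sum>w\<in>I. g w) * ((\<Sum>w\<in>I. g w) * ((\<Sum>w\<in>I. g w) * ((\<Sum>w\<in>I. g w) *
        ((\<Sum>w\<in>I. g w) * (\<Sum>w\<in>I. g w))))))"
      by (simp only: sum_distrib_left[symmetric] sum_distrib_right[symmetric])
    also have "\<dots> \<le> 4608 * ?Z * B * (L * (L * (L * (L * (L * L)))))"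
      using bnd nn L0 B zeta_four_thirds_nonneg
      by (intro mult_mono mult_left_mono mult_nonneg_nonneg) auto
    also have "\<dots> = 4608 * ?Z * 6^6 * B * ln B ^ 6" by (simp add: L_def power_mult_distrib eval_nat_numeral)
    finally show ?thesis .
  qed
  have "(\<Sum>(w0,w1,w2,w3,u1,u2,u3,i,j,h)\<in>I \<times> I \<times> I \<times> I \<times> I \<times> I \<times> I \<times> J \<times> J \<times> I.
        lattice_error B w0 w1 w2 w3 u1 u2 u3 j h + lattice_main B w0 w1 w2 w3 u1 u2 u3 i j h)
    = (\<Sum>w0\<in>I. \<Sum>w1\<in>I. \<Sum>w2\<in>I. \<Sum>w3\<in>I. \<Sum>u1\<in>I. \<Sum>u2\<in>I. \<Sum>u3\<in>I. \<Sum>i\<in>J. \<Sum>j\<in>J. \<Sum>h\<in>I.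
        lattice_error B w0 w1 w2 w3 u1 u2 u3 j h) +
      (\<Sum>w0\<in>I. \<Sum>w1\<in>I. \<Sum>w2\<in>I. \<Sum>w3\<in>I. \<Sum>u1\<in>I. \<Sum>u2\<in>I. \<Sum>u3\<in>I. \<Sum>i\<in>J. \<Sum>j\<in>J. \<Sum>h\<in>I.
        lattice_main B w0 w1 w2 w3 u1 u2 u3 i j h)"
    by (simp only: sum.cartesian_product[symmetric] sum.distrib)
  also have "\<dots> \<le> (48 * ?Z^4 * 6^5 + 4608 * ?Z * 6^6) * B * ln B ^ 6"
    using add_mono[OF err main] by (simp add: distrib_right)
  finally show "lattice_sum B \<le> (48 * ?Z^4 * 6^5 + 4608 * ?Z * 6^6) * B * ln B ^ 6"
    unfolding lattice_sum_def Let_def \<open>I = var_range B\<close> \<open>J = exp_range B\<close> .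
qed

section \<open>Rational points\<close>

lemma torsor_set_bound:
  "\<exists>C\<ge>0. \<forall>B\<ge>2. finite (torsor_set B) \<and> real (card (torsor_set B)) \<le> C * B * ln B ^ 6"
proof -
  obtain C1 where C1: "C1 \<ge> 0" "\<forall>B\<ge>2. conic_sum B \<le> C1 * B * ln B ^ 6" using conic_sum_le by blast
  obtain C2 where C2: "C2 \<ge> 0" "\<forall>B\<ge>2. lattice_sum B \<le> C2 * B * ln B ^ 6" using lattice_sum_le by blast
  show ?thesis
  proof (intro exI[of _ "C1 + C2"] conjI allI impI)
    fix B :: real assume B: "B \<ge> 2"
    have sub: "torsor_set B \<subseteq> conic_points B \<union> lattice_points B"
    proof
      fix t assume "t \<in> torsor_set B"
      then obtain w0 w1 w2 w3 u1 u2 u3 h a1 a2 a3 where t: "t = ((w0,w1,w2,w3),(u1,u2,u3),h,(a1,a2,a3))"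
        and tp: "torsor_pt B w0 w1 w2 w3 u1 u2 u3 h a1 a2 a3" unfolding torsor_set_def by blast
      show "t \<in> conic_points B \<union> lattice_points B"
      proof (cases "conic_zone w1 w2 w3 (floor_log u1) (floor_log u2) (floor_log u3) (lg_abs a2)")
        case True
        then have "t \<in> conic_points B" unfolding conic_points_def t using tp by blast
        then show ?thesis ..
      next
        case False
        then have "t \<in> lattice_points B" unfolding lattice_points_def t using tp by blast
        then show ?thesis ..
      qed
    qed
    note c = card_conic_points_le[OF B] and l = card_lattice_points_le[OF B]
    show "finite (torsor_set B)" using finite_subset[OF sub] c l by simp
    have "card (torsor_set B) \<le> card (conic_points B \<union> lattice_points B)" using sub c l by (intro card_mono) auto
    also have "\<dots> \<le> card (conic_points B) + card (lattice_points B)" by (rule card_Un_le)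
    finally have "real (card (torsor_set B)) \<le> real (card (conic_points B)) + real (card (lattice_points B))"
      by (metis of_nat_add of_nat_le_iff)
    also have "\<dots> \<le> C1 * B * ln B ^ 6 + C2 * B * ln B ^ 6" using c l C1(2) C2(2) B by fastforce
    finally show "real (card (torsor_set B)) \<le> (C1 + C2) * B * ln B ^ 6" by (simp add: algebra_simps)
  qed (use C1 C2 in auto)
qed

section \<open>Covering the rational points by torsor points\<close>

definition torsor_xs :: "torsor_tuple \<Rightarrow> int \<times> int \<times> int" where
  "torsor_xs = (\<lambda>((w0,w1,w2,w3),(u1,u2,u3),h,(a1,a2,a3)).
     (int (h * w0^2 * (w1 * w2 * w3)) * (int (w1 * u1^2) * a1),
      int (h * w0^2 * (w1 * w2 * w3)) * (int (w2 * u2^2) * a2),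
      int (h * w0^2 * (w1 * w2 * w3)) * (int (w3 * u3^2) * a3)))"

text \<open>This gives |y|; the sign of y is carried separately by
  \<open>torsor_point\<close>.\<close>

definition torsor_y :: "torsor_tuple \<Rightarrow> int" where
  "torsor_y = (\<lambda>((w0,w1,w2,w3),(u1,u2,u3),h,(a1,a2,a3)). int (w0^3 * (w1 * w2 * w3)^2 * (u1 * u2 * u3)))"

definition torsor_d :: "torsor_tuple \<Rightarrow> int" where
  "torsor_d = (\<lambda>((w0,w1,w2,w3),(u1,u2,u3),h,(a1,a2,a3)). int (h^3) * (a1 * a2 * a3))"

text \<open>Primitivity is expressed by common divisors because a divisor of two of the x_i divides
  the third. The hypothesis then carries over when the coordinates are reordered by size.\<close>

lemma torsor_set_covers:
  fixes x1 x2 x3 y d :: int and B :: real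
  assumes sum: "x1 + x2 + x3 = 0" and eq: "x1 * x2 * x3 = d * y^2"
    and nz: "x1 \<noteq> 0" "x2 \<noteq> 0" "x3 \<noteq> 0"
    and prim: "\<And>g. g dvd x1 \<Longrightarrow> g dvd x2 \<Longrightarrow> g dvd y \<Longrightarrow> g dvd d \<Longrightarrow> g dvd 1"
    and ord: "\<bar>x1\<bar> \<le> \<bar>x2\<bar>" "\<bar>x2\<bar> \<le> \<bar>x3\<bar>"
    and ht: "real_of_int \<bar>x3\<bar> \<le> 2 * B" "real_of_int \<bar>y\<bar> \<le> 3 * B" "real_of_int \<bar>d\<bar> \<le> B"
  shows "\<exists>t\<in>torsor_set B. torsor_xs t = (x1,x2,x3) \<and> \<bar>y\<bar> = torsor_y t \<and> d = torsor_d t"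
proof -
  have "gcd (gcd x1 x2) (gcd y d) dvd 1"
    by (rule prim; meson dvd_trans gcd_dvd1 gcd_dvd2)
  then have cop: "gcd (gcd x1 x2) (gcd y d) = 1" by simp
  obtain h w0 w1 w2 w3 u1 u2 u3 :: nat and a1 a2 a3 :: int where
    pos: "h > 0" "w0 > 0" "w1 > 0" "w2 > 0" "w3 > 0" "u1 > 0" "u2 > 0" "u3 > 0" and anz: "a1 \<noteq> 0" "a2 \<noteq> 0" "a3 \<noteq> 0"
    and x: "x1 = int (h * w0^2 * (w1 * w2 * w3)) * (int (w1 * u1^2) * a1)"
     "x2 = int (h * w0^2 * (w1 * w2 * w3)) * (int (w2 * u2^2) * a2)"
     "x3 = int (h * w0^2 * (w1 * w2 * w3)) * (int (w3 * u3^2) * a3)"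
    and y: "\<bar>y\<bar> = int (w0^3 * (w1 * w2 * w3)^2 * (u1 * u2 * u3))" and d: "d = int (h^3) * (a1 * a2 * a3)"
    and z: "int (w1 * u1^2) * a1 + int (w2 * u2^2) * a2 + int (w3 * u3^2) * a3 = 0"
    and c: "coprime (int (w1 * u1^2) * a1) (int (w2 * u2^2) * a2)"
     "coprime (int (w1 * u1^2) * a1) (int (w3 * u3^2) * a3)"
     "coprime (int (w2 * u2^2) * a2) (int (w3 * u3^2) * a3)"
    using torsor_parametrization[OF sum eq nz cop] by (elim exE conjE)
  let ?g = "h * w0^2 * (w1 * w2 * w3)"
  let ?A = "\<lambda>a::int. nat \<bar>a\<bar>"
  have ab: "\<bar>int ?g * (int c * a)\<bar> = int (?g * (c * ?A a))" for c a by (simp add: abs_mult)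
  have g0: "?g > 0" using pos by simp
  have o1: "w1 * u1^2 * ?A a1 \<le> w2 * u2^2 * ?A a2"
  proof -
    have "?g * (w1 * u1^2 * ?A a1) \<le> ?g * (w2 * u2^2 * ?A a2)" using ord(1) unfolding x ab by (simp only: of_nat_le_iff)
    then show ?thesis using g0 by (metis mult_le_cancel1)
  qed
  have o2: "w2 * u2^2 * ?A a2 \<le> w3 * u3^2 * ?A a3"
  proof -
    have "?g * (w2 * u2^2 * ?A a2) \<le> ?g * (w3 * u3^2 * ?A a3)" using ord(2) unfolding x ab by (simp only: of_nat_le_iff)
    then show ?thesis using g0 by (metis mult_le_cancel1)
  qed
  have h1: "real (?g * (w3 * u3^2 * ?A a3)) \<le> 2 * B" using ht(1) unfolding x ab by (simp only: of_int_of_nat_eq)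
  have h2: "real (w0^3 * (w1 * w2 * w3)^2 * (u1 * u2 * u3)) \<le> 3 * B" using ht(2) unfolding y by (simp only: of_int_of_nat_eq)
  have "\<bar>d\<bar> = int (h^3 * (?A a1 * ?A a2 * ?A a3))" unfolding d by (simp add: abs_mult)
  then have h3: "real (h^3 * (?A a1 * ?A a2 * ?A a3)) \<le> B" using ht(3) by (simp only: of_int_of_nat_eq)
  have "torsor_pt B w0 w1 w2 w3 u1 u2 u3 h a1 a2 a3"
    unfolding torsor_pt_def by (intro conjI pos anz z c o1 o2 h1 h2 h3)
  then have "((w0,w1,w2,w3),(u1,u2,u3),h,(a1,a2,a3)) \<in> torsor_set B" unfolding torsor_set_def by blast
  then show ?thesis
    by (rule bexI[rotated]) (simp only: torsor_xs_def torsor_y_def torsor_d_def prod.case x y[symmetric] d[symmetric])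
qed

text \<open>The index k records at which two places of the triple ordered by size the original
  coordinates a and b stand; the remaining entry is -(a + b).\<close>

fun pick_two :: "nat \<Rightarrow> int \<times> int \<times> int \<Rightarrow> int \<times> int" where
  "pick_two k (x1,x2,x3) =
     [(x1,x2),(x2,x1),(x1,x3),(x3,x1),(x2,x3),(x3,x2)] ! k"

definition torsor_point :: "nat \<times> int \<times> torsor_tuple \<Rightarrow> vec4 set" where
  "torsor_point = (\<lambda>(k,s,t). case pick_two k (torsor_xs t) of (a,b) \<Rightarrow>
     let v = (a, b, s * torsor_y t - a - b, torsor_d t) in {v, neg4 v})"

text \<open>Ordering a, b and -(a + b) by size and recording this order together with the sign of y
  recovers the point. Covering a point several times is harmless for an upper bound.\<close>

lemma U2_points_subset_torsor_points:
  assumes B: "B \<ge> 2"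
  shows "U2_points B \<subseteq> torsor_point ` ({..<6} \<times> {1,-1} \<times> torsor_set B)"
proof
  fix p assume "p \<in> U2_points B"
  then obtain a b c d where p: "p = {(a,b,c,d), neg4 (a,b,c,d)}" and prim: "primitive4 (a,b,c,d)"
    and S: "on_S2 (a,b,c,d)" and lines: "\<not> on_six_lines (a,b,c,d)" and H: "real_of_int (height4 (a,b,c,d)) \<le> B"
    unfolding U2_points_def by auto
  define e where "e = - a - b"
  define y where "y = a + b + c"
  have eq: "a * b * e = d * y^2" using S by (simp add: on_S2_def e_def y_def algebra_simps)
  \<comment> \<open>If a, b or e vanishes, then d y^2 = 0. The three choices combined with d = 0 or
    y = 0 are exactly the six deleted lines.\<close>
  have nz: "a \<noteq> 0" "b \<noteq> 0" "e \<noteq> 0"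
  proof -
    show "a \<noteq> 0"
    proof
      assume a: "a = 0"
      then have "d = 0 \<or> y = 0" using eq by simp
      then show False using lines a by (auto simp: on_six_lines_def y_def)
    qed
    show "b \<noteq> 0"
    proof
      assume b: "b = 0"
      then have "d = 0 \<or> y = 0" using eq by simp
      then show False using lines b by (auto simp: on_six_lines_def y_def)
    qed
    show "e \<noteq> 0"
    proof
      assume e: "e = 0"
      then have "d = 0 \<or> y = 0" using eq by simp
      then show False using lines e by (auto simp: on_six_lines_def y_def e_def)
    qed
  qed
  have ht: "real_of_int \<bar>a\<bar> \<le> B" "real_of_int \<bar>b\<bar> \<le> B" "real_of_int \<bar>c\<bar> \<le> B" "real_of_int \<bar>d\<bar> \<le> B"
    using H by (auto simp: height4_def)
  have hx: "real_of_int \<bar>a\<bar> \<le> 2 * B" "real_of_int \<bar>b\<bar> \<le> 2 * B" "real_of_int \<bar>e\<bar> \<le> 2 * B" "real_of_int \<bar>y\<bar> \<le> 3 * B"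
    using ht B by (simp_all add: e_def y_def)
  have sum: "a + b + e = 0" by (simp add: e_def)
  have gp: "g dvd 1" if g: "g dvd a" "g dvd b" "g dvd y" "g dvd d" for g
  proof -
    have "g dvd y - a - b" using g by (intro dvd_diff)
    then have "g dvd c" by (simp add: y_def)
    then have "g dvd gcd (gcd a b) (gcd c d)" using g by (intro gcd_greatest)
    moreover have "gcd (gcd a b) (gcd c d) = 1" using prim by (simp add: primitive4_def)
    ultimately show ?thesis by simp
  qed
  have ge: "g dvd b" if "g dvd a" "g dvd e" for g
  proof -
    have "g dvd - e - a" using that by (intro dvd_diff) auto
    then show ?thesis by (simp add: e_def)
  qed
  have ge': "g dvd a" if "g dvd b" "g dvd e" for g
  proof -
    have "g dvd - e - b" using that by (intro dvd_diff) auto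
    then show ?thesis by (simp add: e_def)
  qed
  define s :: int where "s = (if y \<ge> 0 then 1 else - 1)"
  have s: "s \<in> {1,-1}" "y = s * \<bar>y\<bar>" by (auto simp: s_def)
  have fin: "p \<in> torsor_point ` ({..<6} \<times> {1,-1} \<times> torsor_set B)"
    if k: "k < 6" and x: "pick_two k (x1,x2,x3) = (a,b)" and xs: "x1 + x2 + x3 = 0" "x1 * x2 * x3 = d * y^2"
      "x1 \<noteq> 0" "x2 \<noteq> 0" "x3 \<noteq> 0" "\<And>g. g dvd x1 \<Longrightarrow> g dvd x2 \<Longrightarrow> g dvd y \<Longrightarrow> g dvd d \<Longrightarrow> g dvd 1"
      "\<bar>x1\<bar> \<le> \<bar>x2\<bar>" "\<bar>x2\<bar> \<le> \<bar>x3\<bar>" "real_of_int \<bar>x3\<bar> \<le> 2 * B" for k x1 x2 x3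
  proof -
    obtain t where t: "t \<in> torsor_set B" "torsor_xs t = (x1,x2,x3)" "\<bar>y\<bar> = torsor_y t" "d = torsor_d t"
      using torsor_set_covers[OF xs hx(4) ht(4)] by blast
    have c: "s * torsor_y t - a - b = c" using s t(3) by (simp add: y_def)
    have "torsor_point (k,s,t) = p"
      unfolding torsor_point_def prod.case t(2) x Let_def c t(4)[symmetric] p by (rule refl)
    moreover have "(k,s,t) \<in> {..<6} \<times> {1,-1} \<times> torsor_set B" using k s(1) t(1) by simp
    ultimately show ?thesis by blast
  qed
  have sums: "b + a + e = 0" "a + e + b = 0" "b + e + a = 0" "e + a + b = 0" "e + b + a = 0"
    using sum by linarith+
  have prods: "b * a * e = d * y^2" "a * e * b = d * y^2" "b * e * a = d * y^2" "e * a * b = d * y^2" "e * b * a = d * y^2"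
    using eq by (simp_all only: mult.assoc mult.commute mult.left_commute)
  consider "\<bar>a\<bar> \<le> \<bar>b\<bar>" "\<bar>b\<bar> \<le> \<bar>e\<bar>" | "\<bar>b\<bar> \<le> \<bar>a\<bar>" "\<bar>a\<bar> \<le> \<bar>e\<bar>" | "\<bar>a\<bar> \<le> \<bar>e\<bar>" "\<bar>e\<bar> \<le> \<bar>b\<bar>"
    | "\<bar>b\<bar> \<le> \<bar>e\<bar>" "\<bar>e\<bar> \<le> \<bar>a\<bar>" | "\<bar>e\<bar> \<le> \<bar>a\<bar>" "\<bar>a\<bar> \<le> \<bar>b\<bar>" | "\<bar>e\<bar> \<le> \<bar>b\<bar>" "\<bar>b\<bar> \<le> \<bar>a\<bar>" by linarith
  then show "p \<in> torsor_point ` ({..<6} \<times> {1,-1} \<times> torsor_set B)"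
  proof cases
    case 1
    show ?thesis by (rule fin[of 0 a b e, OF _ _ sum eq nz(1,2,3) _ 1 hx(3)]) (simp, simp, blast intro: gp)
  next
    case 2
    show ?thesis by (rule fin[of 1 b a e, OF _ _ sums(1) prods(1) nz(2,1,3) _ 2 hx(3)]) (simp, simp, blast intro: gp)
  next
    case 3
    show ?thesis by (rule fin[of 2 a e b, OF _ _ sums(2) prods(2) nz(1,3,2) _ 3 hx(2)]) (simp, simp, blast intro: gp ge)
  next
    case 4
    show ?thesis by (rule fin[of 3 b e a, OF _ _ sums(3) prods(3) nz(2,3,1) _ 4 hx(1)]) (simp, simp, blast intro: gp ge')
  next
    case 5
    show ?thesis by (rule fin[of 4 e a b, OF _ _ sums(4) prods(4) nz(3,1,2) _ 5 hx(2)]) (simp, simp, blast intro: gp ge)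
  next
    case 6
    show ?thesis by (rule fin[of 5 e b a, OF _ _ sums(5) prods(5) nz(3,2,1) _ 6 hx(1)]) (simp, simp, blast intro: gp ge')
  qed
qed

theorem theorem1p9:
  shows "\<exists>C>0. \<forall>B::real. B \<ge> 2 \<longrightarrow> real (N_U2 B) \<le> C * B * (ln B) ^ 6"
proof -
  obtain C where C: "C \<ge> 0" "\<And>B. B \<ge> 2 \<Longrightarrow> finite (torsor_set B) \<and> real (card (torsor_set B)) \<le> C * B * ln B ^ 6"
    using torsor_set_bound by metis
  show ?thesis
  \<comment> \<open>There are 12 = 6 * 2 pairs of an order and a sign; adding 1 makes the constant
    positive even when C = 0.\<close>
  proof (intro exI[of _ "12 * C + 1"] conjI allI impI)
    fix B :: real assume B: "B \<ge> 2"
    let ?K = "{..<6::nat} \<times> {1,-1::int} \<times> torsor_set B"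
    have fin: "finite ?K" using C(2)[OF B] by simp
    have "N_U2 B \<le> card ?K" unfolding N_U2_def
      by (rule surj_card_le[OF fin U2_points_subset_torsor_points[OF B]])
    also have "card ?K = 12 * card (torsor_set B)" by (simp add: card_cartesian_product)
    finally have "real (N_U2 B) \<le> 12 * real (card (torsor_set B))"
      by (metis of_nat_le_iff of_nat_mult of_nat_numeral)
    also have "\<dots> \<le> 12 * (C * B * ln B ^ 6)" using C(2)[OF B] by simp
    also have "\<dots> \<le> (12 * C + 1) * B * ln B ^ 6" using B by (simp add: algebra_simps)
    finally show "real (N_U2 B) \<le> (12 * C + 1) * B * (ln B) ^ 6" .
  qed (use C in simp)
qed

end
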